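(* The $1$-DSP problem is $W[1]$-hard when parameterized by the number $l$ of requests.
   Context: Graphs are finite, simple and undirected. A graph $G$ is a $1$-shortest graph if there is a partition $(V_1,\dots,V_m)$ of $V(G)$ such that every edge of $G$ has one endpoint in $V_j$ and the other in $V_{j+1}$ for some $j\in\{1,\dots,m-1\}$; the graph is given together with such a partition. A path $x_1,\dots,x_r$ is a path of colour $1$ if for every $j\in\{1,\dots,r-1\}$ there is an index $q$ with $x_j\in V_q$ and $x_{j+1}\in V_{q+1}$. A path of colour $1$ between $x$ and $y$ is one whose endpoints are $x$ and $y$ (in either orientation). The $1$-DSP problem: given a $1$-shortest graph $G$ and $l$ pairs of vertices $(s_1,t_1),\dots,(s_l,t_l)$ (the requests), decide whether there are pairwise internally vertex-disjoint paths $P_1,\dots,P_l$ such that for each $i$, $P_i$ is a path of colour $1$ between $s_i$ and $t_i$. Two paths are internally vertex-disjoint if no internal vertex of one is a vertex of the other (they may share endpoints). *)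

theory Defs
  imports Complex_Main "HOL-Library.Disjoint_Sets"
begin

section \<open>Machine model\<close>

text \<open>
  Running times and computability refer to WHILE programs over binary trees (in the style of
  N. D. Jones, Computability and Complexity from a Programming Perspective). A tree with \<open>n\<close> nodes
  is the same thing as a word over two brackets of length linear in \<open>n\<close>. An assignment is charged
  the number of nodes of the tree that it stores, so sharing does not make huge trees cheap, and
  each test costs one step. Hence this model and multitape Turing machines simulate each other with
  polynomial overhead.
\<close>

datatype data = Nl | Cns data data

primrec nodes :: "data \<Rightarrow> nat" where
  "nodes Nl = 1"
| "nodes (Cns x y) = 1 + nodes x + nodes y"

type_synonym state = "nat \<Rightarrow> data"

datatype expr = ENil | EVar nat | ECons nat nat | EHd nat | ETl nat

fun eval_expr :: "expr \<Rightarrow> state \<Rightarrow> data" where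
  "eval_expr ENil s = Nl"
| "eval_expr (EVar x) s = s x"
| "eval_expr (ECons x y) s = Cns (s x) (s y)"
| "eval_expr (EHd x) s = (case s x of Nl \<Rightarrow> Nl | Cns u v \<Rightarrow> u)"
| "eval_expr (ETl x) s = (case s x of Nl \<Rightarrow> Nl | Cns u v \<Rightarrow> v)"

datatype prog =
    Assign nat expr
  | Seq prog prog
  | Cond nat prog prog
  | While nat prog

text \<open>\<open>exec c s t s'\<close>: started in state \<open>s\<close>, program \<open>c\<close> halts in state \<open>s'\<close> after time \<open>t\<close>.
  A test succeeds iff the variable tested is not \<open>Nl\<close>.\<close>

inductive exec :: "prog \<Rightarrow> state \<Rightarrow> nat \<Rightarrow> state \<Rightarrow> bool" where
  Assign: "exec (Assign x e) s (1 + nodes (eval_expr e s)) (s(x := eval_expr e s))"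
| Seq: "exec c1 s t1 s' \<Longrightarrow> exec c2 s' t2 s'' \<Longrightarrow> exec (Seq c1 c2) s (t1 + t2) s''"
| CondTrue: "s x \<noteq> Nl \<Longrightarrow> exec c1 s t s' \<Longrightarrow> exec (Cond x c1 c2) s (1 + t) s'"
| CondFalse: "s x = Nl \<Longrightarrow> exec c2 s t s' \<Longrightarrow> exec (Cond x c1 c2) s (1 + t) s'"
| WhileFalse: "s x = Nl \<Longrightarrow> exec (While x c) s 1 s"
| WhileTrue: "s x \<noteq> Nl \<Longrightarrow> exec c s t1 s' \<Longrightarrow> exec (While x c) s' t2 s'' \<Longrightarrow>
    exec (While x c) s (1 + t1 + t2) s''"

text \<open>Input and output are in variable \<open>0\<close>; all other variables are initially \<open>Nl\<close>.\<close>

definition computes_within :: "prog \<Rightarrow> data \<Rightarrow> data \<Rightarrow> nat \<Rightarrow> bool" where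
  "computes_within c x y t \<longleftrightarrow> (\<exists>t' s'. t' \<le> t \<and> exec c ((\<lambda>_. Nl)(0 := x)) t' s' \<and> s' 0 = y)"


section \<open>Encodings\<close>

text \<open>Natural numbers are encoded in unary. Unary numbers occur below only as parameters and as
  indices or counts of vertices or gates, which are bounded by the size of the encoded object.\<close>

primrec enc_nat :: "nat \<Rightarrow> data" where
  "enc_nat 0 = Nl"
| "enc_nat (Suc n) = Cns Nl (enc_nat n)"

primrec enc_list :: "('a \<Rightarrow> data) \<Rightarrow> 'a list \<Rightarrow> data" where
  "enc_list f [] = Nl"
| "enc_list f (x # xs) = Cns (f x) (enc_list f xs)"

definition enc_pair :: "('a \<Rightarrow> data) \<Rightarrow> ('b \<Rightarrow> data) \<Rightarrow> 'a \<times> 'b \<Rightarrow> data" where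
  "enc_pair f g p = Cns (f (fst p)) (g (snd p))"

lemma inj_enc_nat: "inj enc_nat"
proof (rule injI)
  fix m n show "enc_nat m = enc_nat n \<Longrightarrow> m = n"
  proof (induction m arbitrary: n)
    case 0 then show ?case by (cases n) auto
  next
    case (Suc m) then show ?case by (cases n) auto
  qed
qed

lemma inj_enc_list:
  assumes "inj f" shows "inj (enc_list f)"
proof (rule injI)
  fix xs ys show "enc_list f xs = enc_list f ys \<Longrightarrow> xs = ys"
  proof (induction xs arbitrary: ys)
    case Nil then show ?case by (cases ys) auto
  next
    case (Cons x xs) then show ?case using assms by (cases ys) (auto dest: injD)
  qed
qed

lemma inj_enc_pair: "inj f \<Longrightarrow> inj g \<Longrightarrow> inj (enc_pair f g)"
  by (auto simp: inj_def enc_pair_def)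


section \<open>Parameterized problems and fpt-reductions\<close>

text \<open>A parameterized problem is the set of its yes-instances (instance, parameter).\<close>

type_synonym pproblem = "(data \<times> nat) set"

definition computable :: "(nat \<Rightarrow> nat) \<Rightarrow> bool" where
  "computable f \<longleftrightarrow> (\<exists>c. \<forall>n. \<exists>t. computes_within c (enc_nat n) (enc_nat (f n)) t)"

definition fpt_reducible :: "pproblem \<Rightarrow> pproblem \<Rightarrow> bool" (infix \<open>\<le>\<^sub>f\<^sub>p\<^sub>t\<close> 50) where
  "A \<le>\<^sub>f\<^sub>p\<^sub>t B \<longleftrightarrow>
    (\<exists>R :: data \<times> nat \<Rightarrow> data \<times> nat.
      (\<forall>x k. (x, k) \<in> A \<longleftrightarrow> R (x, k) \<in> B) \<and>
      (\<exists>g. computable g \<and> (\<forall>x k. snd (R (x, k)) \<le> g k)) \<and>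
      (\<exists>f c P. computable f \<and>
        (\<forall>x k. computes_within P (enc_pair id enc_nat (x, k)) (enc_pair id enc_nat (R (x, k)))
                 (f k * nodes x ^ c))))"


section \<open>Boolean circuits and the W-hierarchy\<close>

text \<open>
  A circuit is a directed acyclic graph listed in topological order: the gate at position \<open>i\<close> refers
  to gates at positions less than \<open>i\<close>. The last gate is the output. Conjunctions and disjunctions
  have at least two predecessors.
\<close>

datatype gate = InG | NotG nat | AndG "nat list" | OrG "nat list"

type_synonym circuit = "gate list"

fun preds :: "gate \<Rightarrow> nat list" where
  "preds InG = []"
| "preds (NotG j) = [j]"
| "preds (AndG js) = js"
| "preds (OrG js) = js"

fun arity_ok :: "gate \<Rightarrow> bool" where
  "arity_ok (AndG js) \<longleftrightarrow> length js \<ge> 2"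
| "arity_ok (OrG js) \<longleftrightarrow> length js \<ge> 2"
| "arity_ok _ \<longleftrightarrow> True"

definition wf_circuit :: "circuit \<Rightarrow> bool" where
  "wf_circuit C \<longleftrightarrow> C \<noteq> [] \<and>
    (\<forall>i<length C. arity_ok (C ! i) \<and> distinct (preds (C ! i)) \<and> (\<forall>j\<in>set (preds (C ! i)). j < i))"

text \<open>\<open>vs\<close> lists the values of the preceding gates; the input gate at position \<open>i\<close> has value \<open>a i\<close>.\<close>

fun gate_value :: "(nat \<Rightarrow> bool) \<Rightarrow> bool list \<Rightarrow> gate \<Rightarrow> bool" where
  "gate_value a vs InG \<longleftrightarrow> a (length vs)"
| "gate_value a vs (NotG j) \<longleftrightarrow> \<not> vs ! j"
| "gate_value a vs (AndG js) \<longleftrightarrow> (\<forall>j\<in>set js. vs ! j)"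
| "gate_value a vs (OrG js) \<longleftrightarrow> (\<exists>j\<in>set js. vs ! j)"

definition gate_values :: "(nat \<Rightarrow> bool) \<Rightarrow> circuit \<Rightarrow> bool list" where
  "gate_values a C = foldl (\<lambda>vs g. vs @ [gate_value a vs g]) [] C"

definition circuit_output :: "(nat \<Rightarrow> bool) \<Rightarrow> circuit \<Rightarrow> bool" where
  "circuit_output a C = last (gate_values a C)"

definition weight :: "(nat \<Rightarrow> bool) \<Rightarrow> circuit \<Rightarrow> nat" where
  "weight a C = card {i. i < length C \<and> C ! i = InG \<and> a i}"

definition in_out_path :: "circuit \<Rightarrow> nat list \<Rightarrow> bool" where
  "in_out_path C p \<longleftrightarrow> p \<noteq> [] \<and> set p \<subseteq> {..<length C} \<and> C ! hd p = InG \<and>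
    last p = length C - 1 \<and> (\<forall>j. Suc j < length p \<longrightarrow> p ! j \<in> set (preds (C ! (p ! Suc j))))"

definition depth_le :: "circuit \<Rightarrow> nat \<Rightarrow> bool" where
  "depth_le C d \<longleftrightarrow> (\<forall>p. in_out_path C p \<longrightarrow> length p - 1 \<le> d)"

definition large :: "gate \<Rightarrow> bool" where
  "large g \<longleftrightarrow> length (preds g) > 2"

definition weft_le :: "circuit \<Rightarrow> nat \<Rightarrow> bool" where
  "weft_le C t \<longleftrightarrow> (\<forall>p. in_out_path C p \<longrightarrow> length (filter (\<lambda>i. large (C ! i)) p) \<le> t)"

primrec enc_gate :: "gate \<Rightarrow> data" where
  "enc_gate InG = Cns (enc_nat 0) Nl"
| "enc_gate (NotG j) = Cns (enc_nat 1) (enc_nat j)"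
| "enc_gate (AndG js) = Cns (enc_nat 2) (enc_list enc_nat js)"
| "enc_gate (OrG js) = Cns (enc_nat 3) (enc_list enc_nat js)"

definition enc_circuit :: "circuit \<Rightarrow> data" where
  "enc_circuit = enc_list enc_gate"

lemma inj_enc_gate: "inj enc_gate"
proof (rule injI)
  fix g h show "enc_gate g = enc_gate h \<Longrightarrow> g = h"
    by (cases g; cases h)
      (auto simp: numeral_eq_Suc dest: injD[OF inj_enc_nat] injD[OF inj_enc_list[OF inj_enc_nat]])
qed

lemma inj_enc_circuit: "inj enc_circuit"
  unfolding enc_circuit_def by (rule inj_enc_list[OF inj_enc_gate])

text \<open>Weighted circuit satisfiability for circuits of weft at most \<open>t\<close> and depth at most \<open>d\<close>.\<close>

definition WCS :: "nat \<Rightarrow> nat \<Rightarrow> pproblem" where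
  "WCS t d = {(enc_circuit C, k) | C k.
     wf_circuit C \<and> weft_le C t \<and> depth_le C d \<and> (\<exists>a. weight a C = k \<and> circuit_output a C)}"

definition W :: "nat \<Rightarrow> pproblem set" where
  "W t = {A. \<exists>d\<ge>1. A \<le>\<^sub>f\<^sub>p\<^sub>t WCS t d}"

definition W_hard :: "nat \<Rightarrow> pproblem \<Rightarrow> bool" where
  "W_hard t B \<longleftrightarrow> (\<forall>A\<in>W t. A \<le>\<^sub>f\<^sub>p\<^sub>t B)"


section \<open>The 1-DSP problem\<close>

definition simple_graph :: "'a set \<Rightarrow> 'a set set \<Rightarrow> bool" where
  "simple_graph V E \<longleftrightarrow> finite V \<and> (\<forall>e\<in>E. \<exists>u\<in>V. \<exists>v\<in>V. u \<noteq> v \<and> e = {u, v})"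

definition one_shortest_graph :: "'a set \<Rightarrow> 'a set set \<Rightarrow> 'a set list \<Rightarrow> bool" where
  "one_shortest_graph V E Vs \<longleftrightarrow> simple_graph V E \<and> partition_on V (set Vs) \<and> distinct Vs \<and>
    (\<forall>e\<in>E. \<exists>j u v. Suc j < length Vs \<and> u \<in> Vs ! j \<and> v \<in> Vs ! Suc j \<and> e = {u, v})"

definition is_path :: "'a set \<Rightarrow> 'a set set \<Rightarrow> 'a list \<Rightarrow> bool" where
  "is_path V E p \<longleftrightarrow> p \<noteq> [] \<and> distinct p \<and> set p \<subseteq> V \<and>
    (\<forall>j. Suc j < length p \<longrightarrow> {p ! j, p ! Suc j} \<in> E)"

definition colour1_path :: "'a set \<Rightarrow> 'a set set \<Rightarrow> 'a set list \<Rightarrow> 'a list \<Rightarrow> bool" where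
  "colour1_path V E Vs p \<longleftrightarrow> is_path V E p \<and>
    (\<forall>j. Suc j < length p \<longrightarrow> (\<exists>q. Suc q < length Vs \<and> p ! j \<in> Vs ! q \<and> p ! Suc j \<in> Vs ! Suc q))"

definition path_between :: "'a list \<Rightarrow> 'a \<Rightarrow> 'a \<Rightarrow> bool" where
  "path_between p x y \<longleftrightarrow> hd p = x \<and> last p = y \<or> hd p = y \<and> last p = x"

definition internal :: "'a list \<Rightarrow> 'a set" where
  "internal p = set p - {hd p, last p}"

definition internally_disjoint :: "'a list \<Rightarrow> 'a list \<Rightarrow> bool" where
  "internally_disjoint p p' \<longleftrightarrow> internal p \<inter> set p' = {} \<and> internal p' \<inter> set p = {}"

definition DSP_solvable :: "'a set \<Rightarrow> 'a set set \<Rightarrow> 'a set list \<Rightarrow> ('a \<times> 'a) list \<Rightarrow> bool" where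
  "DSP_solvable V E Vs rs \<longleftrightarrow> (\<exists>Ps :: 'a list list. length Ps = length rs \<and>
     (\<forall>i<length rs. colour1_path V E Vs (Ps ! i) \<and>
        path_between (Ps ! i) (fst (rs ! i)) (snd (rs ! i))) \<and>
     (\<forall>i<length rs. \<forall>j<length rs. i \<noteq> j \<longrightarrow> internally_disjoint (Ps ! i) (Ps ! j)))"

text \<open>
  An instance has vertex set \<open>{..<n}\<close>; \<open>vss\<close> lists the members of the parts in their order, \<open>es\<close>
  the edges (in any orientation) and \<open>rs\<close> the requests.
\<close>

type_synonym dsp_instance =
  "nat \<times> nat list list \<times> (nat \<times> nat) list \<times> (nat \<times> nat) list"

definition enc_dsp :: "dsp_instance \<Rightarrow> data" where
  "enc_dsp = enc_pair enc_nat (enc_pair (enc_list (enc_list enc_nat))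
     (enc_pair (enc_list (enc_pair enc_nat enc_nat)) (enc_list (enc_pair enc_nat enc_nat))))"

lemma inj_enc_dsp: "inj enc_dsp"
  unfolding enc_dsp_def by (intro inj_enc_pair inj_enc_list inj_enc_nat)

definition one_DSP :: pproblem where
  "one_DSP = {(enc_dsp (n, vss, es, rs), length rs) | n vss es rs.
     (let V = {..<n}; E = (\<lambda>(u, v). {u, v}) ` set es; Vs = map set vss in
       one_shortest_graph V E Vs \<and> set rs \<subseteq> V \<times> V \<and> DSP_solvable V E Vs rs)}"

end

theory Submission
  imports Defs
begin

text \<open>
  Since fpt-reductions compose, it suffices to reduce \<open>WCS 1 d\<close> to \<open>one_DSP\<close> in polynomial time,
  for every \<open>d\<close>.

  Let \<open>q = 2 ^ d\<close>. Knowing two consecutive members of a set of \<open>k\<close> selected inputs decides every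
  input between them, so any \<open>q\<close> inputs are decided by \<open>q\<close> of the \<open>k + 1\<close> gaps. In a circuit of
  weft 1 and depth \<open>d\<close>, a true output is therefore certified by some \<open>q\<close> gaps \<open>J\<close> that survive all
  refutation attempts by \<open>q\<close> gaps \<open>I\<close>: \<open>J\<close> certifies the chosen true (false) predecessors of large
  disjunctions (conjunctions), and a wrong certificate is refuted by few inputs. A selection thus
  amounts to one local view (the contents of the gaps in \<open>J\<close> and \<open>I\<close>) for each of the
  \<open>(k + 1) ^ q\<close> index tuples \<open>I\<close>, such that every two views agree: a binary constraint problem whose
  number of variables is bounded in terms of \<open>k\<close>.

  Directed disjoint paths in a graph with layers \<open>0, \<dots>, T\<close> are tokens that move between places at
  times \<open>0, \<dots>, T\<close> and never meet. For each variable \<open>p\<close> a value token runs through all values in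
  turn; for every value other than the selected one it visits the two gates of each verifier that
  waits to cross there. For each pair of variables a verifier has to cross in the phase of the first
  variable and then in the phase of the second one, which it can do only at the selected values, and
  it remembers the first value in order to test the constraint. Tokens carry no identity when they
  leave a shared gate, and the point of the two gates is that a verifier that follows the track of the
  value token instead of its own gets trapped or collides.
\<close>


section \<open>Polynomial-time and computable functions\<close>

text \<open>The parameter leaves no room for a token per input, so even "not selected" has to be
  expressed by boundedly many objects. Gaps do this: there are only \<open>Suc k\<close> gap
  indices, while the positions of their ends range over polynomially many values. Index tuples
  therefore become variables and positions become values. The constant \<open>2 ^ d\<close> is the
  number of inputs below a gate of depth \<open>d\<close> when all fan-ins are at most two. A large
  gate does not raise it, because a single predecessor is followed there, and weft 1 guarantees that
  this predecessor has only small gates below it. Each variable is chosen twice, once as first and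
  once as second member of the pairs, and only pairs of a first with a second copy are tested. This
  suffices because the pair of a variable with itself is among them. With \<open>L\<close> variables
  there are \<open>2 * L\<close> value tokens, one per phase, and \<open>L * L\<close> verifiers, so
  the number of requests does not depend on the number of values; the latter affects only the length
  of the time axis and the number of places.\<close>

class encd =
  fixes encode :: "'a \<Rightarrow> data"
  assumes inj_encode: "inj encode"

instantiation data :: encd begin
definition "encode = (\<lambda>x :: data. x)"
instance by standard (simp add: encode_data_def)
end

instantiation nat :: encd begin
definition "encode = enc_nat"
instance by standard (simp add: encode_nat_def inj_enc_nat)
end

instantiation bool :: encd begin
definition "encode b = (if b then Cns Nl Nl else Nl)"
instance by standard (auto simp: encode_bool_def inj_def)
end

instantiation prod :: (encd, encd) encd begin
definition "encode = enc_pair encode encode"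
instance by standard (simp add: encode_prod_def inj_enc_pair inj_encode)
end

instantiation list :: (encd) encd begin
definition "encode = enc_list encode"
instance by standard (simp add: encode_list_def inj_enc_list inj_encode)
end

lemma encode_data [simp]: "encode (d :: data) = d"
  by (simp add: encode_data_def)

lemma encode_nat [simp]: "encode (0 :: nat) = Nl" "encode (Suc n) = Cns Nl (encode n)"
  by (simp_all add: encode_nat_def)

lemma encode_bool [simp]: "encode False = Nl" "encode True = Cns Nl Nl"
  by (simp_all add: encode_bool_def)

lemma encode_Pair [simp]: "encode (x, y) = Cns (encode x) (encode y)"
  by (simp add: encode_prod_def enc_pair_def)

lemma encode_list [simp]: "encode [] = Nl" "encode (x # xs) = Cns (encode x) (encode xs)"
  by (simp_all add: encode_list_def)

lemma encode_eq_iff [simp]: "encode x = encode y \<longleftrightarrow> x = y"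
  by (meson inj_encode injD)

lemma encode_prod_case: "encode p = Cns (encode (fst p)) (encode (snd p))"
  by (cases p) simp

section \<open>Sizes of encoded objects\<close>

abbreviation sz :: "'a::encd \<Rightarrow> nat" where "sz x \<equiv> nodes (encode x)"

lemma nodes_pos [simp]: "0 < nodes d" by (cases d) auto

lemma nodes_ge_1: "1 \<le> nodes d" by (cases d) auto

lemma sz_pair: "sz p = 1 + sz (fst p) + sz (snd p)"
  by (simp add: encode_prod_case)

lemma sz_nat [simp]: "sz (n :: nat) = 2 * n + 1"
  by (induction n) auto

lemma sz_bool_le: "sz (b :: bool) \<le> 3"
  by (cases b) auto

lemma sz_list: "sz xs = 1 + (\<Sum>x\<leftarrow>xs. 1 + sz x)"
  by (induction xs) auto

lemma length_le_sz: "length xs \<le> sz xs"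
  by (induction xs) auto

lemma sz_append: "sz (xs @ ys) + 1 = sz xs + sz ys"
  by (simp add: sz_list)

lemma sz_rev [simp]: "sz (rev xs) = sz xs"
  by (simp add: sz_list flip: rev_map)

lemma sz_member: "x \<in> set xs \<Longrightarrow> sz x < sz xs"
  by (induction xs) auto

lemma sz_take_le: "sz (take n xs) \<le> sz xs"
  using sz_append[of "take n xs" "drop n xs"] nodes_ge_1[of "encode (drop n xs)"] by simp

lemma sz_drop_le: "sz (drop n xs) \<le> sz xs"
  using sz_append[of "take n xs" "drop n xs"] nodes_ge_1[of "encode (take n xs)"] by simp

lemma sz_list_le: "(\<And>x. x \<in> set xs \<Longrightarrow> sz x \<le> B) \<Longrightarrow> sz xs \<le> 1 + length xs * (1 + B)"
proof (induction xs)
  case (Cons x xs)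
  then have "sz x \<le> B" "sz xs \<le> 1 + length xs * (1 + B)" by auto
  then show ?case by simp
qed simp


text \<open>An assignment is charged the size of the tree it stores, so a register outgrows its old
  content by at most the time spent. Output sizes are thus controlled by running times.\<close>

lemma exec_nodes: "exec c s t s' \<Longrightarrow> nodes (s' v) \<le> nodes (s v) + t"
proof (induction arbitrary: v rule: exec.induct)
  case (Seq c1 s t1 s' c2 t2 s'')
  from Seq.IH(1)[of v] Seq.IH(2)[of v] show ?case by simp
next
  case (WhileTrue s x c t1 s' t2 s'')
  from WhileTrue.IH(1)[of v] WhileTrue.IH(2)[of v] show ?case by simp
qed (auto intro: le_SucI)

lemma exec_AssignI:
  "s' = s(x := eval_expr e s) \<Longrightarrow> t = 1 + nodes (eval_expr e s) \<Longrightarrow> exec (Assign x e) s t s'"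
  using exec.Assign by auto

text \<open>Scratch registers must be \<open>Nl\<close> on entry and are \<open>Nl\<close> again on exit, which is what makes
  programs composable without renaming registers.\<close>

definition impl :: "prog \<Rightarrow> nat \<Rightarrow> ('a::encd \<Rightarrow> 'b::encd) \<Rightarrow> ('a \<Rightarrow> nat) \<Rightarrow> bool" where
  "impl P N f b \<longleftrightarrow> (\<forall>s x. s 0 = encode x \<longrightarrow> (\<forall>i. 0 < i \<and> i < N \<longrightarrow> s i = Nl) \<longrightarrow>
     (\<exists>t\<le>b x. exec P s t (s(0 := encode (f x)))))"

definition comp_in :: "('a::encd \<Rightarrow> 'b::encd) \<Rightarrow> ('a \<Rightarrow> nat) \<Rightarrow> bool" where
  "comp_in f b \<longleftrightarrow> (\<exists>P N. impl P N f b)"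

lemma implD:
  assumes "impl P N f b" "s 0 = encode x" "\<And>i. 0 < i \<Longrightarrow> i < N \<Longrightarrow> s i = Nl"
  obtains t where "t \<le> b x" "exec P s t (s(0 := encode (f x)))"
  using assms unfolding impl_def by blast

lemma comp_in_mono:
  fixes f :: "'a::encd \<Rightarrow> 'b::encd"
  assumes "comp_in f b" "\<And>x. b x \<le> b' x" shows "comp_in f b'"
proof -
  from assms(1) obtain P N where "impl P N f b" unfolding comp_in_def by blast
  then have "impl P N f b'"
    unfolding impl_def
  proof (intro allI impI)
    fix s :: state and x :: 'a
    assume "s 0 = encode x" "\<forall>i. 0 < i \<and> i < N \<longrightarrow> s i = Nl"
    with \<open>impl P N f b\<close> obtain t where "t \<le> b x" "exec P s t (s(0 := encode (f x)))"
      unfolding impl_def by metis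
    with assms(2)[of x] show "\<exists>t\<le>b' x. exec P s t (s(0 := encode (f x)))"
      using le_trans by blast
  qed
  then show ?thesis unfolding comp_in_def by blast
qed

lemma comp_in_sz:
  assumes "comp_in f b" shows "sz (f x) \<le> sz x + b x"
proof -
  from assms obtain P N where P: "impl P N f b" unfolding comp_in_def by blast
  define s :: state where "s = (\<lambda>_. Nl)(0 := encode x)"
  have "s 0 = encode x" "\<forall>i. 0 < i \<and> i < N \<longrightarrow> s i = Nl" by (auto simp: s_def)
  then obtain t where t: "t \<le> b x" "exec P s t (s(0 := encode (f x)))"
    using P[unfolded impl_def, THEN spec, THEN spec, THEN mp, THEN mp, of s x] by metis
  from exec_nodes[OF t(2), of 0] t(1) show ?thesis by (simp add: s_def)
qed

lemma comp_in_comp: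
  fixes f :: "'a::encd \<Rightarrow> 'b::encd" and g :: "'b \<Rightarrow> 'c::encd"
  assumes "comp_in f b" "comp_in g c"
  shows "comp_in (\<lambda>x. g (f x)) (\<lambda>x. b x + c (f x))"
proof -
  from assms obtain P N Q M where P: "impl P N f b" and Q: "impl Q M g c"
    unfolding comp_in_def by blast
  have "impl (Seq P Q) (max N M) (\<lambda>x. g (f x)) (\<lambda>x. b x + c (f x))"
    unfolding impl_def
  proof (intro allI impI)
    fix s and x :: 'a assume s: "s 0 = encode x" "\<forall>i. 0 < i \<and> i < max N M \<longrightarrow> s i = Nl"
    obtain t where t: "t \<le> b x" "exec P s t (s(0 := encode (f x)))"
      by (rule implD[OF P, of s x]) (use s in auto)
    obtain u where u: "u \<le> c (f x)"
      "exec Q (s(0 := encode (f x))) u ((s(0 := encode (f x)))(0 := encode (g (f x))))"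
      by (rule implD[OF Q, where s = "s(0 := encode (f x))" and x = "f x"]) (use s in auto)
    have "exec (Seq P Q) s (t + u) (s(0 := encode (g (f x))))"
      using exec.Seq[OF t(2) u(2)] by simp
    then show "\<exists>t\<le>b x + c (f x). exec (Seq P Q) s t (s(0 := encode (g (f x))))"
      using t u by (meson add_mono)
  qed
  then show ?thesis unfolding comp_in_def by blast
qed

lemma comp_in_simple:
  fixes f :: "'a::encd \<Rightarrow> 'b::encd"
  assumes "\<And>s x. s 0 = encode x \<Longrightarrow> eval_expr e s = encode (f x)"
  shows "comp_in f (\<lambda>x. 1 + sz (f x))"
proof -
  have "impl (Assign 0 e) 0 f (\<lambda>x. 1 + sz (f x))"
    unfolding impl_def
  proof (intro allI impI)
    fix s :: state and x :: 'a assume "s 0 = encode x"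
    then have "exec (Assign 0 e) s (1 + sz (f x)) (s(0 := encode (f x)))"
      using exec.Assign[of 0 e s] assms by simp
    then show "\<exists>t\<le>1 + sz (f x). exec (Assign 0 e) s t (s(0 := encode (f x)))" by blast
  qed
  then show ?thesis unfolding comp_in_def by blast
qed

lemma comp_in_cast:
  assumes "\<And>x. encode (f x) = encode (x :: 'a::encd)" shows "comp_in f (\<lambda>x. 1 + sz x)"
  using comp_in_simple[of "EVar 0" f] assms by simp

lemma comp_in_fst: "comp_in fst (\<lambda>x. sz x)"
  by (rule comp_in_mono, rule comp_in_simple[of "EHd 0"]) (auto simp: encode_prod_case)

lemma comp_in_snd: "comp_in snd (\<lambda>x. sz x)"
  by (rule comp_in_mono, rule comp_in_simple[of "ETl 0"]) (auto simp: encode_prod_case)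

lemma comp_in_dup: "comp_in (\<lambda>x. (x, x)) (\<lambda>x. 2 * sz x + 2)"
  by (rule comp_in_mono, rule comp_in_simple[of "ECons 0 0"]) auto

lemma comp_in_swap: "comp_in (\<lambda>p. (snd p, fst p)) (\<lambda>p. 3 * sz p + 10)"
proof -
  let ?P = "Seq (Assign 1 (EHd 0)) (Seq (Assign 2 (ETl 0)) (Seq (Assign 0 (ECons 2 1))
    (Seq (Assign 1 ENil) (Assign 2 ENil))))"
  have "impl ?P 3 (\<lambda>p. (snd p, fst p)) (\<lambda>p. 3 * sz p + 10)"
    unfolding impl_def
  proof (intro allI impI, goal_cases)
    case (1 s p)
    obtain a b where p: "p = (a, b)" by (cases p)
    have s: "s 0 = Cns (encode a) (encode b)" "s (Suc 0) = Nl" "s 2 = Nl" using 1 p by auto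
    have "exec ?P s ((1 + sz a) + ((1 + sz b) + ((1 + sz (b, a)) + ((1 + 1) + (1 + 1)))))
        (s(0 := encode (b, a)))"
      by (rule exec.Seq, rule exec_AssignI, rule refl, simp add: s,
          rule exec.Seq, rule exec_AssignI, rule refl, simp add: s,
          rule exec.Seq, rule exec_AssignI, rule refl, simp add: s,
          rule exec.Seq, rule exec_AssignI, rule refl, simp add: s,
          rule exec_AssignI) (auto simp: s fun_eq_iff)
    moreover have "(1 + sz a) + ((1 + sz b) + ((1 + sz (b, a)) + ((1 + 1) + (1 + 1)))) \<le> 3 * sz p + 10"
      by (simp add: p)
    ultimately show ?case unfolding p fst_conv snd_conv by blast
  qed
  then show ?thesis unfolding comp_in_def by blast
qed

lemma comp_in_second:
  assumes "comp_in f b"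
  shows "comp_in (\<lambda>p. (fst p, f (snd p))) (\<lambda>p. 2 * sz p + 2 * b (snd p) + 10)"
proof -
  from assms obtain P N where P: "impl P N f b" unfolding comp_in_def by blast
  \<comment> \<open>A spare register outside the scratch range of \<open>P\<close> and different
    from the input register 0.\<close>
  define M where "M = max N 1"
  let ?Q = "Seq (Assign M (EHd 0)) (Seq (Assign 0 (ETl 0)) (Seq P
    (Seq (Assign 0 (ECons M 0)) (Assign M ENil))))"
  have "impl ?Q (Suc M) (\<lambda>p. (fst p, f (snd p))) (\<lambda>p. 2 * sz p + 2 * b (snd p) + 10)"
    unfolding impl_def
  proof (intro allI impI, goal_cases)
    case (1 s p)
    obtain x y where p: "p = (x, y)" by (cases p)
    have s: "s 0 = Cns (encode x) (encode y)" "s M = Nl" and M: "M \<noteq> 0" using 1 p by (auto simp: M_def)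
    define s2 where "s2 = s(M := encode x, 0 := encode y)"
    obtain t where t: "t \<le> b y" "exec P s2 t (s2(0 := encode (f y)))"
      by (rule implD[OF P, where s = s2]) (use 1 in \<open>auto simp: s2_def M_def\<close>)
    have "exec ?Q s ((1 + sz x) + ((1 + sz y) + (t + ((1 + sz (x, f y)) + (1 + 1)))))
        (s(0 := encode (x, f y)))"
      by (rule exec.Seq, rule exec_AssignI, rule refl, simp add: s,
          rule exec.Seq[where s' = s2], rule exec_AssignI, (simp add: s s2_def M; fail), simp add: s M,
          rule exec.Seq, rule t,
          rule exec.Seq, rule exec_AssignI, rule refl, simp add: s2_def M,
          rule exec_AssignI) (use M in \<open>auto simp: s s2_def fun_eq_iff\<close>)
    moreover have "sz (f y) \<le> sz y + b y" by (rule comp_in_sz[OF assms])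
    then have "(1 + sz x) + ((1 + sz y) + (t + ((1 + sz (x, f y)) + (1 + 1)))) \<le> 2 * sz p + 2 * b (snd p) + 10"
      using t(1) by (simp add: p)
    ultimately show ?case unfolding p fst_conv snd_conv by blast
  qed
  then show ?thesis unfolding comp_in_def by blast
qed

text \<open>The tree is assembled node by node; the quadratic bound pays for storing subtrees again
  at every level.\<close>

lemma comp_in_const: "comp_in (\<lambda>_. y :: 'b::encd) (\<lambda>_ :: 'a::encd. 10 * sz y * sz y)"
proof -
  have "\<exists>P N. \<forall>s. (\<forall>i. 0 < i \<and> i < N \<longrightarrow> s i = Nl) \<longrightarrow> (\<exists>t\<le>10 * nodes d * nodes d. exec P s t (s(0 := d)))" for d
  proof (induction d)
    case Nl
    show ?case
      by (intro exI[of _ "Assign 0 ENil"] exI[of _ 0] allI impI exI[of _ 2] conjI exec_AssignI) auto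
  next
    case (Cns d e)
    then obtain P N Q M where
      P: "\<And>s. (\<forall>i. 0 < i \<and> i < N \<longrightarrow> s i = Nl) \<Longrightarrow> (\<exists>t\<le>10 * nodes d * nodes d. exec P s t (s(0 := d)))" and
      Q: "\<And>s. (\<forall>i. 0 < i \<and> i < M \<longrightarrow> s i = Nl) \<Longrightarrow> (\<exists>t\<le>10 * nodes e * nodes e. exec Q s t (s(0 := e)))"
      by metis
    define K where "K = max 1 (max N M)"
    let ?R = "Seq P (Seq (Assign K (EVar 0)) (Seq Q (Seq (Assign 0 (ECons K 0)) (Assign K ENil))))"
    have "\<exists>t\<le>10 * nodes (Cns d e) * nodes (Cns d e). exec ?R s t (s(0 := Cns d e))"
      if s: "\<forall>i. 0 < i \<and> i < Suc K \<longrightarrow> s i = Nl" for s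
    proof -
      have K: "K \<noteq> 0" "s K = Nl" using s by (auto simp: K_def)
      obtain t where t: "t \<le> 10 * nodes d * nodes d" "exec P s t (s(0 := d))"
        using P[of s] s unfolding K_def by (meson less_SucI less_max_iff_disj)
      define s2 where "s2 = s(0 := d, K := d)"
      obtain u where u: "u \<le> 10 * nodes e * nodes e" "exec Q s2 u (s2(0 := e))"
      proof -
        have "\<forall>i. 0 < i \<and> i < M \<longrightarrow> s2 i = Nl" using s by (auto simp: s2_def K_def)
        from Q[OF this] show ?thesis using that by blast
      qed
      have "exec ?R s (t + ((1 + nodes d) + (u + ((1 + nodes (Cns d e)) + (1 + 1))))) (s(0 := Cns d e))"
        by (rule exec.Seq, rule t,
          rule exec.Seq[where s' = s2], rule exec_AssignI, (simp add: s2_def K; fail), simp add: K,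
          rule exec.Seq, rule u,
          rule exec.Seq, rule exec_AssignI, rule refl, simp add: s2_def K,
          rule exec_AssignI) (use K in \<open>auto simp: s2_def fun_eq_iff\<close>)
      moreover have "t + ((1 + nodes d) + (u + ((1 + nodes (Cns d e)) + (1 + 1))))
          \<le> 10 * nodes (Cns d e) * nodes (Cns d e)"
        using t(1) u(1) by (simp add: algebra_simps)
      ultimately show ?thesis by blast
    qed
    then show ?case by blast
  qed
  then obtain P N where *: "\<And>s. (\<forall>i. 0 < i \<and> i < N \<longrightarrow> s i = Nl) \<Longrightarrow>
      (\<exists>t\<le>10 * sz y * sz y. exec P s t (s(0 := encode y)))" by metis
  then have "impl P N (\<lambda>_. y) (\<lambda>_ :: 'a. 10 * sz y * sz y)" unfolding impl_def by blast
  then show ?thesis unfolding comp_in_def by blast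
qed


text \<open>Programs can test only for \<open>Nl\<close>. \<open>dest\<close> captures any case
  distinction with one case encoded as \<open>Nl\<close> and the other as a pair, so lists, numbers,
  trees and Booleans share one program.\<close>

lemma comp_in_case:
  fixes dest :: "'d::encd \<Rightarrow> ('u::encd \<times> 'v::encd) option" and n :: "'a::encd \<Rightarrow> 'c::encd"
  assumes dest: "\<And>d. encode d = (case dest d of None \<Rightarrow> Nl | Some p \<Rightarrow> encode p)"
    and n: "comp_in n bn" and c: "comp_in c bc"
  shows "comp_in (\<lambda>z. case dest (snd z) of None \<Rightarrow> n (fst z) | Some p \<Rightarrow> c (fst z, p))
    (\<lambda>z. 2 * sz z + 10 + (case dest (snd z) of None \<Rightarrow> bn (fst z) | Some p \<Rightarrow> bc (fst z, p)))"
    (is "comp_in ?f ?b")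
proof -
  from n c obtain P N Q K where P: "impl P N n bn" and Q: "impl Q K c bc"
    unfolding comp_in_def by blast
  define M where "M = Suc (max N K)"
  let ?R = "Seq (Assign M (ETl 0)) (Cond M (Seq (Assign M ENil) Q) (Seq (Assign 0 (EHd 0)) P))"
  have "impl ?R (Suc M) ?f ?b"
    unfolding impl_def
  proof (intro allI impI, goal_cases)
    case (1 s z)
    have s: "s 0 = Cns (encode (fst z)) (encode (snd z))" "s M = Nl" and M: "M \<noteq> 0" "M > N" "M > K"
      using 1 by (auto simp: M_def encode_prod_case)
    show ?case
    proof (cases "dest (snd z)")
      case None
      then have z: "encode (snd z) = Nl" using dest by simp
      define s2 where "s2 = s(0 := encode (fst z))"
      obtain t where t: "t \<le> bn (fst z)" "exec P s2 t (s2(0 := encode (n (fst z))))"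
        by (rule implD[OF P, where s = s2 and x = "fst z"]) (use 1 M in \<open>auto simp: s2_def\<close>)
      have "exec ?R s ((1 + 1) + (1 + ((1 + sz (fst z)) + t))) (s(0 := encode (n (fst z))))"
        by (rule exec.Seq[where s' = s], rule exec_AssignI, (use s z in \<open>simp add: fun_eq_iff; fail\<close>),
            simp add: s z, rule exec.CondFalse, rule s, rule exec.Seq[where s' = s2],
            rule exec_AssignI, (simp add: s2_def s; fail), simp add: s, use t in \<open>simp add: s2_def\<close>)
      moreover have "(1 + 1) + (1 + ((1 + sz (fst z)) + t)) \<le> ?b z"
        using t(1) None by (simp add: sz_pair[of z])
      ultimately have "\<exists>t\<le>?b z. exec ?R s t (s(0 := encode (n (fst z))))" by blast
      then show ?thesis using None by simp
    next
      case (Some p)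
      then have z: "encode (snd z) = encode p" using dest by simp
      \<comment> \<open>Register 0 already holds the encoding of \<open>(fst z, p)\<close>, since
        \<open>snd z\<close> and \<open>p\<close> have equal encodings; only \<open>M\<close> has to
        be cleared before \<open>Q\<close> runs.\<close>
      obtain t where t: "t \<le> bc (fst z, p)" "exec Q s t (s(0 := encode (c (fst z, p))))"
        by (rule implD[OF Q, where s = s and x = "(fst z, p)"]) (use 1 M s z in auto)
      have "exec ?R s ((1 + sz p) + (1 + ((1 + 1) + t))) (s(0 := encode (c (fst z, p))))"
        by (rule exec.Seq[where s' = "s(M := encode p)"], rule exec_AssignI, simp add: s z, simp add: s z,
          rule exec.CondTrue, simp add: encode_prod_case, rule exec.Seq[where s' = s],
          rule exec_AssignI, (use s in \<open>simp add: fun_eq_iff; fail\<close>), simp, rule t)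
      moreover have "(1 + sz p) + (1 + ((1 + 1) + t)) \<le> ?b z"
        using t(1) Some z by (simp add: sz_pair[of z])
      ultimately have "\<exists>t\<le>?b z. exec ?R s t (s(0 := encode (c (fst z, p))))" by blast
      then show ?thesis using Some by simp
    qed
  qed
  then show ?thesis unfolding comp_in_def by blast
qed

text \<open>Termination is supplied as data: \<open>it z\<close> is the complete trace of the loop
  on \<open>z\<close>, its flag is what the loop tests, and \<open>n z\<close> is the number of
  rounds. \<open>B z\<close> bounds every state and the cost of every round.\<close>

lemma comp_in_while:
  fixes f :: "'a::encd \<Rightarrow> bool \<times> 'a" and h :: "'i::encd \<Rightarrow> bool \<times> 'a"
  assumes f: "comp_in f b" and h: "comp_in h bh"
    and it0: "\<And>z. it z 0 = h z"
    and it_Suc: "\<And>z i. i < n z \<Longrightarrow> fst (it z i) \<and> it z (Suc i) = f (snd (it z i)) \<and> b (snd (it z i)) \<le> B z"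
    and it_n: "\<And>z. \<not> fst (it z (n z))" and it_sz: "\<And>z i. i \<le> n z \<Longrightarrow> sz (it z i) \<le> B z"
  shows "comp_in (\<lambda>z. snd (it z (n z))) (\<lambda>z. bh z + (n z + 1) * (2 * B z + 20))"
proof -
  from f h obtain P N Q K where P: "impl P N f b" and Q: "impl Q K h bh"
    unfolding comp_in_def by blast
  define M where "M = Suc (max N K)"
  define body where "body = Seq (Assign M ENil) (Seq (Assign 0 (ETl 0)) (Seq P (Assign M (EHd 0))))"
  let ?R = "Seq Q (Seq (Assign M (EHd 0)) (Seq (While M body) (Assign 0 (ETl 0))))"
  have "impl ?R (Suc M) (\<lambda>z. snd (it z (n z))) (\<lambda>z. bh z + (n z + 1) * (2 * B z + 20))"
    unfolding impl_def
  proof (intro allI impI, goal_cases)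
    case (1 s z)
    have M: "M \<noteq> 0" "M > N" "M > K" by (auto simp: M_def)
    have sM: "s M = Nl" using 1 M by simp
    define st where "st i = s(0 := encode (it z i), M := encode (fst (it z i)))" for i
    have loop: "\<exists>t \<le> (n z - i) * (2 * B z + 19) + 1. exec (While M body) (st i) t (st (n z))" if "i \<le> n z" for i
      using that
    proof (induction rule: inc_induct)
      case base
      have "exec (While M body) (st (n z)) 1 (st (n z))"
        by (rule exec.WhileFalse) (simp add: st_def it_n)
      then show ?case by auto
    next
      case (step i)
      have fi: "fst (it z i)" and Si: "it z (Suc i) = f (snd (it z i))" and bi: "b (snd (it z i)) \<le> B z"
        using it_Suc step.hyps by auto
      define s2 where "s2 = s(0 := encode (snd (it z i)))"
      obtain t where t: "t \<le> b (snd (it z i))" "exec P s2 t (s2(0 := encode (f (snd (it z i)))))"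
        by (rule implD[OF P, where s = s2 and x = "snd (it z i)"]) (use 1 M in \<open>auto simp: s2_def\<close>)
      have "exec body (st i) ((1 + 1) + ((1 + sz (snd (it z i))) + (t + (1 + sz (fst (it z (Suc i)))))))
          (st (Suc i))"
        unfolding body_def
        by (rule exec.Seq, rule exec_AssignI, rule refl, simp,
            rule exec.Seq[where s' = s2], rule exec_AssignI,
            (use sM M in \<open>simp add: s2_def st_def encode_prod_case[of "it z i"] fun_eq_iff; fail\<close>),
            (use M in \<open>simp add: st_def encode_prod_case[of "it z i"]; fail\<close>),
            rule exec.Seq, rule t, rule exec_AssignI)
           (use M Si in \<open>auto simp: st_def s2_def encode_prod_case[of "f _"]\<close>)
      moreover obtain u where "u \<le> (n z - Suc i) * (2 * B z + 19) + 1" "exec (While M body) (st (Suc i)) u (st (n z))"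
        using step.IH by blast
      moreover have "st i M \<noteq> Nl" using fi by (simp add: st_def)
      ultimately have "exec (While M body) (st i)
          (1 + ((1 + 1) + ((1 + sz (snd (it z i))) + (t + (1 + sz (fst (it z (Suc i))))))) + u) (st (n z))"
        by (intro exec.WhileTrue)
      moreover have "1 + ((1 + 1) + ((1 + sz (snd (it z i))) + (t + (1 + sz (fst (it z (Suc i))))))) + u
          \<le> (n z - i) * (2 * B z + 19) + 1"
      proof -
        have "sz (snd (it z i)) \<le> B z" using it_sz[of i z] step.hyps by (simp add: sz_pair)
        moreover have "sz (fst (it z (Suc i))) \<le> 3" by (rule sz_bool_le)
        moreover have "n z - i = Suc (n z - Suc i)" using step.hyps by simp
        ultimately show ?thesis using t(1) bi \<open>u \<le> _\<close> by simp
      qed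
      ultimately show ?case by blast
    qed
    obtain u where u: "u \<le> n z * (2 * B z + 19) + 1" "exec (While M body) (st 0) u (st (n z))"
      using loop[of 0] by auto
    obtain t where t: "t \<le> bh z" "exec Q s t (s(0 := encode (h z)))"
      by (rule implD[OF Q, where s = s and x = z]) (use 1 M in auto)
    have fin: "encode (fst (it z (n z))) = Nl" using it_n by simp
    have "exec ?R s (t + ((1 + sz (fst (h z))) + (u + (1 + sz (snd (it z (n z)))))))
        (s(0 := encode (snd (it z (n z)))))"
      by (rule exec.Seq, rule t, rule exec.Seq[where s' = "st 0"], rule exec_AssignI,
          (use M in \<open>simp add: st_def it0 encode_prod_case[of "h z"]; fail\<close>),
          (simp add: encode_prod_case[of "h z"]; fail),
          rule exec.Seq, rule u, rule exec_AssignI)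
         (use M sM fin in \<open>auto simp: st_def encode_prod_case[of "it z (n z)"] fun_eq_iff\<close>)
    moreover have "sz (fst (h z)) \<le> 3" by (rule sz_bool_le)
    moreover have "sz (snd (it z (n z))) \<le> B z" using it_sz[of "n z" z] by (simp add: sz_pair)
    ultimately show ?case using t(1) u(1)
      by (intro exI[of _ "t + ((1 + sz (fst (h z))) + (u + (1 + sz (snd (it z (n z))))))"] conjI)
         (simp_all add: algebra_simps)
  qed
  then show ?thesis unfolding comp_in_def by blast
qed


text \<open>\<open>K = True\<close> gives the polynomial-time functions and \<open>K = False\<close> the computable ones, so
  that both classes share their closure properties.\<close>

definition pb :: "bool \<Rightarrow> ('a::encd \<Rightarrow> nat) \<Rightarrow> bool" where
  "pb K b \<longleftrightarrow> (K \<longrightarrow> (\<exists>c. \<forall>x. b x \<le> (sz x + 2) ^ c))"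

definition cm :: "bool \<Rightarrow> ('a::encd \<Rightarrow> 'b::encd) \<Rightarrow> bool" where
  "cm K f \<longleftrightarrow> (\<exists>b. comp_in f b \<and> pb K b)"

named_theorems cm_intros

section \<open>Closure of growth bounds under arithmetic\<close>

lemma pb_le: "pb K b \<Longrightarrow> (\<And>x. b' x \<le> b x) \<Longrightarrow> pb K b'"
  unfolding pb_def using le_trans by blast

lemma pb_sz_id: "pb K (\<lambda>x. sz x)"
  unfolding pb_def by (intro impI exI[of _ 1]) simp

lemma pb_const: "pb K (\<lambda>_ :: 'a::encd. k)"
proof -
  have "k \<le> (sz x + 2) ^ k" for x :: 'a
  proof -
    have "k \<le> 2 ^ k" using less_exp[of k] by simp
    also have "\<dots> \<le> (sz x + 2) ^ k" by (rule power_mono) auto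
    finally show ?thesis .
  qed
  then show ?thesis unfolding pb_def by blast
qed

lemma pb_mult: assumes "pb K b" "pb K c" shows "pb K (\<lambda>x. b x * c x)"
  unfolding pb_def
proof
  assume K
  with assms obtain i j where "\<And>x. b x \<le> (sz x + 2) ^ i" "\<And>x. c x \<le> (sz x + 2) ^ j"
    unfolding pb_def by blast
  then have "b x * c x \<le> (sz x + 2) ^ (i + j)" for x by (simp add: power_add mult_mono)
  then show "\<exists>i. \<forall>x. b x * c x \<le> (sz x + 2) ^ i" by blast
qed

lemma pb_add: assumes "pb K b" "pb K c" shows "pb K (\<lambda>x. b x + c x)"
proof -
  \<comment> \<open>\<open>b + c \<le> (b + 1) * (c + 1)\<close> reduces sums to products.\<close>
  have "pb K (\<lambda>x. (b x + 1) * (c x + 1))" if "pb K (\<lambda>x. b x + 1)" "pb K (\<lambda>x. c x + 1)"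
    by (rule pb_mult[OF that])
  moreover have "pb K (\<lambda>x. b x + 1)" if "pb K b" for b :: "'a \<Rightarrow> nat"
    unfolding pb_def
  proof
    assume K
    with that obtain i where i: "\<And>x. b x \<le> (sz x + 2) ^ i" unfolding pb_def by blast
    have "b x + 1 \<le> (sz x + 2) ^ (i + 1)" for x
    proof -
      have "b x + 1 \<le> (sz x + 2) ^ i + (sz x + 2) ^ i" using i[of x] by (intro add_mono) auto
      also have "\<dots> \<le> (sz x + 2) ^ (i + 1)" by simp
      finally show ?thesis .
    qed
    then show "\<exists>i. \<forall>x. b x + 1 \<le> (sz x + 2) ^ i" by blast
  qed
  ultimately have "pb K (\<lambda>x. (b x + 1) * (c x + 1))" using assms by blast
  then show ?thesis by (rule pb_le) simp
qed

lemma pb_power: "pb K b \<Longrightarrow> pb K (\<lambda>x. b x ^ k)"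
  by (induction k) (auto intro: pb_const pb_mult)

lemma cm_sz: assumes "cm K f" shows "pb K (\<lambda>x. sz (f x))"
proof -
  from assms obtain b where b: "comp_in f b" "pb K b" unfolding cm_def by blast
  show ?thesis by (rule pb_le[OF pb_add[OF pb_sz_id b(2)]]) (rule comp_in_sz[OF b(1)])
qed

lemma pb_comp: assumes "pb K b" "cm K f" shows "pb K (\<lambda>x. b (f x))"
proof (cases K)
  case True
  with assms(1) obtain c where c: "\<And>x. b x \<le> (sz x + 2) ^ c" unfolding pb_def by blast
  have "pb K (\<lambda>x. (sz (f x) + 2) ^ c)" by (intro pb_power pb_add pb_const cm_sz assms)
  then show ?thesis by (rule pb_le) (rule c)
qed (simp add: pb_def)

section \<open>Closure of both function classes under composition, pairing, branching and
  loops\<close>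

lemma cmI: "comp_in f b \<Longrightarrow> pb K b \<Longrightarrow> cm K f"
  unfolding cm_def by blast

lemma cm_comp:
  assumes "cm K g" "cm K f" shows "cm K (\<lambda>x. g (f x))"
proof -
  from assms(1) obtain c where c: "comp_in g c" "pb K c" unfolding cm_def by blast
  from assms(2) obtain b where b: "comp_in f b" "pb K b" unfolding cm_def by blast
  show ?thesis by (rule cmI[OF comp_in_comp[OF b(1) c(1)]]) (rule pb_add[OF b(2) pb_comp[OF c(2) assms(2)]])
qed

lemma cm_cast: "(\<And>x. encode (f x) = encode (x :: 'a::encd)) \<Longrightarrow> cm K f"
  by (rule cmI[OF comp_in_cast]) (assumption, intro pb_add pb_const pb_sz_id)

lemma cm_id [cm_intros]: "cm K (\<lambda>x. x)"
  by (rule cm_cast) simp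

lemma cm_const [cm_intros]: "cm K (\<lambda>_. y)"
  by (rule cmI[OF comp_in_const]) (rule pb_const)

lemma cm_fst [cm_intros]: "cm K f \<Longrightarrow> cm K (\<lambda>x. fst (f x))"
  by (rule cm_comp[OF cmI[OF comp_in_fst pb_sz_id]])

lemma cm_snd [cm_intros]: "cm K f \<Longrightarrow> cm K (\<lambda>x. snd (f x))"
  by (rule cm_comp[OF cmI[OF comp_in_snd pb_sz_id]])

lemma cm_dup: "cm K (\<lambda>x. (x, x))"
  by (rule cmI[OF comp_in_dup]) (intro pb_add pb_mult pb_const pb_sz_id)

lemma cm_swap: "cm K f \<Longrightarrow> cm K (\<lambda>x. (snd (f x), fst (f x)))"
  by (rule cm_comp[OF cmI[OF comp_in_swap]]) (intro pb_add pb_mult pb_const pb_sz_id)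

lemma cm_second: assumes "cm K f" shows "cm K (\<lambda>p. (fst p, f (snd p)))"
proof -
  from assms obtain b where b: "comp_in f b" "pb K b" unfolding cm_def by blast
  show ?thesis
    by (rule cmI[OF comp_in_second[OF b(1)]])
       (intro pb_add pb_mult pb_const pb_sz_id pb_comp[OF b(2) cm_snd[OF cm_id]])
qed

lemma cm_Pair [cm_intros]: assumes "cm K f" "cm K g" shows "cm K (\<lambda>x. (f x, g x))"
proof -
  have "cm K (\<lambda>x. (x, g x))" using cm_comp[OF cm_second[OF assms(2)] cm_dup] by simp
  from cm_comp[OF cm_second[OF assms(1)] cm_swap[OF this]] have "cm K (\<lambda>x. (g x, f x))" by simp
  from cm_swap[OF this] show ?thesis by simp
qed

lemma cm_case:
  fixes dest :: "'d::encd \<Rightarrow> ('u::encd \<times> 'v::encd) option"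
  assumes dest: "\<And>d. encode d = (case dest d of None \<Rightarrow> Nl | Some p \<Rightarrow> encode p)"
    and d: "cm K d" and n: "cm K n" and c: "cm K (\<lambda>z. c (fst z) (fst (snd z)) (snd (snd z)))"
  shows "cm K (\<lambda>x. case dest (d x) of None \<Rightarrow> n x | Some p \<Rightarrow> c x (fst p) (snd p))"
proof -
  from n obtain bn where bn: "comp_in n bn" "pb K bn" unfolding cm_def by blast
  from c obtain bc where bc: "comp_in (\<lambda>z. c (fst z) (fst (snd z)) (snd (snd z))) bc" "pb K bc"
    unfolding cm_def by blast
  note b = bn(1) bc(1) bn(2) bc(2)
  have "pb K (\<lambda>z. case dest (snd z) of None \<Rightarrow> bn (fst z) | Some p \<Rightarrow> bc (fst z, p))"
    unfolding pb_def
  proof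
    assume K
    with b obtain i j where ij: "\<And>x. bn x \<le> (sz x + 2) ^ i" "\<And>x. bc x \<le> (sz x + 2) ^ j"
      unfolding pb_def by blast
    have "(case dest (snd z) of None \<Rightarrow> bn (fst z) | Some p \<Rightarrow> bc (fst z, p)) \<le> (sz z + 2) ^ (i + j)" for z
    proof (cases "dest (snd z)")
      case None
      have "bn (fst z) \<le> (sz (fst z) + 2) ^ i" by (rule ij)
      also have "\<dots> \<le> (sz z + 2) ^ i" by (rule power_mono) (auto simp: sz_pair[of z])
      also have "\<dots> \<le> (sz z + 2) ^ (i + j)" by (rule power_increasing) auto
      finally show ?thesis using None by simp
    next
      case (Some p)
      have "bc (fst z, p) \<le> (sz (fst z, p) + 2) ^ j" by (rule ij)
      also have "sz (fst z, p) = sz z" using dest[of "snd z"] Some by (simp add: sz_pair[of z])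
      also have "(sz z + 2) ^ j \<le> (sz z + 2) ^ (i + j)" by (rule power_increasing) auto
      finally show ?thesis using Some by simp
    qed
    then show "\<exists>c. \<forall>z. (case dest (snd z) of None \<Rightarrow> bn (fst z) | Some p \<Rightarrow> bc (fst z, p)) \<le> (sz z + 2) ^ c"
      by blast
  qed
  then have "cm K (\<lambda>z. case dest (snd z) of None \<Rightarrow> n (fst z) | Some p \<Rightarrow> c (fst z) (fst p) (snd p))"
    using comp_in_case[OF dest b(1,2), unfolded fst_conv snd_conv]
    by (intro cmI[of _ "\<lambda>z. 2 * sz z + 10 + (case dest (snd z) of None \<Rightarrow> bn (fst z) | Some p \<Rightarrow> bc (fst z, p))"])
       (auto intro!: pb_add pb_mult pb_const pb_sz_id)
  from cm_comp[OF this cm_Pair[OF cm_id d], unfolded fst_conv snd_conv] show ?thesis .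
qed

lemma cm_case_list [cm_intros]:
  fixes l :: "'a::encd \<Rightarrow> 'b::encd list"
  assumes "cm K l" "cm K n" "cm K (\<lambda>z. c (fst z) (fst (snd z)) (snd (snd z)))"
  shows "cm K (\<lambda>x. case l x of [] \<Rightarrow> n x | y # ys \<Rightarrow> c x y ys)"
proof -
  let ?d = "\<lambda>l :: 'b list. case l of [] \<Rightarrow> None | y # ys \<Rightarrow> Some (y, ys)"
  have "cm K (\<lambda>x. case ?d (l x) of None \<Rightarrow> n x | Some p \<Rightarrow> c x (fst p) (snd p))"
    by (rule cm_case[OF _ assms]) (simp split: list.split)
  then show ?thesis by (rule back_subst[of "cm K"]) (auto split: list.split)
qed

lemma cm_case_nat [cm_intros]:
  assumes "cm K l" "cm K n" "cm K (\<lambda>z. c (fst z) (snd z))"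
  shows "cm K (\<lambda>x. case l x of 0 \<Rightarrow> n x | Suc m \<Rightarrow> c x m)"
proof -
  let ?d = "\<lambda>n. case n of 0 \<Rightarrow> None | Suc m \<Rightarrow> Some (Nl, m)"
  have "cm K (\<lambda>z :: 'a \<times> data \<times> nat. c (fst z) (snd (snd z)))"
    using cm_comp[OF assms(3), of "\<lambda>z. (fst z, snd (snd z))"] by (simp add: cm_intros)
  then have "cm K (\<lambda>x. case ?d (l x) of None \<Rightarrow> n x | Some p \<Rightarrow> c x (snd p))"
    by (intro cm_case[where c = "\<lambda>x y z. c x z"] assms) (simp split: nat.split)
  then show ?thesis by (rule back_subst[of "cm K"]) (auto split: nat.split)
qed

lemma cm_case_data [cm_intros]:
  assumes "cm K l" "cm K n" "cm K (\<lambda>z. c (fst z) (fst (snd z)) (snd (snd z)))"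
  shows "cm K (\<lambda>x. case l x of Nl \<Rightarrow> n x | Cns u v \<Rightarrow> c x u v)"
proof -
  let ?d = "\<lambda>d. case d of Nl \<Rightarrow> None | Cns u v \<Rightarrow> Some (u, v)"
  have "cm K (\<lambda>x. case ?d (l x) of None \<Rightarrow> n x | Some p \<Rightarrow> c x (fst p) (snd p))"
    by (rule cm_case[OF _ assms]) (simp split: data.split)
  then show ?thesis by (rule back_subst[of "cm K"]) (auto split: data.split)
qed

lemma cm_If [cm_intros]:
  assumes "cm K b" "cm K f" "cm K g"
  shows "cm K (\<lambda>x. if b x then f x else g x)"
proof -
  let ?d = "\<lambda>b. if b then Some (Nl, Nl) else None"
  have "cm K (\<lambda>x. case ?d (b x) of None \<Rightarrow> g x | Some p \<Rightarrow> f x)"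
    by (rule cm_case[where c = "\<lambda>x _ _. f x"]) (use assms cm_comp[OF assms(2) cm_fst[OF cm_id]] in auto)
  then show ?thesis by (rule back_subst[of "cm K"]) auto
qed

lemma cm_while:
  fixes f :: "'a::encd \<Rightarrow> bool \<times> 'a" and h :: "'i::encd \<Rightarrow> bool \<times> 'a"
  assumes f: "cm K f" and h: "cm K h"
    and it0: "\<And>z. it z 0 = h z"
    and it_Suc: "\<And>z i. i < n z \<Longrightarrow> fst (it z i) \<and> it z (Suc i) = f (snd (it z i))"
    and it_n: "\<And>z. \<not> fst (it z (n z))" and it_sz: "\<And>z i. K \<Longrightarrow> i \<le> n z \<Longrightarrow> sz (it z i) \<le> S z"
    and n: "pb K n" and S: "pb K S"
  shows "cm K (\<lambda>z. snd (it z (n z)))"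
proof -
  from f obtain b where bf: "comp_in f b" "pb K b" unfolding cm_def by blast
  from h obtain bh where bh: "comp_in h bh" "pb K bh" unfolding cm_def by blast
  note b = bf bh
  obtain B where B: "pb K B" "\<And>z i. i \<le> n z \<Longrightarrow> b (snd (it z i)) \<le> B z \<and> sz (it z i) \<le> B z"
  proof (cases K)
    case True
    then obtain c where c: "\<And>x. b x \<le> (sz x + 2) ^ c" using b(2) unfolding pb_def by blast
    show ?thesis
    proof (rule that[of "\<lambda>z. (S z + 2) ^ c + S z"])
      show "pb K (\<lambda>z. (S z + 2) ^ c + S z)" by (intro pb_add pb_power pb_const S)
      fix z i assume i: "i \<le> n z"
      have "b (snd (it z i)) \<le> (sz (snd (it z i)) + 2) ^ c" by (rule c)
      also have "\<dots> \<le> (S z + 2) ^ c"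
        by (rule power_mono) (use it_sz[OF True i] in \<open>auto simp: sz_pair\<close>)
      finally show "b (snd (it z i)) \<le> (S z + 2) ^ c + S z \<and> sz (it z i) \<le> (S z + 2) ^ c + S z"
        using it_sz[OF True i] by simp
    qed
  next
    \<comment> \<open>No growth bound is claimed in this case, so the total cost along the finite
      trace can serve as \<open>B\<close>.\<close>
    case False
    show ?thesis
    proof (rule that[of "\<lambda>z. \<Sum>i\<le>n z. b (snd (it z i)) + sz (it z i)"])
      show "pb K (\<lambda>z. \<Sum>i\<le>n z. b (snd (it z i)) + sz (it z i))" using False by (simp add: pb_def)
      fix z i assume "i \<le> n z"
      then have "b (snd (it z i)) + sz (it z i) \<le> (\<Sum>i\<le>n z. b (snd (it z i)) + sz (it z i))"
        by (intro member_le_sum) auto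
      then show "b (snd (it z i)) \<le> (\<Sum>i\<le>n z. b (snd (it z i)) + sz (it z i)) \<and>
          sz (it z i) \<le> (\<Sum>i\<le>n z. b (snd (it z i)) + sz (it z i))" by simp
    qed
  qed
  have "comp_in (\<lambda>z. snd (it z (n z))) (\<lambda>z. bh z + (n z + 1) * (2 * B z + 20))"
    by (rule comp_in_while[OF b(1,3)]) (use it0 it_Suc it_n B in auto)
  then show ?thesis by (rule cmI) (intro pb_add pb_mult pb_const n b B)
qed

text \<open>Every intermediate accumulator has to be bounded, not only the result of one step:
  polynomially many rounds that each double the accumulator would already produce exponential
  size.\<close>

lemma cm_foldl:
  fixes l :: "'a::encd \<Rightarrow> 'b::encd list" and init :: "'a \<Rightarrow> 'c::encd"
  assumes step: "cm K (\<lambda>z. step (fst z) (fst (snd z)) (snd (snd z)))" and init: "cm K init" and l: "cm K l"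
    and B: "pb K B" "\<And>x n. K \<Longrightarrow> n \<le> length (l x) \<Longrightarrow> sz (foldl (step x) (init x) (take n (l x))) \<le> B x"
  shows "cm K (\<lambda>x. foldl (step x) (init x) (l x))"
proof -
  define f where "f z = (case snd (snd z) of [] \<Rightarrow> (False, z)
    | y # ys \<Rightarrow> (True, (fst z, (step (fst z) (fst (snd z)) y, ys))))" for z :: "'a \<times> 'c \<times> 'b list"
  \<comment> \<open>One additional round discovers that the list is exhausted, which makes
    \<open>Suc (length (l x))\<close> rounds.\<close>
  define it where "it x i = (if i \<le> length (l x) then (True, (x, (foldl (step x) (init x) (take i (l x)), drop i (l x))))
    else (False, (x, (foldl (step x) (init x) (l x), []))))" for x i
  have "cm K (\<lambda>z :: ('a \<times> 'c \<times> 'b list) \<times> 'b \<times> 'b list. step (fst (fst z)) (fst (snd (fst z))) (fst (snd z)))"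
    using cm_comp[OF step, of "\<lambda>z. (fst (fst z), fst (snd (fst z)), fst (snd z))"] by (simp add: cm_intros)
  then have f: "cm K f" unfolding f_def by (intro cm_intros)
  have "cm K (\<lambda>x. snd (it x (Suc (length (l x)))))"
  proof (rule cm_while[OF f, where h = "\<lambda>x. (True, (x, (init x, l x)))" and S = "\<lambda>x. 10 + sz x + B x + sz (l x)"])
    show "cm K (\<lambda>x. (True, (x, (init x, l x))))" by (intro cm_intros init l)
    show "pb K (\<lambda>x. Suc (length (l x)))"
      by (rule pb_le[OF pb_add[OF pb_const[of _ 1] cm_sz[OF l]]]) (simp add: length_le_sz)
    show "pb K (\<lambda>x. 10 + sz x + B x + sz (l x))" by (intro pb_add pb_const pb_sz_id B cm_sz l)
    show "it z 0 = (True, z, init z, l z)" for z by (simp add: it_def)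
    show "\<not> fst (it z (Suc (length (l z))))" for z by (simp add: it_def)
    show "fst (it z i) \<and> it z (Suc i) = f (snd (it z i))" if "i < Suc (length (l z))" for z i
    proof (cases "i = length (l z)")
      case True then show ?thesis by (simp add: it_def f_def)
    next
      case False
      then have i: "i < length (l z)" using that by simp
      then have "drop i (l z) = l z ! i # drop (Suc i) (l z)" by (simp add: Cons_nth_drop_Suc)
      with i show ?thesis by (simp add: it_def f_def take_Suc_conv_app_nth)
    qed
    show "sz (it z i) \<le> 10 + sz z + B z + sz (l z)" if "K" "i \<le> Suc (length (l z))" for z i
    proof (cases "i \<le> length (l z)")
      case True
      from B(2)[OF that(1) True] sz_drop_le[of i "l z"] True show ?thesis by (simp add: it_def)
    next
      case False
      from B(2)[OF that(1) order_refl] have "sz (foldl (step z) (init z) (l z)) \<le> B z" by simp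
      with False nodes_ge_1[of "encode (l z)"] show ?thesis by (simp add: it_def)
    qed
  qed
  from cm_fst[OF cm_snd[OF this]] show ?thesis by (simp add: it_def)
qed


section \<open>Functions on lists and numbers\<close>

text \<open>Programs see nothing but encodings, so a program serves every function with the same
  encoded values, even at another type. List cells, successors and tree nodes are all obtained from
  pairing in this way.\<close>

lemma cm_encode_cong:
  fixes f :: "'a::encd \<Rightarrow> 'b::encd" and g :: "'a \<Rightarrow> 'c::encd"
  assumes f: "cm K f" and eq: "\<And>x. encode (g x) = encode (f x)" shows "cm K g"
proof -
  from f obtain b where b: "comp_in f b" "pb K b" unfolding cm_def by blast
  then have "comp_in g b" unfolding comp_in_def impl_def by (simp add: eq)
  with b show ?thesis by (rule_tac cmI)
qed

lemma cm_comp2: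
  assumes "cm K (\<lambda>z. g (fst z) (snd z))" "cm K a" "cm K b" shows "cm K (\<lambda>x. g (a x) (b x))"
  using cm_comp[OF assms(1) cm_Pair[OF assms(2,3)]] by simp

lemma cm_comp3:
  assumes "cm K (\<lambda>z. g (fst z) (fst (snd z)) (snd (snd z)))" "cm K a" "cm K b" "cm K c"
  shows "cm K (\<lambda>x. g (a x) (b x) (c x))"
  using cm_comp[OF assms(1) cm_Pair[OF assms(2) cm_Pair[OF assms(3,4)]]] by simp

lemma cm_Cons [cm_intros]: assumes "cm K f" "cm K g" shows "cm K (\<lambda>x. f x # g x)"
  by (rule cm_encode_cong[OF cm_Pair[OF assms]]) simp

lemma cm_encode [cm_intros]: assumes "cm K f" shows "cm K (\<lambda>x. encode (f x))"
  by (rule cm_encode_cong[OF assms]) simp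

lemma cm_Suc [cm_intros]: assumes "cm K f" shows "cm K (\<lambda>x. Suc (f x))"
  by (rule cm_encode_cong[OF cm_Pair[OF cm_const[of _ Nl] assms]]) simp

lemma cm_Cns [cm_intros]: assumes "cm K f" "cm K g" shows "cm K (\<lambda>x. Cns (f x) (g x))"
  by (rule cm_encode_cong[OF cm_Pair[OF assms]]) simp

text \<open>Reading a tree along its right spine never fails, so every tree encodes a list of trees.
  This is the basis of total decoding.\<close>

primrec dlist :: "data \<Rightarrow> data list" where
  "dlist Nl = []"
| "dlist (Cns u v) = u # dlist v"

lemma encode_dlist [simp]: "encode (dlist d) = d"
  by (induction d) simp_all

lemma dlist_encode [simp]: "dlist (encode xs) = map encode xs"
  by (induction xs) simp_all

lemma cm_dlist [cm_intros]: assumes "cm K f" shows "cm K (\<lambda>x. dlist (f x))"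
  by (rule cm_encode_cong[OF assms]) simp

text \<open>A unary number is encoded like a list of empty trees, which turns iteration into a
  fold.\<close>

lemma encode_units: "encode (replicate n Nl) = encode n"
  by (induction n) simp_all

lemma cm_units: assumes "cm K f" shows "cm K (\<lambda>x. replicate (f x) Nl)"
  by (rule cm_encode_cong[OF assms]) (simp add: encode_units)

lemma sz_units [simp]: "sz (replicate n Nl) = 2 * n + 1"
  by (simp add: encode_units)

lemma foldl_replicate: "foldl (\<lambda>acc _. f acc) a (replicate n y) = (f ^^ n) a"
  by (induction n arbitrary: a) (simp_all add: funpow_swap1)

lemma cm_funpow:
  fixes f :: "'a::encd \<Rightarrow> 'b::encd \<Rightarrow> 'b"
  assumes f: "cm K (\<lambda>z. f (fst z) (snd z))" and a: "cm K a" and n: "cm K n"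
    and B: "pb K B" "\<And>x m. K \<Longrightarrow> m \<le> n x \<Longrightarrow> sz ((f x ^^ m) (a x)) \<le> B x"
  shows "cm K (\<lambda>x. (f x ^^ n x) (a x))"
proof -
  have f': "cm K (\<lambda>z. f (fst z) (fst (snd z)))"
    by (rule cm_comp2[OF f]) (intro cm_intros)+
  have "cm K (\<lambda>x. foldl (\<lambda>acc _. f x acc) (a x) (replicate (n x) Nl))"
    by (rule cm_foldl[where step = "\<lambda>x acc _. f x acc", OF f' a cm_units[OF n] B(1)])
       (use B(2) in \<open>simp add: foldl_replicate\<close>)
  then show ?thesis by (simp add: foldl_replicate)
qed

section \<open>Closure under list operations\<close>

lemma foldl_flip_Cons: "foldl (\<lambda>acc y. y # acc) ys xs = rev xs @ ys"
  by (induction xs arbitrary: ys) simp_all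

lemma sz_append_le: "sz (xs @ ys) \<le> sz xs + sz ys"
  using sz_append[of xs ys] by simp

lemma cm_append [cm_intros]: assumes "cm K f" "cm K g" shows "cm K (\<lambda>x. f x @ g x)"
proof -
  \<comment> \<open>A fold can only prepend, so appending reverses the first list and then pours it
    onto the second one.\<close>
  have rv: "cm K (\<lambda>z. foldl (\<lambda>acc y. y # acc) (b z) (a z))"
    if "cm K a" "cm K b" for a b :: "'z::encd \<Rightarrow> 'd::encd list"
  proof (rule cm_foldl[where step = "\<lambda>_ acc y. y # acc", OF _ that(2,1)])
    show "cm K (\<lambda>z :: 'z \<times> 'd list \<times> 'd. snd (snd z) # fst (snd z))" by (intro cm_intros)
    show "pb K (\<lambda>x. sz (b x) + sz (a x))" by (intro pb_add cm_sz that)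
    show "sz (foldl (\<lambda>acc y. y # acc) (b x) (take n (a x))) \<le> sz (b x) + sz (a x)" for x n
      unfolding foldl_flip_Cons
      using sz_append_le[of "rev (take n (a x))" "b x"] sz_take_le[of n "a x"] by simp
  qed
  have "cm K (\<lambda>x. foldl (\<lambda>acc y. y # acc) (g x) (foldl (\<lambda>acc y. y # acc) [] (f x)))"
    by (intro rv cm_const assms)
  then show ?thesis by (simp add: foldl_flip_Cons)
qed

lemma cm_rev [cm_intros]: assumes "cm K f" shows "cm K (\<lambda>x. rev (f x))"
proof -
  have "cm K (\<lambda>z. foldl (\<lambda>acc y. y # acc) [] (f z))"
  proof (rule cm_foldl[where step = "\<lambda>_ acc y. y # acc", OF _ cm_const assms])
    show "cm K (\<lambda>z :: 'a \<times> 'b list \<times> 'b. snd (snd z) # fst (snd z))" by (intro cm_intros)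
    show "pb K (\<lambda>x. sz (f x))" by (intro cm_sz assms)
  qed (simp add: foldl_flip_Cons sz_take_le)
  then show ?thesis by (simp add: foldl_flip_Cons)
qed

lemma foldl_map_rev: "foldl (\<lambda>acc y. g y # acc) zs xs = rev (map g xs) @ zs"
  by (induction xs arbitrary: zs) simp_all

lemma cm_map [cm_intros]:
  fixes l :: "'a::encd \<Rightarrow> 'b::encd list" and g :: "'a \<Rightarrow> 'b \<Rightarrow> 'c::encd"
  assumes l: "cm K l" and g: "cm K (\<lambda>z. g (fst z) (snd z))"
  shows "cm K (\<lambda>x. map (\<lambda>y. g x y) (l x))"
proof -
  from g obtain b where b: "comp_in (\<lambda>z. g (fst z) (snd z)) b" "pb K b" unfolding cm_def by blast
  have st: "cm K (\<lambda>z :: 'a \<times> 'c list \<times> 'b. g (fst z) (snd (snd z)) # fst (snd z))"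
    by (intro cm_Cons cm_comp2[OF g]) (intro cm_intros)+
  \<comment> \<open>One bound must cover the images of all members of \<open>l x\<close>; it comes
    from the running time of \<open>g\<close> and the fact that members are smaller than the
    list.\<close>
  have "\<exists>B. pb K B \<and> (K \<longrightarrow> (\<forall>x. \<forall>y\<in>set (l x). sz (g x y) \<le> B x))"
  proof (cases K)
    case True
    then obtain c where c: "\<And>z. b z \<le> (sz z + 2) ^ c" using b unfolding pb_def by blast
    let ?B = "\<lambda>x. (1 + sz x + sz (l x)) + (1 + sz x + sz (l x) + 2) ^ c"
    have "pb K ?B" by (intro pb_add pb_power pb_const pb_sz_id cm_sz l)
    moreover have "sz (g x y) \<le> ?B x" if "y \<in> set (l x)" for x y
    proof -
      have 1: "sz (x, y) \<le> 1 + sz x + sz (l x)" using sz_member[OF that] by simp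
      have "sz (g x y) \<le> sz (x, y) + b (x, y)" using comp_in_sz[OF b(1), of "(x, y)"] by simp
      also have "b (x, y) \<le> (sz (x, y) + 2) ^ c" by (rule c)
      also have "\<dots> \<le> (1 + sz x + sz (l x) + 2) ^ c" by (rule power_mono) (use 1 in auto)
      finally show ?thesis using 1 by linarith
    qed
    ultimately show ?thesis by blast
  qed (simp add: pb_def)
  then obtain B where B: "pb K B" "\<And>x y. K \<Longrightarrow> y \<in> set (l x) \<Longrightarrow> sz (g x y) \<le> B x" by blast
  have "cm K (\<lambda>x. foldl (\<lambda>acc y. g x y # acc) [] (l x))"
  proof (rule cm_foldl[where step = "\<lambda>x acc y. g x y # acc", OF st cm_const l])
    show "pb K (\<lambda>x. 1 + sz (l x) * (1 + B x))" by (intro pb_add pb_mult pb_const cm_sz l B)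
    fix x n assume K "n \<le> length (l x)"
    have "sz (map (g x) (take n (l x))) \<le> 1 + length (map (g x) (take n (l x))) * (1 + B x)"
      by (rule sz_list_le) (use B(2)[OF \<open>K\<close>] in \<open>auto dest: in_set_takeD\<close>)
    also have "\<dots> \<le> 1 + sz (l x) * (1 + B x)"
      using length_le_sz[of "l x"] \<open>n \<le> _\<close> by (intro add_mono mult_le_mono) simp_all
    finally show "sz (foldl (\<lambda>acc y. g x y # acc) [] (take n (l x))) \<le> 1 + sz (l x) * (1 + B x)"
      by (simp add: foldl_map_rev)
  qed
  from cm_rev[OF this] show ?thesis by (simp add: foldl_map_rev)
qed

lemma sz_concat_le: "sz (concat xss) \<le> sz xss"
proof (induction xss)
  case (Cons xs xss)
  then show ?case using sz_append_le[of xs "concat xss"] by simp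
qed simp

lemma cm_concat [cm_intros]: assumes "cm K f" shows "cm K (\<lambda>x. concat (f x))"
proof -
  have eq: "foldl (\<lambda>acc ys. acc @ ys) zs xss = zs @ concat xss" for zs and xss :: "'b list list"
    by (induction xss arbitrary: zs) simp_all
  have "cm K (\<lambda>z. foldl (\<lambda>acc ys. acc @ ys) [] (f z))"
  proof (rule cm_foldl[where step = "\<lambda>_ acc ys. acc @ ys", OF _ cm_const assms])
    show "cm K (\<lambda>z :: 'a \<times> 'b list \<times> 'b list. fst (snd z) @ snd (snd z))" by (intro cm_intros)
    show "pb K (\<lambda>x. sz (f x))" by (intro cm_sz assms)
    show "sz (foldl (\<lambda>acc ys. acc @ ys) [] (take n (f x))) \<le> sz (f x)" for x n
      unfolding eq using sz_concat_le[of "take n (f x)"] sz_take_le[of n "f x"] by simp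
  qed
  then show ?thesis by (simp add: eq)
qed

lemma cm_filter [cm_intros]:
  assumes "cm K l" "cm K (\<lambda>z. P (fst z) (snd z))"
  shows "cm K (\<lambda>x. filter (\<lambda>y. P x y) (l x))"
proof -
  have "cm K (\<lambda>x. concat (map (\<lambda>y. if P x y then [y] else []) (l x)))"
    by (intro cm_intros assms)
  moreover have "concat (map (\<lambda>y. if P x y then [y] else []) xs) = filter (P x) xs" for x xs
    by (induction xs) simp_all
  ultimately show ?thesis by simp
qed

section \<open>Boolean connectives and bounded quantifiers\<close>

lemma cm_not [cm_intros]: assumes "cm K f" shows "cm K (\<lambda>x. \<not> f x)"
proof -
  have "cm K (\<lambda>x. if f x then False else True)" by (intro cm_intros assms)
  then show ?thesis by (rule back_subst[of "cm K"]) auto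
qed

lemma cm_conj [cm_intros]: assumes "cm K f" "cm K g" shows "cm K (\<lambda>x. f x \<and> g x)"
proof -
  have "cm K (\<lambda>x. if f x then g x else False)" by (intro cm_intros assms)
  then show ?thesis by (rule back_subst[of "cm K"]) auto
qed

lemma cm_disj [cm_intros]: assumes "cm K f" "cm K g" shows "cm K (\<lambda>x. f x \<or> g x)"
proof -
  have "cm K (\<lambda>x. if f x then True else g x)" by (intro cm_intros assms)
  then show ?thesis by (rule back_subst[of "cm K"]) auto
qed

lemma cm_imp [cm_intros]: assumes "cm K f" "cm K g" shows "cm K (\<lambda>x. f x \<longrightarrow> g x)"
proof -
  have "cm K (\<lambda>x. if f x then g x else True)" by (intro cm_intros assms)
  then show ?thesis by (rule back_subst[of "cm K"]) auto
qed

lemma cm_null: assumes "cm K f" shows "cm K (\<lambda>x. f x = [])"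
proof -
  have "cm K (\<lambda>x. case f x of [] \<Rightarrow> True | _ # _ \<Rightarrow> False)" by (intro cm_intros assms)
  then show ?thesis by (rule back_subst[of "cm K"]) (simp add: fun_eq_iff split: list.split)
qed

lemma cm_Bex [cm_intros]:
  assumes "cm K l" "cm K (\<lambda>z. P (fst z) (snd z))"
  shows "cm K (\<lambda>x. \<exists>y\<in>set (l x). P x y)"
proof -
  have "cm K (\<lambda>x. \<not> (filter (\<lambda>y. P x y) (l x) = []))"
    by (intro cm_not cm_null cm_filter assms)
  then show ?thesis by (rule back_subst[of "cm K"]) (auto simp: filter_empty_conv)
qed

lemma cm_Ball [cm_intros]:
  assumes "cm K l" "cm K (\<lambda>z. P (fst z) (snd z))"
  shows "cm K (\<lambda>x. \<forall>y\<in>set (l x). P x y)"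
proof -
  have "cm K (\<lambda>x. filter (\<lambda>y. \<not> P x y) (l x) = [])"
    by (intro cm_not cm_null cm_filter assms)
  then show ?thesis by (rule back_subst[of "cm K"]) (auto simp: filter_empty_conv)
qed


text \<open>Equality of trees is not primitive and needs a loop. The state is a worklist of pairs
  still to be compared, together with the answer.\<close>

definition eq_step :: "(data \<times> data) list \<times> bool \<Rightarrow> bool \<times> (data \<times> data) list \<times> bool" where
  "eq_step z = (case fst z of [] \<Rightarrow> (False, z) | p # ps \<Rightarrow>
     (case fst p of
        Nl \<Rightarrow> (case snd p of Nl \<Rightarrow> (True, (ps, snd z)) | Cns _ _ \<Rightarrow> (False, ([], False)))
      | Cns u1 u2 \<Rightarrow> (case snd p of Nl \<Rightarrow> (False, ([], False))
          | Cns v1 v2 \<Rightarrow> (True, ((u1, v1) # (u2, v2) # ps, snd z)))))"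

definition eq_trace where
  "eq_trace ps n it \<longleftrightarrow> n \<le> Suc (\<Sum>p\<leftarrow>ps. nodes (fst p)) \<and> it 0 = (True, (ps, True)) \<and>
    (\<forall>i<n. fst (it i) \<and> it (Suc i) = eq_step (snd (it i))) \<and>
    it n = (False, ([], \<forall>p\<in>set ps. fst p = snd p)) \<and> (\<forall>i\<le>n. sz (it i) \<le> 10 + sz ps)"

lemma eq_trace_extend:
  assumes tr: "eq_trace qs n it" and eq: "eq_step (ps, True) = (True, (qs, True))"
    and lt: "(\<Sum>p\<leftarrow>qs. nodes (fst p)) < (\<Sum>p\<leftarrow>ps. nodes (fst p))"
    and iff: "(\<forall>p\<in>set qs. fst p = snd p) = (\<forall>p\<in>set ps. fst p = snd p)" and szq: "sz qs \<le> sz ps"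
  shows "eq_trace ps (Suc n) (case_nat (True, (ps, True)) it)"
proof -
  let ?it = "case_nat (True, (ps, True)) it"
  have it: "it 0 = (True, (qs, True))" "\<And>i. i < n \<Longrightarrow> fst (it i) \<and> it (Suc i) = eq_step (snd (it i))"
    "it n = (False, ([], \<forall>p\<in>set qs. fst p = snd p))" "\<And>i. i \<le> n \<Longrightarrow> sz (it i) \<le> 10 + sz qs"
    "n \<le> Suc (\<Sum>p\<leftarrow>qs. nodes (fst p))"
    using tr unfolding eq_trace_def by auto
  have "fst (?it i) \<and> ?it (Suc i) = eq_step (snd (?it i))" if "i < Suc n" for i
    using that it(1,2) eq by (cases i) auto
  moreover have "sz (?it i) \<le> 10 + sz ps" if "i \<le> Suc n" for i
    using that it(4)[of "i - 1"] szq by (cases i) auto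
  moreover have "?it (Suc n) = (False, ([], \<forall>p\<in>set ps. fst p = snd p))"
    unfolding iff[symmetric] using it(3) by simp
  ultimately show ?thesis using it(5) lt unfolding eq_trace_def by auto
qed

lemma eq_trace_stop:
  assumes "eq_step (ps, True) = (False, ([], \<forall>p\<in>set ps. fst p = snd p))"
  shows "eq_trace ps 1 (case_nat (True, (ps, True)) (\<lambda>_. (False, ([], \<forall>p\<in>set ps. fst p = snd p))))"
  using sz_bool_le[of "\<forall>p\<in>set ps. fst p = snd p"]
  unfolding eq_trace_def by (simp add: assms split: nat.split)

text \<open>Splitting a pair of inner nodes removes one node from the first components and keeps the
  encoded size of the worklist unchanged. The former bounds the rounds, the latter the
  space.\<close>

lemma ex_eq_trace: "\<exists>n it. eq_trace ps n it"
proof (induction "\<Sum>p\<leftarrow>ps. nodes (fst p)" arbitrary: ps rule: less_induct)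
  case less
  show ?case
  proof (cases ps)
    case Nil
    then have "eq_step (ps, True) = (False, ([], \<forall>p\<in>set ps. fst p = snd p))" by (simp add: eq_step_def)
    from eq_trace_stop[OF this] show ?thesis by blast
  next
    case (Cons p qs)
    have extend: "?thesis" if "eq_step (ps, True) = (True, (rs, True))"
        "(\<Sum>p\<leftarrow>rs. nodes (fst p)) < (\<Sum>p\<leftarrow>ps. nodes (fst p))"
        "(\<forall>p\<in>set rs. fst p = snd p) = (\<forall>p\<in>set ps. fst p = snd p)" "sz rs \<le> sz ps" for rs
    proof -
      from less[OF that(2)] obtain n it where "eq_trace rs n it" by blast
      from eq_trace_extend[OF this that] show ?thesis by blast
    qed
    show ?thesis
    proof (cases "fst p"; cases "snd p")
      assume "fst p = Nl" "snd p = Nl"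
      with Cons show ?thesis by (intro extend[of qs]) (auto simp: eq_step_def)
    next
      fix v1 v2 assume "fst p = Nl" "snd p = Cns v1 v2"
      with Cons have "eq_step (ps, True) = (False, ([], \<forall>p\<in>set ps. fst p = snd p))"
        by (auto simp: eq_step_def)
      from eq_trace_stop[OF this] show ?thesis by blast
    next
      fix u1 u2 assume "fst p = Cns u1 u2" "snd p = Nl"
      with Cons have "eq_step (ps, True) = (False, ([], \<forall>p\<in>set ps. fst p = snd p))"
        by (auto simp: eq_step_def)
      from eq_trace_stop[OF this] show ?thesis by blast
    next
      fix u1 u2 v1 v2 assume "fst p = Cns u1 u2" "snd p = Cns v1 v2"
      with Cons show ?thesis
        by (intro extend[of "(u1, v1) # (u2, v2) # qs"]) (auto simp: eq_step_def sz_pair[of p])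
    qed
  qed
qed

lemma cm_data_eq:
  fixes f g :: "'a::encd \<Rightarrow> data"
  assumes "cm K f" "cm K g" shows "cm K (\<lambda>x. f x = g x)"
proof -
  let ?ps = "\<lambda>x. [(f x, g x)]"
  have "\<forall>x. \<exists>n. \<exists>it. eq_trace (?ps x) n it" using ex_eq_trace by blast
  from choice[OF this] obtain n where "\<forall>x. \<exists>it. eq_trace (?ps x) (n x) it" by blast
  from choice[OF this] obtain it where "\<forall>x. eq_trace (?ps x) (n x) (it x)" by blast
  then have it: "n x \<le> Suc (nodes (f x))" "it x 0 = (True, (?ps x, True))"
    "\<And>i. i < n x \<Longrightarrow> fst (it x i) \<and> it x (Suc i) = eq_step (snd (it x i))"
    "it x (n x) = (False, ([], f x = g x))" "\<And>i. i \<le> n x \<Longrightarrow> sz (it x i) \<le> 10 + sz (?ps x)" for x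
    unfolding eq_trace_def by simp_all
  have st: "cm K eq_step" unfolding eq_step_def by (intro cm_intros)
  have h: "cm K (\<lambda>x. (True, (?ps x, True)))" by (intro cm_intros assms)
  have ps: "cm K ?ps" by (intro cm_intros assms)
  have "cm K (\<lambda>x. snd (it x (n x)))"
  proof (rule cm_while[OF st h])
    have "pb K (\<lambda>x. 1 + sz (f x))" by (intro pb_add pb_const cm_sz assms)
    then show "pb K n" by (rule pb_le) (use it in simp)
    show "pb K (\<lambda>x. 10 + sz (?ps x))" by (intro pb_add pb_const cm_sz ps)
    show "it z 0 = (True, ?ps z, True)" for z by (rule it)
    show "i < n z \<Longrightarrow> fst (it z i) \<and> it z (Suc i) = eq_step (snd (it z i))" for z i by (rule it)
    show "\<not> fst (it z (n z))" for z by (simp add: it)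
    show "i \<le> n z \<Longrightarrow> sz (it z i) \<le> 10 + sz (?ps z)" for z i by (rule it)
  qed
  from cm_snd[OF this] it show ?thesis by simp
qed

lemma cm_eq [cm_intros]: assumes "cm K f" "cm K g" shows "cm K (\<lambda>x. f x = g x)"
  using cm_data_eq[OF cm_encode[OF assms(1)] cm_encode[OF assms(2)]] by simp


section \<open>Unary arithmetic, ranges, indexing and products\<close>

lemma cm_length [cm_intros]: assumes "cm K f" shows "cm K (\<lambda>x. length (f x))"
proof -
  have "cm K (\<lambda>x. map (\<lambda>_. Nl) (f x))" by (intro cm_intros assms)
  then show ?thesis by (rule cm_encode_cong) (simp add: map_replicate_const encode_units)
qed

lemma cm_add [cm_intros]: assumes "cm K f" "cm K g" shows "cm K (\<lambda>x. f x + g x :: nat)"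
proof -
  have eq: "(Suc ^^ m) n = m + n" for m n by (induction m) simp_all
  have "cm K (\<lambda>x. (Suc ^^ f x) (g x))"
  proof (rule cm_funpow[where f = "\<lambda>_. Suc", OF _ assms(2,1)])
    show "cm K (\<lambda>z :: 'a \<times> nat. Suc (snd z))" by (intro cm_intros)
    show "pb K (\<lambda>x. sz (f x) + sz (g x))" by (intro pb_add cm_sz assms)
  qed (simp add: eq)
  then show ?thesis by (simp add: eq)
qed

lemma cm_mult [cm_intros]: assumes "cm K f" "cm K g" shows "cm K (\<lambda>x. f x * g x :: nat)"
proof -
  have eq: "((\<lambda>a. a + k) ^^ m) 0 = m * k" for m k :: nat by (induction m) simp_all
  have "cm K (\<lambda>x. ((\<lambda>a. a + g x) ^^ f x) 0)"
  proof (rule cm_funpow[where f = "\<lambda>x a. a + g x", OF _ cm_const assms(1)])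
    show "cm K (\<lambda>z :: 'a \<times> nat. snd z + g (fst z))"
      by (intro cm_add cm_snd cm_id cm_comp[OF assms(2)] cm_fst)
    show "pb K (\<lambda>x. 1 + sz (f x) * sz (g x))" by (intro pb_add pb_mult pb_const cm_sz assms)
    fix x m assume "m \<le> f x"
    then have "m * g x \<le> f x * g x" by simp
    then show "sz (((\<lambda>a. a + g x) ^^ m) 0) \<le> 1 + sz (f x) * sz (g x)"
    proof -
      have "sz (f x) * sz (g x) = 4 * (f x * g x) + 2 * f x + 2 * g x + 1" by (simp add: algebra_simps)
      with \<open>m * g x \<le> f x * g x\<close> show ?thesis unfolding eq sz_nat by linarith
    qed
  qed
  then show ?thesis by (simp add: eq)
qed

lemma cm_power [cm_intros]: "cm K f \<Longrightarrow> cm K (\<lambda>x. f x ^ k :: nat)"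
  by (induction k) (auto intro: cm_const cm_mult)

lemma cm_diff [cm_intros]: assumes "cm K f" "cm K g" shows "cm K (\<lambda>x. f x - g x :: nat)"
proof -
  let ?p = "\<lambda>k :: nat. case k of 0 \<Rightarrow> 0 | Suc j \<Rightarrow> j"
  have eq: "(?p ^^ m) n = n - m" for m n
    by (induction m) (auto split: nat.split)
  have "cm K (\<lambda>x. (?p ^^ g x) (f x))"
  proof (rule cm_funpow[where f = "\<lambda>_. ?p", OF _ assms(1,2)])
    show "cm K (\<lambda>z :: 'a \<times> nat. ?p (snd z))" by (intro cm_intros)
    show "pb K (\<lambda>x. sz (f x))" by (intro cm_sz assms)
  qed (simp add: eq)
  then show ?thesis by (simp add: eq)
qed

lemma cm_le [cm_intros]: assumes "cm K f" "cm K g" shows "cm K (\<lambda>x. f x \<le> (g x :: nat))"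
proof -
  have "cm K (\<lambda>x. f x - g x = 0)" by (intro cm_intros assms)
  then show ?thesis by simp
qed

lemma cm_less [cm_intros]: assumes "cm K f" "cm K g" shows "cm K (\<lambda>x. f x < (g x :: nat))"
proof -
  have "cm K (\<lambda>x. Suc (f x) \<le> g x)" by (intro cm_intros assms)
  then show ?thesis by (simp add: Suc_le_eq)
qed

lemma cm_upt [cm_intros]: assumes "cm K f" shows "cm K (\<lambda>x. [0..<f x])"
proof -
  let ?p = "\<lambda>ns. ns @ [length ns]"
  have eq: "(?p ^^ m) [] = [0..<m]" for m by (induction m) simp_all
  have "cm K (\<lambda>x. (?p ^^ f x) [])"
  proof (rule cm_funpow[where f = "\<lambda>_. ?p", OF _ cm_const assms(1)])
    show "cm K (\<lambda>z :: 'a \<times> nat list. snd z @ [length (snd z)])" by (intro cm_intros)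
    show "pb K (\<lambda>x. 1 + sz (f x) * (1 + sz (f x)))" by (intro pb_add pb_mult pb_const cm_sz assms)
    fix x m assume m: "m \<le> f x"
    have "sz [0..<m] \<le> 1 + length [0..<m] * (1 + sz m)"
      by (rule sz_list_le) auto
    also have "\<dots> \<le> 1 + sz (f x) * (1 + sz (f x))" using m by (intro add_mono mult_mono) auto
    finally show "sz ((?p ^^ m) []) \<le> 1 + sz (f x) * (1 + sz (f x))" unfolding eq .
  qed
  then show ?thesis by (simp add: eq)
qed

lemma cm_drop: assumes "cm K l" "cm K n" shows "cm K (\<lambda>x. drop (n x) (l x))"
proof -
  let ?p = "\<lambda>ys. case ys of [] \<Rightarrow> [] | _ # zs \<Rightarrow> zs"
  have eq: "(?p ^^ m) xs = drop m xs" for m and xs :: "'b list"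
  proof (induction m)
    case (Suc m)
    then show ?case by (auto split: list.split simp: drop_Suc tl_drop) (metis list.sel(3) tl_drop)
  qed simp
  have "cm K (\<lambda>x. (?p ^^ n x) (l x))"
  proof (rule cm_funpow[where f = "\<lambda>_. ?p", OF _ assms])
    show "cm K (\<lambda>z :: 'a \<times> 'b list. ?p (snd z))" by (intro cm_intros)
    show "pb K (\<lambda>x. sz (l x))" by (intro cm_sz assms)
  qed (simp add: eq sz_drop_le)
  then show ?thesis by (simp add: eq)
qed

text \<open>\<open>xs ! n\<close> is unspecified outside the list, so no program could be shown to
  compute it there; the default makes indexing total.\<close>

definition nthd :: "'a \<Rightarrow> 'a list \<Rightarrow> nat \<Rightarrow> 'a" where
  "nthd d xs n = (if n < length xs then xs ! n else d)"

lemma cm_nthd [cm_intros]: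
  assumes "cm K d" "cm K l" "cm K n" shows "cm K (\<lambda>x. nthd (d x) (l x) (n x))"
proof -
  have "cm K (\<lambda>x. case drop (n x) (l x) of [] \<Rightarrow> d x | y # _ \<Rightarrow> y)"
    by (rule cm_case_list[OF cm_drop]) (intro cm_intros assms)+
  moreover have "nthd d xs n = (case drop n xs of [] \<Rightarrow> d | y # _ \<Rightarrow> y)" for d n and xs :: "'b list"
    by (cases "n < length xs") (auto simp: nthd_def Cons_nth_drop_Suc[symmetric])
  ultimately show ?thesis by simp
qed

lemma cm_product [cm_intros]: assumes "cm K f" "cm K g" shows "cm K (\<lambda>x. List.product (f x) (g x))"
  unfolding product_concat_map
  by (intro cm_intros cm_comp[OF assms(2)] assms)

text \<open>Polynomial because the length \<open>q\<close> is a constant; it will be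
  \<open>2 ^ d\<close>.\<close>

lemma cm_n_lists [cm_intros]: assumes "cm K f" shows "cm K (\<lambda>x. List.n_lists q (f x))"
  by (induction q) (auto intro!: cm_intros assms cm_comp[OF assms])


section \<open>Transitivity of fpt-reductions\<close>

primrec expr_below :: "nat \<Rightarrow> expr \<Rightarrow> bool" where
  "expr_below N ENil \<longleftrightarrow> True"
| "expr_below N (EVar x) \<longleftrightarrow> x < N"
| "expr_below N (ECons x y) \<longleftrightarrow> x < N \<and> y < N"
| "expr_below N (EHd x) \<longleftrightarrow> x < N"
| "expr_below N (ETl x) \<longleftrightarrow> x < N"

primrec prog_below :: "nat \<Rightarrow> prog \<Rightarrow> bool" where
  "prog_below N (Assign x e) \<longleftrightarrow> x < N \<and> expr_below N e"
| "prog_below N (Seq c d) \<longleftrightarrow> prog_below N c \<and> prog_below N d"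
| "prog_below N (Cond x c d) \<longleftrightarrow> x < N \<and> prog_below N c \<and> prog_below N d"
| "prog_below N (While x c) \<longleftrightarrow> x < N \<and> prog_below N c"

lemma expr_below_mono: "expr_below N e \<Longrightarrow> N \<le> M \<Longrightarrow> expr_below M e"
  by (cases e) auto

lemma prog_below_mono: "prog_below N c \<Longrightarrow> N \<le> M \<Longrightarrow> prog_below M c"
  by (induction c) (auto intro: expr_below_mono)

lemma ex_prog_below: "\<exists>N>0. prog_below N c"
proof (induction c)
  case (Assign x e)
  have "\<exists>N. expr_below N e"
  proof (cases e)
    case (ECons x y) then show ?thesis by (auto intro!: exI[of _ "Suc (max x y)"])
  qed auto
  then obtain N where "expr_below N e" ..
  then have "prog_below (max N (Suc x)) (Assign x e)" by (auto intro: expr_below_mono)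
  then show ?case by (intro exI[of _ "max N (Suc x)"]) simp
next
  case (Seq c d)
  then obtain N M where "N > 0" "prog_below N c" "prog_below M d" by blast
  then have "max N M > 0" "prog_below (max N M) (Seq c d)" by (auto intro: prog_below_mono)
  then show ?case by blast
next
  case (Cond x c d)
  then obtain N M where "prog_below N c" "prog_below M d" by blast
  then have "prog_below (max (Suc x) (max N M)) (Cond x c d)" by (auto intro: prog_below_mono)
  moreover have "max (Suc x) (max N M) > 0" by simp
  ultimately show ?case by blast
next
  case (While x c)
  then obtain N where "prog_below N c" by blast
  then have "prog_below (max (Suc x) N) (While x c)" by (auto intro: prog_below_mono)
  moreover have "max (Suc x) N > 0" by simp
  ultimately show ?case by blast
qed

lemma eval_expr_cong: "expr_below N e \<Longrightarrow> (\<And>i. i < N \<Longrightarrow> r i = s i) \<Longrightarrow> eval_expr e r = eval_expr e s"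
  by (cases e) auto

lemma exec_frame:
  assumes "exec c s t s'" "prog_below N c" "\<And>i. i < N \<Longrightarrow> r i = s i"
  shows "exec c r t (\<lambda>i. if i < N then s' i else r i)"
  using assms
proof (induction arbitrary: r rule: exec.induct)
  case (Assign x e s)
  then have eq: "eval_expr e r = eval_expr e s" by (intro eval_expr_cong) auto
  show ?case
    by (rule exec_AssignI) (use Assign eq in \<open>auto simp: fun_eq_iff\<close>)
next
  case (Seq c1 s t1 s' c2 t2 s'')
  have "exec c1 r t1 (\<lambda>i. if i < N then s' i else r i)" using Seq by simp
  moreover have "exec c2 (\<lambda>i. if i < N then s' i else r i) t2
      (\<lambda>i. if i < N then s'' i else (\<lambda>i. if i < N then s' i else r i) i)"
    using Seq.prems by (intro Seq.IH(2)) auto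
  moreover have "(\<lambda>i. if i < N then s'' i else (\<lambda>i. if i < N then s' i else r i) i) = (\<lambda>i. if i < N then s'' i else r i)"
    by auto
  ultimately show ?case using exec.Seq by metis
next
  case (CondTrue s x c1 t s' c2)
  then show ?case by (intro exec.CondTrue) auto
next
  case (CondFalse s x c2 t s' c1)
  then show ?case by (intro exec.CondFalse) auto
next
  case (WhileFalse s x c)
  have "(\<lambda>i. if i < N then s i else r i) = r" using WhileFalse by auto
  moreover have "r x = Nl" using WhileFalse by simp
  ultimately show ?case using exec.WhileFalse by metis
next
  case (WhileTrue s x c t1 s' t2 s'')
  have "exec c r t1 (\<lambda>i. if i < N then s' i else r i)" using WhileTrue by simp
  moreover have "exec (While x c) (\<lambda>i. if i < N then s' i else r i) t2
      (\<lambda>i. if i < N then s'' i else (\<lambda>i. if i < N then s' i else r i) i)"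
    using WhileTrue.prems by (intro WhileTrue.IH(2)) auto
  moreover have "(\<lambda>i. if i < N then s'' i else (\<lambda>i. if i < N then s' i else r i) i) = (\<lambda>i. if i < N then s'' i else r i)"
    by auto
  moreover have "r x \<noteq> Nl" using WhileTrue by simp
  ultimately show ?case using exec.WhileTrue by metis
qed

primrec clear :: "nat \<Rightarrow> prog" where
  "clear 0 = Assign 1 ENil"
| "clear (Suc n) = Seq (Assign (Suc n) ENil) (clear n)"

lemma exec_clear: "exec (clear n) s (2 * n + 2) (\<lambda>i. if 0 < i \<and> i \<le> max 1 n then Nl else s i)"
proof (induction n arbitrary: s)
  case 0
  show ?case unfolding clear.simps by (rule exec_AssignI) (auto simp: fun_eq_iff)
next
  case (Suc n)
  have "exec (clear (Suc n)) s (2 + (2 * n + 2))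
      (\<lambda>i. if 0 < i \<and> i \<le> max 1 n then Nl else (s(Suc n := Nl)) i)"
    unfolding clear.simps by (rule exec.Seq[OF exec_AssignI Suc]) auto
  moreover have "(\<lambda>i. if 0 < i \<and> i \<le> max 1 n then Nl else (s(Suc n := Nl)) i)
      = (\<lambda>i. if 0 < i \<and> i \<le> max 1 (Suc n) then Nl else s i)"
    by (auto simp: fun_eq_iff)
  ultimately show ?case by simp
qed

text \<open>A program in the sense of \<open>computes_within\<close> starts with all other registers
  empty and may leave garbage behind. Registers beyond those it mentions are irrelevant by
  \<open>exec_frame\<close>, and the garbage is cleared at a constant cost, which is the
  \<open>k\<close>.\<close>

lemma computes_within_comp_in:
  fixes f :: "'a::encd \<Rightarrow> 'b::encd"
  assumes "\<And>x. computes_within c (encode x) (encode (f x)) (b x)"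
  shows "\<exists>k. comp_in f (\<lambda>x. b x + k)"
proof -
  obtain N where N: "N > 0" "prog_below N c" using ex_prog_below by blast
  have "impl (Seq c (clear N)) (Suc (max 1 N)) f (\<lambda>x. b x + (2 * N + 2))"
    unfolding impl_def
  proof (intro allI impI)
    fix s and x :: 'a assume s: "s 0 = encode x" "\<forall>i. 0 < i \<and> i < Suc (max 1 N) \<longrightarrow> s i = Nl"
    from assms[of x] obtain t s' where t: "t \<le> b x" "exec c ((\<lambda>_. Nl)(0 := encode x)) t s'" "s' 0 = encode (f x)"
      unfolding computes_within_def by blast
    have "exec c s t (\<lambda>i. if i < N then s' i else s i)"
      by (rule exec_frame[OF t(2) N(2)]) (use s in auto)
    from exec.Seq[OF this exec_clear[of N]]
    have "exec (Seq c (clear N)) s (t + (2 * N + 2))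
       (\<lambda>i. if 0 < i \<and> i \<le> max 1 N then Nl else if i < N then s' i else s i)" .
    moreover have "(\<lambda>i. if 0 < i \<and> i \<le> max 1 N then Nl else if i < N then s' i else s i) = s(0 := encode (f x))"
      using s t(3) N(1) by (auto simp: fun_eq_iff)
    ultimately show "\<exists>t\<le>b x + (2 * N + 2). exec (Seq c (clear N)) s t (s(0 := encode (f x)))"
      using t(1) by (intro exI[of _ "t + (2 * N + 2)"]) simp
  qed
  then show ?thesis unfolding comp_in_def by blast
qed

lemma comp_in_computes_within:
  fixes f :: "'a::encd \<Rightarrow> 'b::encd"
  assumes "comp_in f b"
  shows "\<exists>c. \<forall>x. computes_within c (encode x) (encode (f x)) (b x)"
proof -
  from assms obtain P N where P: "impl P N f b" unfolding comp_in_def by blast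
  have "computes_within P (encode x) (encode (f x)) (b x)" for x
  proof -
    define s :: state where "s = (\<lambda>_. Nl)(0 := encode x)"
    have "s 0 = encode x" "\<forall>i. 0 < i \<and> i < N \<longrightarrow> s i = Nl" by (auto simp: s_def)
    then obtain t where "t \<le> b x" "exec P s t (s(0 := encode (f x)))"
      using P[unfolded impl_def, THEN spec, THEN spec, THEN mp, THEN mp, of s x] by metis
    then show ?thesis unfolding computes_within_def s_def[symmetric]
      by (intro exI[of _ t] exI[of _ "s(0 := encode (f x))"]) simp
  qed
  then show ?thesis by blast
qed

section \<open>Fpt-reductions in terms of the closure classes\<close>

lemma computable_iff_cm: "computable f \<longleftrightarrow> cm False f"
proof
  assume "computable f"
  then obtain c where "\<forall>n. \<exists>t. computes_within c (encode n) (encode (f n)) t"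
    unfolding computable_def encode_nat_def by blast
  from choice[OF this] obtain b where "\<And>n. computes_within c (encode n) (encode (f n)) (b n)" by blast
  from computes_within_comp_in[OF this] show "cm False f" unfolding cm_def pb_def by blast
next
  assume "cm False f"
  then obtain b where "comp_in f b" unfolding cm_def by blast
  from comp_in_computes_within[OF this] show "computable f"
    unfolding computable_def encode_nat_def by blast
qed

lemma enc_pair_id: "enc_pair id enc_nat = (encode :: data \<times> nat \<Rightarrow> data)"
  by (simp add: encode_prod_def encode_nat_def encode_data_def id_def)

lemma fpt_reducible_iff:
  "A \<le>\<^sub>f\<^sub>p\<^sub>t B \<longleftrightarrow> (\<exists>R. (\<forall>x k. (x, k) \<in> A \<longleftrightarrow> R (x, k) \<in> B) \<and>
     (\<exists>g. cm False g \<and> (\<forall>x k. snd (R (x, k)) \<le> g k)) \<and>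
     (\<exists>f c. cm False f \<and> comp_in R (\<lambda>p. f (snd p) * nodes (fst p) ^ c)))" (is "_ \<longleftrightarrow> (\<exists>R. ?Q R)")
proof
  assume "A \<le>\<^sub>f\<^sub>p\<^sub>t B"
  then obtain R g f c P where R: "\<forall>x k. (x, k) \<in> A \<longleftrightarrow> R (x, k) \<in> B"
    and g: "computable g" "\<forall>x k. snd (R (x, k)) \<le> g k" and f: "computable f"
    and P: "\<forall>x k. computes_within P (encode (x, k)) (encode (R (x, k))) (f k * nodes x ^ c)"
    unfolding fpt_reducible_def enc_pair_id by blast
  have "\<And>p. computes_within P (encode p) (encode (R p)) (f (snd p) * nodes (fst p) ^ c)"
    using P by (simp add: split_paired_all)
  from computes_within_comp_in[OF this] obtain m where
    "comp_in R (\<lambda>p. f (snd p) * nodes (fst p) ^ c + m)" by blast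
  \<comment> \<open>The additive constant moves into the parameter-dependent factor, since powers of
    \<open>nodes\<close> are at least 1.\<close>
  then have "comp_in R (\<lambda>p. (f (snd p) + m) * nodes (fst p) ^ c)"
    by (rule comp_in_mono) (simp add: algebra_simps Suc_le_eq)
  moreover have "cm False (\<lambda>k. f k + m)" using f by (intro cm_intros) (simp add: computable_iff_cm)
  ultimately have "\<exists>f c. cm False f \<and> comp_in R (\<lambda>p. f (snd p) * nodes (fst p) ^ c)"
    by (intro exI[of _ "\<lambda>k. f k + m"] exI[of _ c]) simp
  with R g show "\<exists>R. ?Q R" unfolding computable_iff_cm by blast
next
  assume "\<exists>R. ?Q R"
  then obtain R g f c where R: "\<forall>x k. (x, k) \<in> A \<longleftrightarrow> R (x, k) \<in> B"
    and g: "computable g" "\<forall>x k. snd (R (x, k)) \<le> g k" and f: "computable f"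
    and c: "comp_in R (\<lambda>p. f (snd p) * nodes (fst p) ^ c)"
    unfolding computable_iff_cm by blast
  from comp_in_computes_within[OF c] obtain P where
    "\<forall>p. computes_within P (encode p) (encode (R p)) (f (snd p) * nodes (fst p) ^ c)" by blast
  then have "\<forall>x k. computes_within P (encode (x, k)) (encode (R (x, k))) (f k * nodes x ^ c)"
    by (simp del: encode_Pair)
  with R g f show "A \<le>\<^sub>f\<^sub>p\<^sub>t B"
    unfolding fpt_reducible_def enc_pair_id by blast
qed

text \<open>The parameter of an intermediate instance is known only up to a bound, and a computable
  function need not be monotone. Summing over all smaller arguments gives a computable monotone
  majorant.\<close>

lemma cm_partial_sum:
  fixes f :: "nat \<Rightarrow> nat"
  assumes "cm False f" shows "cm False (\<lambda>m. \<Sum>j\<le>m. f j)"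
proof -
  have eq: "foldl (\<lambda>acc j. acc + f j) 0 [0..<m] = (\<Sum>j<m. f j)" for m
    by (induction m) simp_all
  have "cm False (\<lambda>m. foldl (\<lambda>acc j. acc + f j) 0 [0..<Suc m])"
    by (rule cm_foldl[where step = "\<lambda>_ acc j. acc + f j" and B = "\<lambda>_. 0"])
       ((intro cm_intros cm_comp[OF assms])+, simp_all add: pb_def)
  then show ?thesis unfolding eq lessThan_Suc_atMost .
qed

lemma le_partial_sum: "j \<le> (m :: nat) \<Longrightarrow> f j \<le> (\<Sum>j\<le>m. f j :: nat)"
  by (rule member_le_sum) auto

lemma fpt_reducible_trans:
  assumes "A \<le>\<^sub>f\<^sub>p\<^sub>t B" "B \<le>\<^sub>f\<^sub>p\<^sub>t C" shows "A \<le>\<^sub>f\<^sub>p\<^sub>t C"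
proof -
  from assms(1) obtain R1 g1 f1 c1 where R1: "\<forall>x k. (x, k) \<in> A \<longleftrightarrow> R1 (x, k) \<in> B"
    and g1: "cm False g1" "\<And>x k. snd (R1 (x, k)) \<le> g1 k"
    and f1: "cm False f1" "comp_in R1 (\<lambda>p. f1 (snd p) * nodes (fst p) ^ c1)"
    unfolding fpt_reducible_iff by blast
  from assms(2) obtain R2 g2 f2 c2 where R2: "\<forall>x k. (x, k) \<in> B \<longleftrightarrow> R2 (x, k) \<in> C"
    and g2: "cm False g2" "\<And>x k. snd (R2 (x, k)) \<le> g2 k"
    and f2: "cm False f2" "comp_in R2 (\<lambda>p. f2 (snd p) * nodes (fst p) ^ c2)"
    unfolding fpt_reducible_iff by blast
  let ?R = "\<lambda>p. R2 (R1 p)"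
  let ?G = "\<lambda>k. \<Sum>j\<le>g1 k. g2 j"
  let ?F2 = "\<lambda>k. \<Sum>j\<le>g1 k. f2 j"
  \<comment> \<open>\<open>(f1 k + 2 * k + 3) * n ^ (c1 + 1)\<close> bounds the size of the
    intermediate instance, where \<open>2 * k\<close> stems from the unary parameter; the second
    reduction raises this to the power \<open>c2\<close>.\<close>
  let ?F = "\<lambda>k. f1 k + ?F2 k * (f1 k + 2 * k + 3) ^ c2"
  let ?c = "c1 + (c1 + 1) * c2"
  have 1: "\<forall>x k. (x, k) \<in> A \<longleftrightarrow> ?R (x, k) \<in> C"
    using R1 R2 by (metis prod.collapse)
  have 2: "cm False ?G" by (rule cm_comp[OF cm_partial_sum[OF g2(1)] g1(1)])
  have 3: "snd (?R (x, k)) \<le> ?G k" for x k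
  proof -
    have "snd (?R (x, k)) \<le> g2 (snd (R1 (x, k)))"
      using g2(2)[of "fst (R1 (x, k))" "snd (R1 (x, k))"] by simp
    also have "\<dots> \<le> ?G k" by (rule le_partial_sum[OF g1(2)])
    finally show ?thesis .
  qed
  have 4: "cm False ?F"
    by (intro cm_intros f1(1) cm_comp[OF cm_partial_sum[OF f2(1)] g1(1)])
  have 5: "comp_in ?R (\<lambda>p. ?F (snd p) * nodes (fst p) ^ ?c)"
  proof (rule comp_in_mono[OF comp_in_comp[OF f1(2) f2(2)]])
    fix p :: "data \<times> nat"
    obtain x k where p: "p = (x, k)" by (cases p)
    define n where "n = nodes x"
    have n: "n \<ge> 1" by (simp add: n_def Suc_le_eq)
    obtain x' k' where p': "R1 (x, k) = (x', k')" by (cases "R1 (x, k)")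
    have k': "k' \<le> g1 k" using g1(2)[of x k] p' by simp
    have "sz (R1 (x, k)) \<le> sz (x, k) + f1 k * n ^ c1" using comp_in_sz[OF f1(2), of "(x, k)"] by (simp add: n_def)
    then have "nodes x' \<le> n + 2 * k + 2 + f1 k * n ^ c1" by (simp add: p' n_def)
    also have "\<dots> \<le> (f1 k + 2 * k + 3) * n ^ (c1 + 1)"
    proof -
      have "(2 * k + 2) * 1 \<le> (2 * k + 2) * n ^ (c1 + 1)" using n by (intro mult_le_mono2) simp
      moreover have "f1 k * n ^ c1 \<le> f1 k * n ^ (c1 + 1)"
        using n by (intro mult_le_mono2 power_increasing) simp_all
      moreover have "n \<le> n ^ (c1 + 1)" using n by simp
      ultimately show ?thesis unfolding add_mult_distrib by linarith
    qed
    finally have x': "nodes x' \<le> (f1 k + 2 * k + 3) * n ^ (c1 + 1)" .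
    have "f2 k' * nodes x' ^ c2 \<le> ?F2 k * ((f1 k + 2 * k + 3) * n ^ (c1 + 1)) ^ c2"
      by (intro mult_le_mono le_partial_sum[OF k'] power_mono x') simp
    also have "\<dots> = ?F2 k * (f1 k + 2 * k + 3) ^ c2 * n ^ ((c1 + 1) * c2)"
      by (simp only: power_mult_distrib power_mult mult.assoc)
    also have "\<dots> \<le> ?F2 k * (f1 k + 2 * k + 3) ^ c2 * n ^ ?c"
      using n by (intro mult_le_mono2 power_increasing) auto
    finally have "f2 k' * nodes x' ^ c2 \<le> ?F2 k * (f1 k + 2 * k + 3) ^ c2 * n ^ ?c" .
    moreover have "f1 k * n ^ c1 \<le> f1 k * n ^ ?c"
      using n by (intro mult_le_mono2 power_increasing) auto
    ultimately have "f1 k * n ^ c1 + f2 k' * nodes x' ^ c2 \<le> ?F k * n ^ ?c"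
      unfolding add_mult_distrib by (rule add_mono[rotated])
    then show "f1 (snd p) * nodes (fst p) ^ c1 + f2 (snd (R1 p)) * nodes (fst (R1 p)) ^ c2
        \<le> ?F (snd p) * nodes (fst p) ^ ?c"
      by (simp add: p p' n_def)
  qed
  show ?thesis unfolding fpt_reducible_iff
    by (intro exI[of _ ?R] conjI exI[of _ ?G] exI[of _ ?F] exI[of _ ?c] 1 2 4 5 allI 3)
qed

text \<open>The size of the pair, plus 2, is at most \<open>2 * k + 5\<close> times the size of the
  instance, and a power of this product separates into a function of the parameter and a power of
  the instance size.\<close>

lemma polytime_reduction:
  fixes R :: "data \<times> nat \<Rightarrow> data \<times> nat"
  assumes R: "cm True R" "\<And>x k. (x, k) \<in> A \<longleftrightarrow> R (x, k) \<in> B"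
    and g: "cm False g" "\<And>x k. snd (R (x, k)) \<le> g k"
  shows "A \<le>\<^sub>f\<^sub>p\<^sub>t B"
proof -
  from R(1) obtain b where b: "comp_in R b" "pb True b" unfolding cm_def by blast
  from b(2) obtain c where c: "\<And>p. b p \<le> (sz p + 2) ^ c" unfolding pb_def by blast
  have "comp_in R (\<lambda>p. (2 * snd p + 5) ^ c * nodes (fst p) ^ c)"
  proof (rule comp_in_mono[OF b(1)])
    fix p :: "data \<times> nat"
    have "sz p + 2 \<le> (2 * snd p + 5) * nodes (fst p)"
    proof -
      have "2 * snd p + 4 \<le> (2 * snd p + 4) * nodes (fst p)"
        using nodes_ge_1[of "fst p"] by simp
      then show ?thesis unfolding sz_pair sz_nat add_mult_distrib
        by (simp add: algebra_simps)
    qed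
    then have "(sz p + 2) ^ c \<le> ((2 * snd p + 5) * nodes (fst p)) ^ c" by (rule power_mono) simp
    with c[of p] show "b p \<le> (2 * snd p + 5) ^ c * nodes (fst p) ^ c"
      by (simp add: power_mult_distrib)
  qed
  moreover have "cm False (\<lambda>k :: nat. (2 * k + 5) ^ c)" by (intro cm_intros)
  ultimately show ?thesis using R(2) g unfolding fpt_reducible_iff by blast
qed


section \<open>Disjoint paths in time-expanded graphs\<close>

lemma div_mult_add: "a < P \<Longrightarrow> (t * P + a) div P = t" "a < P \<Longrightarrow> (t * P + a) mod P = (a :: nat)"
  by simp_all

lemma vertex_less: assumes "a < P" "t < T" shows "t * P + a < T * (P :: nat)"
proof -
  have "t * P + a < Suc t * P" using assms by simp
  also have "\<dots> \<le> T * P" using assms by (intro mult_le_mono1) simp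
  finally show ?thesis .
qed

text \<open>Vertex \<open>t * P + a\<close> is place \<open>a\<close> at time \<open>t\<close>. By
  \<open>ends\<close>, different requests share no endpoint, so paths that may meet only in common
  endpoints do not meet at all.\<close>

locale time_expanded =
  fixes T P :: nat and mv :: "nat \<Rightarrow> nat \<Rightarrow> nat \<Rightarrow> bool" and R :: nat
    and t1 a1 t2 a2 :: "nat \<Rightarrow> nat"
  assumes P: "P > 0"
    and times: "\<And>r. r < R \<Longrightarrow> t1 r < t2 r" "\<And>r. r < R \<Longrightarrow> t2 r < T"
    and places: "\<And>r. r < R \<Longrightarrow> a1 r < P" "\<And>r. r < R \<Longrightarrow> a2 r < P"
    and ends: "\<And>r r'. r < R \<Longrightarrow> r' < R \<Longrightarrow> r \<noteq> r' \<Longrightarrow>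
      {(t1 r, a1 r), (t2 r, a2 r)} \<inter> {(t1 r', a1 r'), (t2 r', a2 r')} = {}"
begin

definition "V = {..<T * P}"
definition "Vs = map (\<lambda>t. {t * P..<t * P + P}) [0..<T]"
definition "E = {{t * P + a, Suc t * P + b} | t a b. Suc t < T \<and> a < P \<and> b < P \<and> mv t a b}"
definition "rs = map (\<lambda>r. (t1 r * P + a1 r, t2 r * P + a2 r)) [0..<R]"

definition routing :: "(nat \<Rightarrow> nat \<Rightarrow> nat) \<Rightarrow> bool" where
  "routing pos \<longleftrightarrow> (\<forall>r<R. pos r (t1 r) = a1 r \<and> pos r (t2 r) = a2 r \<and>
      (\<forall>t. t1 r \<le> t \<and> t \<le> t2 r \<longrightarrow> pos r t < P) \<and>
      (\<forall>t. t1 r \<le> t \<and> t < t2 r \<longrightarrow> mv t (pos r t) (pos r (Suc t)))) \<and>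
    (\<forall>r<R. \<forall>r'<R. \<forall>t. r \<noteq> r' \<longrightarrow> t1 r \<le> t \<longrightarrow> t \<le> t2 r \<longrightarrow> t1 r' \<le> t \<longrightarrow> t \<le> t2 r' \<longrightarrow> pos r t \<noteq> pos r' t)"

section \<open>The layered graph\<close>

lemma Vs_nth: "t < T \<Longrightarrow> Vs ! t = {t * P..<t * P + P}"
  by (simp add: Vs_def)

lemma length_Vs [simp]: "length Vs = T"
  by (simp add: Vs_def)

lemma mem_Vs: "t < T \<Longrightarrow> v \<in> Vs ! t \<longleftrightarrow> v div P = t"
proof -
  assume "t < T"
  have "v div P = t" if "v \<in> {t * P..<t * P + P}"
  proof -
    have "v - t * P < P" "t * P + (v - t * P) = v" using that by auto
    with div_mult_add(1)[of "v - t * P" P t] show ?thesis by simp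
  qed
  moreover have "v \<in> {t * P..<t * P + P}" if "v div P = t"
  proof -
    have "v mod P < P" using P by simp
    with div_mult_mod_eq[of v P] that show ?thesis by simp
  qed
  ultimately show ?thesis using Vs_nth[OF \<open>t < T\<close>] by blast
qed

lemma vertex_eq: "a < P \<Longrightarrow> b < P \<Longrightarrow> t * P + a = t' * P + b \<longleftrightarrow> t = t' \<and> a = b"
  by (metis div_mult_add)

lemma one_shortest: "one_shortest_graph V E Vs"
  unfolding one_shortest_graph_def
proof (intro conjI ballI)
  show "simple_graph V E"
    unfolding simple_graph_def
  proof (intro conjI ballI)
    fix e assume "e \<in> E"
    then obtain t a b where e: "e = {t * P + a, Suc t * P + b}" "Suc t < T" "a < P" "b < P"
      unfolding E_def by blast
    have "t * P + a \<in> V" "Suc t * P + b \<in> V" "t * P + a \<noteq> Suc t * P + b"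
      using e vertex_less[of a P t T] vertex_less[of b P "Suc t" T] vertex_eq[of a b t "Suc t"]
      by (simp_all add: V_def)
    then show "\<exists>u\<in>V. \<exists>v\<in>V. u \<noteq> v \<and> e = {u, v}" using e(1) by blast
  qed (simp add: V_def)
  show "partition_on V (set Vs)"
  proof (rule partition_onI)
    show "\<Union> (set Vs) = V"
    proof (intro equalityI subsetI)
      fix v assume "v \<in> \<Union> (set Vs)"
      then obtain t where "t < T" "v \<in> {t * P..<t * P + P}" by (auto simp: Vs_def)
      then have "v div P = t" using mem_Vs Vs_nth by simp
      with \<open>t < T\<close> show "v \<in> V" by (auto simp: V_def div_less_iff_less_mult P)
    next
      fix v assume "v \<in> V"
      then have "v div P < T" by (simp add: V_def div_less_iff_less_mult P)
      then show "v \<in> \<Union> (set Vs)" using mem_Vs[of "v div P" v] nth_mem[of "v div P" Vs] by auto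
    qed
    show "{} \<notin> set Vs" using P by (auto simp: Vs_def)
    show "disjnt p q" if pq: "p \<in> set Vs" "q \<in> set Vs" "p \<noteq> q" for p q
    proof -
      from pq(1) obtain s where s: "s < T" "p = Vs ! s" by (auto simp: in_set_conv_nth)
      from pq(2) obtain t where t: "t < T" "q = Vs ! t" by (auto simp: in_set_conv_nth)
      have "s \<noteq> t" using pq(3) s t by auto
      then have "v \<notin> q" if "v \<in> p" for v
        using that mem_Vs[OF s(1)] mem_Vs[OF t(1)] s(2) t(2) by auto
      then show ?thesis by (auto simp: disjnt_def)
    qed
  qed
  show "distinct Vs"
    unfolding Vs_def distinct_map
  proof (intro conjI inj_onI)
    fix s t assume st: "s \<in> set [0..<T]" "t \<in> set [0..<T]" "{s * P..<s * P + P} = {t * P..<t * P + P}"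
    have "s * P \<in> {s * P..<s * P + P}" using P by simp
    then have mem: "s * P \<in> {t * P..<t * P + P}" using st(3) by (simp only:)
    have "t < T" using st by simp
    from mem have "s * P \<in> Vs ! t" unfolding Vs_nth[OF \<open>t < T\<close>] .
    then have "s * P div P = t" using mem_Vs[OF \<open>t < T\<close>] by blast
    then show "s = t" using P by simp
  qed simp
  show "\<exists>j u v. Suc j < length Vs \<and> u \<in> Vs ! j \<and> v \<in> Vs ! Suc j \<and> e = {u, v}" if "e \<in> E" for e
  proof -
    from that obtain t a b where e: "e = {t * P + a, Suc t * P + b}" "Suc t < T" "a < P" "b < P"
      unfolding E_def by blast
    then show ?thesis using mem_Vs[of t "t * P + a"] mem_Vs[of "Suc t" "Suc t * P + b"]
        div_mult_add(1)[of a P t] div_mult_add(1)[of b P "Suc t"]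
      by (intro exI[of _ t] exI[of _ "t * P + a"] exI[of _ "Suc t * P + b"]) simp
  qed
qed

lemma rs_subset: "set rs \<subseteq> V \<times> V"
  unfolding rs_def V_def using times places by (auto intro!: vertex_less) (meson less_trans)

section \<open>Paths of colour 1 as routes of tokens\<close>

lemma solvable_if_routing:
  assumes "routing pos" shows "DSP_solvable V E Vs rs"
proof -
  let ?p = "\<lambda>r. map (\<lambda>t. t * P + pos r t) [t1 r..<Suc (t2 r)]"
  have pos: "pos r (t1 r) = a1 r" "pos r (t2 r) = a2 r" "\<And>t. t1 r \<le> t \<Longrightarrow> t \<le> t2 r \<Longrightarrow> pos r t < P"
    "\<And>t. t1 r \<le> t \<Longrightarrow> t < t2 r \<Longrightarrow> mv t (pos r t) (pos r (Suc t))" if "r < R" for r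
    using assms that unfolding routing_def by auto
  have nth: "?p r ! j = (t1 r + j) * P + pos r (t1 r + j)" if "j < Suc (t2 r) - t1 r" for r j
    using that by (simp add: nth_append del: upt_Suc)
  have lay: "?p r ! j div P = t1 r + j" if "j < Suc (t2 r) - t1 r" "r < R" for r j
    unfolding nth[OF that(1)] by (rule div_mult_add, rule pos) (use that in auto)
  show ?thesis
    unfolding DSP_solvable_def
  proof (intro exI[of _ "map ?p [0..<R]"] conjI allI impI)
    show "length (map ?p [0..<R]) = length rs" by (simp add: rs_def)
    fix r assume "r < length rs"
    then have r: "r < R" by (simp add: rs_def)
    have ne: "t1 r < Suc (t2 r)" using times(1)[OF r] by simp
    have len: "length (?p r) = Suc (t2 r) - t1 r" by (simp del: upt_Suc)
    have "is_path V E (?p r)"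
      unfolding is_path_def
    proof (intro conjI allI impI)
      show "?p r \<noteq> []" using ne by simp
      show "distinct (?p r)"
        unfolding distinct_conv_nth len using lay[OF _ r] by (metis add_left_cancel)
      show "set (?p r) \<subseteq> V"
        using pos(3)[OF r] times(2)[OF r] by (auto simp: V_def less_Suc_eq_le simp del: upt_Suc intro!: vertex_less)
      fix j assume "Suc j < length (?p r)"
      then have j: "Suc j < Suc (t2 r) - t1 r" unfolding len .
      then have "?p r ! j = (t1 r + j) * P + pos r (t1 r + j)"
        "?p r ! Suc j = Suc (t1 r + j) * P + pos r (Suc (t1 r + j))"
        using nth[of j r] nth[of "Suc j" r] by (simp_all del: upt_Suc)
      moreover have "t1 r + j < t2 r" using j by simp
      ultimately show "{?p r ! j, ?p r ! Suc j} \<in> E"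
        unfolding E_def mem_Collect_eq
        by (intro exI[of _ "t1 r + j"] exI[of _ "pos r (t1 r + j)"] exI[of _ "pos r (Suc (t1 r + j))"] conjI)
           (use pos[OF r] times(2)[OF r] in \<open>simp_all del: upt_Suc\<close>)
    qed
    moreover have "\<exists>q. Suc q < length Vs \<and> ?p r ! j \<in> Vs ! q \<and> ?p r ! Suc j \<in> Vs ! Suc q"
      if "Suc j < length (?p r)" for j
    proof -
      have j: "Suc j < Suc (t2 r) - t1 r" using that unfolding len .
      then have "?p r ! j div P = t1 r + j" "?p r ! Suc j div P = Suc (t1 r + j)"
        using lay[of j r] lay[of "Suc j" r] r by simp_all
      then show ?thesis using mem_Vs j times(2)[OF r] by (intro exI[of _ "t1 r + j"]) (simp del: upt_Suc)
    qed
    moreover have "path_between (?p r) (fst (rs ! r)) (snd (rs ! r))"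
    proof -
      have "hd (?p r) = ?p r ! 0" using ne by (intro hd_conv_nth) simp
      moreover have "last (?p r) = ?p r ! (t2 r - t1 r)"
        using ne len by (subst last_conv_nth) (auto simp: Suc_diff_le less_Suc_eq_le simp del: upt_Suc)
      ultimately have "hd (?p r) = t1 r * P + a1 r" "last (?p r) = t2 r * P + a2 r"
        using nth[of 0 r] nth[of "t2 r - t1 r" r] ne pos(1,2)[OF r] by (simp_all del: upt_Suc add: Suc_diff_le less_Suc_eq_le)
      then show ?thesis using r by (simp add: path_between_def rs_def)
    qed
    ultimately show "colour1_path V E Vs (map ?p [0..<R] ! r)"
      "path_between (map ?p [0..<R] ! r) (fst (rs ! r)) (snd (rs ! r))"
      unfolding colour1_path_def using r by (simp_all del: upt_Suc)
  next
    fix r r' assume "r < length rs" "r' < length rs" "r \<noteq> r'"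
    then have r: "r < R" "r' < R" "r \<noteq> r'" by (simp_all add: rs_def)
    have "set (?p r) \<inter> set (?p r') = {}"
    proof (rule ccontr)
      assume "set (?p r) \<inter> set (?p r') \<noteq> {}"
      then obtain t t' where t: "t1 r \<le> t" "t \<le> t2 r" "t1 r' \<le> t'" "t' \<le> t2 r'"
        "t * P + pos r t = t' * P + pos r' t'" by (auto simp: less_Suc_eq_le simp del: upt_Suc)
      then have "t = t'" "pos r t = pos r' t'" using vertex_eq pos(3) r by blast+
      with assms r t show False unfolding routing_def by blast
    qed
    then show "internally_disjoint (map ?p [0..<R] ! r) (map ?p [0..<R] ! r')"
      unfolding internally_disjoint_def internal_def using r by (simp del: upt_Suc) blast
  qed
qed

lemma routing_if_solvable:
  assumes "DSP_solvable V E Vs rs" shows "\<exists>pos. routing pos"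
proof -
  from assms obtain Ps where len: "length Ps = length rs" and
    path: "\<And>r. r < R \<Longrightarrow> colour1_path V E Vs (Ps ! r)" and
    btw: "\<And>r. r < R \<Longrightarrow> path_between (Ps ! r) (fst (rs ! r)) (snd (rs ! r))" and
    disj: "\<And>r r'. r < R \<Longrightarrow> r' < R \<Longrightarrow> r \<noteq> r' \<Longrightarrow> internally_disjoint (Ps ! r) (Ps ! r')"
    unfolding DSP_solvable_def by (auto simp: rs_def)
  have main: "hd (Ps ! r) = t1 r * P + a1 r \<and> last (Ps ! r) = t2 r * P + a2 r \<and>
      length (Ps ! r) = Suc (t2 r - t1 r) \<and> (\<forall>j<length (Ps ! r). (Ps ! r) ! j div P = t1 r + j)" if r: "r < R" for r
  proof -
    let ?p = "Ps ! r"
    have ne: "?p \<noteq> []" and col: "\<And>j. Suc j < length ?p \<Longrightarrow> \<exists>q. Suc q < length Vs \<and> ?p ! j \<in> Vs ! q \<and> ?p ! Suc j \<in> Vs ! Suc q"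
      using path[OF r] unfolding colour1_path_def is_path_def by auto
    have step: "?p ! Suc j div P = Suc (?p ! j div P)" if "Suc j < length ?p" for j
      using col[OF that] mem_Vs by auto
    have lay: "j < length ?p \<Longrightarrow> ?p ! j div P = ?p ! 0 div P + j" for j
      by (induction j) (simp_all add: step)
    have hd: "hd ?p = ?p ! 0" and last: "last ?p = ?p ! (length ?p - 1)"
      using ne by (simp_all add: hd_conv_nth last_conv_nth)
    have le: "hd ?p div P \<le> last ?p div P" using lay[of "length ?p - 1"] ne unfolding hd last by simp
    have d: "(t1 r * P + a1 r) div P = t1 r" "(t2 r * P + a2 r) div P = t2 r"
      using places[OF r] by simp_all
    \<comment> \<open>Layers increase along a path of colour 1, so \<open>t1 r < t2 r\<close>
      excludes the reversed orientation that \<open>path_between\<close> permits.\<close>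
    have hl: "hd ?p = t1 r * P + a1 r \<and> last ?p = t2 r * P + a2 r"
      using btw[OF r] le d times(1)[OF r] r unfolding path_between_def by (auto simp: rs_def)
    have l0: "?p ! 0 div P = t1 r" using hl d unfolding hd by simp
    have l1: "t2 r = t1 r + (length ?p - 1)"
      using lay[of "length ?p - 1"] ne d hl l0 unfolding last by simp
    have "length ?p > 0" using ne by simp
    with l1 have l2: "length ?p = Suc (t2 r - t1 r)" by linarith
    show ?thesis
      by (intro conjI allI impI) (use hl l2 lay l0 in simp_all)
  qed
  define pos where "pos r t = (Ps ! r) ! (t - t1 r) mod P" for r t
  have vert: "(Ps ! r) ! (t - t1 r) = t * P + pos r t" if "r < R" "t1 r \<le> t" "t \<le> t2 r" for r t
  proof -
    have "(Ps ! r) ! (t - t1 r) div P = t1 r + (t - t1 r)" using main[OF that(1)] that by auto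
    then show ?thesis unfolding pos_def using that div_mult_mod_eq[of "Ps ! r ! (t - t1 r)" P] by simp
  qed
  have "routing pos"
    unfolding routing_def
  proof (intro conjI allI impI)
    fix r assume r: "r < R"
    note m = main[OF r]
    have ne: "Ps ! r \<noteq> []" using m by auto
    have "hd (Ps ! r) = t1 r * P + pos r (t1 r)"
      using vert[of r "t1 r"] r times(1)[OF r] ne by (simp add: hd_conv_nth)
    with m show "pos r (t1 r) = a1 r" by simp
    have "last (Ps ! r) = t2 r * P + pos r (t2 r)"
      using vert[of r "t2 r"] r times(1)[OF r] ne m by (simp add: last_conv_nth)
    with m show "pos r (t2 r) = a2 r" by simp
    show "pos r t < P" for t using P by (simp add: pos_def)
    fix t assume t: "t1 r \<le> t \<and> t < t2 r"
    define j where "j = t - t1 r"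
    have j: "Suc j < length (Ps ! r)" "t = t1 r + j" using m t by (auto simp: j_def)
    then have "{Ps ! r ! j, Ps ! r ! Suc j} \<in> E"
      using path[OF r] unfolding colour1_path_def is_path_def by blast
    moreover have "t - t1 r = j" "Suc t - t1 r = Suc j" using j(2) by simp_all
    then have "Ps ! r ! j = t * P + pos r t" "Ps ! r ! Suc j = Suc t * P + pos r (Suc t)"
      using vert[of r t] vert[of r "Suc t"] r t by simp_all
    ultimately obtain t' a b where e: "{t * P + pos r t, Suc t * P + pos r (Suc t)} = {t' * P + a, Suc t' * P + b}"
      "a < P" "b < P" "mv t' a b" unfolding E_def by auto
    have lt: "pos r t < P" "pos r (Suc t) < P" using P by (simp_all add: pos_def)
    \<comment> \<open>Edges are unordered; read backwards, each of \<open>t\<close> and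
      \<open>t'\<close> would be the successor of the other.\<close>
    from e(1) consider "t * P + pos r t = t' * P + a" "Suc t * P + pos r (Suc t) = Suc t' * P + b"
      | "t * P + pos r t = Suc t' * P + b" "Suc t * P + pos r (Suc t) = t' * P + a"
      unfolding doubleton_eq_iff by blast
    then show "mv t (pos r t) (pos r (Suc t))"
    proof cases
      case 1 then show ?thesis using vertex_eq e lt by metis
    next
      case 2
      then have "t = Suc t'" "Suc t = t'" using vertex_eq e lt by metis+
      then show ?thesis by simp
    qed
  next
    fix r r' t assume r: "r < R" "r' < R" "r \<noteq> r'"
      and t: "t1 r \<le> t" "t \<le> t2 r" "t1 r' \<le> t" "t \<le> t2 r'"
    show "pos r t \<noteq> pos r' t"
    proof
      assume eq: "pos r t = pos r' t"
      define v where "v = t * P + pos r t"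
      have "v \<in> set (Ps ! r)" using vert[OF r(1) t(1,2)] main[OF r(1)] t unfolding v_def
        by (metis nth_mem less_Suc_eq_le diff_le_mono)
      moreover have "v \<in> set (Ps ! r')" using vert[OF r(2) t(3,4)] main[OF r(2)] t unfolding v_def eq
        by (metis nth_mem less_Suc_eq_le diff_le_mono)
      ultimately have "v \<in> {hd (Ps ! r), last (Ps ! r)}" "v \<in> {hd (Ps ! r'), last (Ps ! r')}"
        using disj[OF r] unfolding internally_disjoint_def internal_def by auto
      then have "{t1 r * P + a1 r, t2 r * P + a2 r} \<inter> {t1 r' * P + a1 r', t2 r' * P + a2 r'} \<noteq> {}"
        using main[OF r(1)] main[OF r(2)] by auto
      then show False using ends[OF r] places r(1,2) vertex_eq by auto
    qed
  qed
  then show ?thesis by blast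
qed

lemma solvable_iff: "DSP_solvable V E Vs rs \<longleftrightarrow> (\<exists>pos. routing pos)"
  using solvable_if_routing routing_if_solvable by blast

end


section \<open>The token gadget\<close>

text \<open>
  A place is \<open>(tag, i, j, c)\<close> with the tags named below. The first five places belong to the value
  token of the current phase: it moves in the lane \<open>low\<close> before its value, in \<open>free\<close> during its value,
  and in \<open>high\<close> afterwards. The others belong to the verifier \<open>(i, j)\<close>, and \<open>mid i j c\<close> remembers that
  it has crossed at value \<open>c\<close> of the first variable.

  A time is \<open>(p, c, t, s)\<close>: phase \<open>p\<close>, value \<open>c\<close>, slot \<open>t\<close>, step \<open>s < 3\<close>. The phases \<open>p < L\<close> and
  \<open>L + p\<close> belong to the variable \<open>p\<close> as the first and as the second variable of a pair. In the slots
  \<open>0\<close> and \<open>L + 1\<close> the value token may enter and must leave \<open>free\<close>; in the slot \<open>t\<close> between them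
  only the verifier of the current variable and the variable \<open>t - 1\<close> may cross.
\<close>

type_synonym place = "nat \<times> nat \<times> nat \<times> nat"

abbreviation (input) "low \<equiv> (0, 0, 0, 0) :: place"
abbreviation (input) "free \<equiv> (1, 0, 0, 0) :: place"
abbreviation (input) "high \<equiv> (2, 0, 0, 0) :: place"
abbreviation (input) "gate0 \<equiv> (3, 0, 0, 0) :: place"
abbreviation (input) "gate1 \<equiv> (4, 0, 0, 0) :: place"
abbreviation (input) "pre i j \<equiv> (5, i, j, 0) :: place"
abbreviation (input) "mid i j c \<equiv> (6, i, j, c) :: place"
abbreviation (input) "done i j \<equiv> (7, i, j, 0) :: place"

definition entry :: "nat \<Rightarrow> (nat \<Rightarrow> nat \<Rightarrow> bool) \<Rightarrow> nat \<Rightarrow> nat \<Rightarrow> nat \<Rightarrow> place \<Rightarrow> bool" where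
  "entry L rel p c t x \<longleftrightarrow> (if p < L then x = pre p (t - 1)
     else fst x = 6 \<and> fst (snd x) = t - 1 \<and> fst (snd (snd x)) = p - L \<and> rel (snd (snd (snd x))) c)"

definition exit_place :: "nat \<Rightarrow> nat \<Rightarrow> nat \<Rightarrow> nat \<Rightarrow> place" where
  "exit_place L p c t = (if p < L then mid p (t - 1) c else done (t - 1) (p - L))"

text \<open>At steps 0, 1, 2 of a slot from 1 to \<open>L\<close>, the lower lane is at
  \<open>low\<close>, \<open>gate0\<close>, \<open>low\<close> and the upper lane at
  \<open>high\<close>, \<open>high\<close>, \<open>gate1\<close>. A crossing verifier is in
  \<open>gate0\<close> at step 1 and in \<open>gate1\<close> at step 2, so a value token in either
  lane blocks one of its gates, whereas one in \<open>free\<close> blocks none. Places with tag at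
  least 5 allow waiting at any time. Nothing else can move at the last time of a phase, which is
  fatal for a verifier still in a lane; the value token has its end there.\<close>

definition gmove :: "nat \<Rightarrow> nat \<Rightarrow> (nat \<Rightarrow> nat \<Rightarrow> bool) \<Rightarrow> (nat \<Rightarrow> nat \<Rightarrow> bool) \<Rightarrow>
    nat \<times> nat \<times> nat \<times> nat \<Rightarrow> place \<Rightarrow> place \<Rightarrow> bool" where
  "gmove L m ok rel d x y \<longleftrightarrow> (5 \<le> fst x \<and> x = y) \<or>
     (if fst (snd (snd d)) = 0 then
        (x = low \<and> y = low) \<or> (x = high \<and> y = high) \<or>
        (if snd (snd (snd d)) = 0
         then x = low \<and> y = free \<and> ok (if fst d < L then fst d else fst d - L) (fst (snd d))
         else x = free \<and> y = free)
      else if fst (snd (snd d)) \<le> L then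
        (x = free \<and> y = free) \<or>
        (if snd (snd (snd d)) = 0 then
           (x = low \<and> y = gate0) \<or> (x = high \<and> y = high) \<or>
           (y = gate0 \<and> entry L rel (fst d) (fst (snd d)) (fst (snd (snd d))) x)
         else if snd (snd (snd d)) = 1 then
           (x = gate0 \<and> (y = low \<or> y = gate1)) \<or> (x = high \<and> y = gate1)
         else (x = low \<and> y = low) \<or>
           (x = gate1 \<and> (y = high \<or> y = exit_place L (fst d) (fst (snd d)) (fst (snd (snd d))))))
      else if snd (snd (snd d)) = 2 \<and> Suc (fst (snd d)) = m then False
      else (x = low \<and> y = low) \<or> (x = high \<and> y = high) \<or>
        (snd (snd (snd d)) = 0 \<and> x = free \<and> y = high))"

section \<open>Linear numbering of the times\<close>

definition times :: "nat \<Rightarrow> nat \<Rightarrow> (nat \<times> nat \<times> nat \<times> nat) list" where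
  "times L m = List.product [0..<2 * L] (List.product [0..<m] (List.product [0..<L + 2] [0..<3]))"

definition tm :: "nat \<Rightarrow> nat \<Rightarrow> nat \<Rightarrow> nat \<Rightarrow> nat \<Rightarrow> nat \<Rightarrow> nat" where
  "tm L m p c t s = ((p * m + c) * (L + 2) + t) * 3 + s"

lemma nth_product:
  "i < length xs \<Longrightarrow> j < length ys \<Longrightarrow> List.product xs ys ! (i * length ys + j) = (xs ! i, ys ! j)"
  using div_mult_add[of j "length ys" i] vertex_less[of j "length ys" i "length xs"]
  by (subst product_nth) simp_all

lemma length_times: "length (times L m) = 2 * L * (m * ((L + 2) * 3))"
  by (simp add: times_def)

lemma nth_times:
  assumes "p < 2 * L" "c < m" "t < L + 2" "s < 3"
  shows "times L m ! tm L m p c t s = (p, c, t, s)" "tm L m p c t s < length (times L m)"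
proof -
  have eq: "tm L m p c t s = p * (m * ((L + 2) * 3)) + (c * ((L + 2) * 3) + (t * 3 + s))"
    by (simp add: tm_def algebra_simps)
  have 1: "t * 3 + s < (L + 2) * 3" by (rule vertex_less) (use assms in auto)
  have 2: "c * ((L + 2) * 3) + (t * 3 + s) < m * ((L + 2) * 3)" by (rule vertex_less) (use assms 1 in auto)
  have 3: "List.product [0..<L + 2] [0..<3] ! (t * 3 + s) = (t, s)"
    using nth_product[of t "[0..<L + 2]" s "[0..<3]"] assms by (simp del: upt_Suc)
  have 4: "List.product [0..<m] (List.product [0..<L + 2] [0..<3]) ! (c * ((L + 2) * 3) + (t * 3 + s)) = (c, t, s)"
    using nth_product[of c "[0..<m]" "t * 3 + s" "List.product [0..<L + 2] [0..<3]"] assms 1 3 by (simp del: upt_Suc)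
  show "times L m ! tm L m p c t s = (p, c, t, s)"
    using nth_product[of p "[0..<2 * L]" "c * ((L + 2) * 3) + (t * 3 + s)"
        "List.product [0..<m] (List.product [0..<L + 2] [0..<3])"] assms 2 4
    unfolding eq times_def by (simp del: upt_Suc)
  show "tm L m p c t s < length (times L m)"
    unfolding eq length_times by (rule vertex_less) (use assms 2 in auto)
qed

locale gadget =
  fixes L m :: nat and ok rel :: "nat \<Rightarrow> nat \<Rightarrow> bool"
  assumes L: "L > 0" and m: "m > 0"
begin

abbreviation "M \<equiv> length (times L m)"
abbreviation "tim \<equiv> tm L m"
abbreviation "part p \<equiv> if p < L then p else p - L"

definition move :: "nat \<Rightarrow> place \<Rightarrow> place \<Rightarrow> bool" where
  "move t x y \<longleftrightarrow> gmove L m ok rel (times L m ! t) x y"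

definition start :: "nat \<Rightarrow> nat" where "start p = tim p 0 0 0"
definition finish :: "nat \<Rightarrow> nat" where "finish p = tim p (m - 1) (L + 1) 2"

definition groute :: "(nat \<Rightarrow> nat \<Rightarrow> place) \<Rightarrow> (nat \<Rightarrow> nat \<Rightarrow> nat \<Rightarrow> place) \<Rightarrow> bool" where
  "groute X V \<longleftrightarrow>
    (\<forall>p<2 * L. X p (start p) = low \<and> X p (finish p) = high \<and>
      (\<forall>t. start p \<le> t \<longrightarrow> t < finish p \<longrightarrow> move t (X p t) (X p (Suc t)))) \<and>
    (\<forall>i<L. \<forall>j<L. V i j 0 = pre i j \<and> V i j M = done i j \<and> (\<forall>t<M. move t (V i j t) (V i j (Suc t)))) \<and>
    (\<forall>p<2 * L. \<forall>i<L. \<forall>j<L. \<forall>t. start p \<le> t \<longrightarrow> t \<le> finish p \<longrightarrow> X p t \<noteq> V i j t) \<and>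
    (\<forall>i<L. \<forall>j<L. \<forall>i'<L. \<forall>j'<L. \<forall>t\<le>M. (i, j) \<noteq> (i', j') \<longrightarrow> V i j t \<noteq> V i' j' t)"

lemma move_tim:
  assumes "p < 2 * L" "c < m" "t < L + 2" "s < 3"
  shows "move (tim p c t s) x y \<longleftrightarrow> gmove L m ok rel (p, c, t, s) x y"
  using nth_times[OF assms] by (simp add: move_def)

lemma tim_Suc: "tim p c t (Suc s) = Suc (tim p c t s)"
  "tim p c (Suc t) 0 = Suc (tim p c t 2)" "tim p (Suc c) 0 0 = Suc (tim p c (L + 1) 2)"
  by (simp_all add: tm_def algebra_simps)

lemma start_0: "start 0 = 0" by (simp add: start_def tm_def)

lemma start_Suc: "start (Suc p) = Suc (finish p)"
proof -
  have "Suc p * m = p * m + (m - 1) + 1" using m by simp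
  then show ?thesis unfolding start_def finish_def tm_def by (simp only: add_mult_distrib) simp
qed

lemma start_last: "start (2 * L) = M"
  by (simp add: start_def tm_def length_times algebra_simps)

lemma finish_less: "p < 2 * L \<Longrightarrow> finish p < M"
  unfolding finish_def by (rule nth_times(2)) (use m in auto)

lemma tim_range:
  assumes "c < m" "t < L + 2" "s < 3"
  shows "start p \<le> tim p c t s" "tim p c t s \<le> finish p"
    "\<not> (c = m - 1 \<and> t = L + 1 \<and> s = 2) \<Longrightarrow> tim p c t s < finish p"
proof -
  have "(c * (L + 2) + t) * 3 + s < (m * (L + 2)) * 3" using assms by (intro vertex_less) auto
  moreover have f: "finish p = start p + ((m - 1) * (L + 2) + (L + 1)) * 3 + 2"
    by (simp add: finish_def start_def tm_def algebra_simps)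
  moreover have "m * (L + 2) = (m - 1) * (L + 2) + (L + 2)" using m by (cases m) simp_all
  moreover have t: "tim p c t s = start p + (c * (L + 2) + t) * 3 + s"
    by (simp add: start_def tm_def algebra_simps)
  ultimately show "start p \<le> tim p c t s" "tim p c t s \<le> finish p" by simp_all
  assume n: "\<not> (c = m - 1 \<and> t = L + 1 \<and> s = 2)"
  show "tim p c t s < finish p"
  proof (rule ccontr)
    assume "\<not> ?thesis"
    with \<open>tim p c t s \<le> finish p\<close> have "tim p c t s = finish p" by simp
    then have "((c * (L + 2) + t) * 3 + s) = ((m - 1) * (L + 2) + (L + 1)) * 3 + 2" using t f by simp
    moreover have "s < 3" "t < L + 2" using assms by auto
    ultimately have "c * (L + 2) + t = (m - 1) * (L + 2) + (L + 1)" "s = 2" by presburger+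
    then have "c = m - 1" "t = L + 1"
      using div_mult_add[of t "L + 2" c] div_mult_add[of "L + 1" "L + 2" "m - 1"] \<open>t < L + 2\<close>
      by (metis add_less_cancel_left one_less_numeral_iff semiring_norm(76))+
    with n \<open>s = 2\<close> show False by simp
  qed
qed

lemma start_mono: "p \<le> q \<Longrightarrow> start p \<le> start q"
  unfolding start_def tm_def by (intro add_mono mult_le_mono) auto

definition nxt :: "nat \<Rightarrow> nat \<Rightarrow> nat \<Rightarrow> nat \<Rightarrow> nat \<Rightarrow> nat \<Rightarrow> bool" where
  "nxt c t s c' t' s' \<longleftrightarrow> (s = 0 \<and> c' = c \<and> t' = t \<and> s' = 1) \<or> (s = 1 \<and> c' = c \<and> t' = t \<and> s' = 2) \<or>
     (s = 2 \<and> t < L + 1 \<and> c' = c \<and> t' = Suc t \<and> s' = 0) \<or>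
     (s = 2 \<and> t = L + 1 \<and> Suc c < m \<and> c' = Suc c \<and> t' = 0 \<and> s' = 0)"

lemma nxt_bounds:
  assumes "nxt c t s c' t' s'" "c < m" "t < L + 2" "s < 3"
  shows "c' < m" "t' < L + 2" "s' < 3" "tim p c' t' s' = Suc (tim p c t s)"
    "\<not> (c = m - 1 \<and> t = L + 1 \<and> s = 2)"
  using assms tim_Suc(1)[of p c t 0] tim_Suc(1)[of p c t 1] tim_Suc(2)[of p c t] tim_Suc(3)[of p c]
  unfolding nxt_def by (auto simp: numeral_2_eq_2)

lemma ex_nxt:
  assumes "c < m" "t < L + 2" "s < 3" "\<not> (c = m - 1 \<and> t = L + 1 \<and> s = 2)"
  shows "\<exists>c' t' s'. nxt c t s c' t' s'"
proof -
  consider "s = 0" | "s = 1" | "s = 2" "t < L + 1" | "s = 2" "t = L + 1" "Suc c < m"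
  proof -
    have "s = 0 \<or> s = 1 \<or> s = 2 \<and> t < L + 1 \<or> s = 2 \<and> t = L + 1 \<and> Suc c < m"
      using assms by (cases "t = L + 1"; cases "s = 2") auto
    then show thesis using that by blast
  qed
  then show ?thesis unfolding nxt_def by cases blast+
qed

lemma tim_inj:
  assumes "c < m" "t < L + 2" "s < 3" "c' < m" "t' < L + 2" "s' < 3" "p < 2 * L" "p' < 2 * L"
    "tim p c t s = tim p' c' t' s'"
  shows "p = p' \<and> c = c' \<and> t = t' \<and> s = s'"
proof -
  have "(p, c, t, s) = (p', c', t', s')"
    unfolding nth_times(1)[OF assms(7,1,2,3), symmetric] nth_times(1)[OF assms(8,4,5,6), symmetric]
    by (rule arg_cong[OF assms(9)])
  then show ?thesis by blast
qed

text \<open>Carries an invariant from one time of a phase to any later time of it. The times are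
  compared in phase 0 because all phases have the same internal order.\<close>

lemma phase_induct [consumes 4, case_names step]:
  assumes "c < m" "t < L + 2" "s < 3" "P c t s"
    and step: "\<And>c t s c' t' s'. c < m \<Longrightarrow> t < L + 2 \<Longrightarrow> s < 3 \<Longrightarrow> nxt c t s c' t' s' \<Longrightarrow> P c t s \<Longrightarrow> P c' t' s'"
    and fin: "c' < m" "t' < L + 2" "s' < 3" "tim 0 c t s \<le> tim 0 c' t' s'"
  shows "P c' t' s'"
proof -
  have "\<forall>c t s. c < m \<longrightarrow> t < L + 2 \<longrightarrow> s < 3 \<longrightarrow> P c t s \<longrightarrow> tim 0 c' t' s' = tim 0 c t s + n \<longrightarrow> P c' t' s'" for n
  proof (induction n)
    case 0
    show ?case
    proof (intro allI impI)
      fix c t s assume *: "c < m" "t < L + 2" "s < 3" "P c t s" "tim 0 c' t' s' = tim 0 c t s + 0"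
      from *(5) have e: "tim 0 c t s = tim 0 c' t' s'" by (simp only: add_0_right)
      have "c = c' \<and> t = t' \<and> s = s'"
        using tim_inj[OF *(1-3) fin(1-3) _ _ e] L by simp
      with * show "P c' t' s'" by simp
    qed
  next
    case (Suc n)
    show ?case
    proof (intro allI impI)
      fix c t s assume *: "c < m" "t < L + 2" "s < 3" "P c t s" "tim 0 c' t' s' = tim 0 c t s + Suc n"
      have last: "\<not> (c = m - 1 \<and> t = L + 1 \<and> s = 2)"
        using tim_range(2)[OF fin(1-3), of 0] *(5) unfolding finish_def by auto
      from ex_nxt[OF *(1-3) last] obtain d u r where d: "nxt c t s d u r" by blast
      note b = nxt_bounds(1-3)[OF d *(1-3)] nxt_bounds(4)[OF d *(1-3), of 0]
      from step[OF *(1-3) d *(4)] Suc b * show "P c' t' s'" by simp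
    qed
  qed
  moreover from fin(4) obtain n where "tim 0 c' t' s' = tim 0 c t s + n" using le_Suc_ex by blast
  ultimately show ?thesis using assms(1-4) by blast
qed

lemma tim_0_le: "c < m \<Longrightarrow> t < L + 2 \<Longrightarrow> s < 3 \<Longrightarrow> tim 0 0 0 0 \<le> tim 0 c t s"
  by (simp add: tm_def)

lemma tim_le_last: "c < m \<Longrightarrow> t < L + 2 \<Longrightarrow> s < 3 \<Longrightarrow> tim 0 c t s \<le> tim 0 (m - 1) (L + 1) 2"
  using tim_range(2)[of c t s 0] by (simp add: finish_def)

end

section \<open>Soundness: the shape of an arbitrary routing\<close>

locale gadget_routing = gadget +
  fixes X :: "nat \<Rightarrow> nat \<Rightarrow> place" and V :: "nat \<Rightarrow> nat \<Rightarrow> nat \<Rightarrow> place"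
  assumes route: "groute X V"
begin

lemmas routeX = route[unfolded groute_def, THEN conjunct1, rule_format]
lemmas routeV = route[unfolded groute_def, THEN conjunct2, THEN conjunct1, rule_format]
lemmas routeXV = route[unfolded groute_def, THEN conjunct2, THEN conjunct2, THEN conjunct1, rule_format]
lemmas routeVV = route[unfolded groute_def, THEN conjunct2, THEN conjunct2, THEN conjunct2, rule_format]

lemma X_ends: "p < 2 * L \<Longrightarrow> X p (start p) = low" "p < 2 * L \<Longrightarrow> X p (finish p) = high"
  using routeX by simp_all

lemma V_ends: "i < L \<Longrightarrow> j < L \<Longrightarrow> V i j 0 = pre i j" "i < L \<Longrightarrow> j < L \<Longrightarrow> V i j M = done i j"
  using routeV by simp_all

lemma X_move:
  assumes "p < 2 * L" "c < m" "t < L + 2" "s < 3" "\<not> (c = m - 1 \<and> t = L + 1 \<and> s = 2)"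
  shows "gmove L m ok rel (p, c, t, s) (X p (tim p c t s)) (X p (Suc (tim p c t s)))"
proof -
  have "move (tim p c t s) (X p (tim p c t s)) (X p (Suc (tim p c t s)))"
    using routeX[OF assms(1), THEN conjunct2, THEN conjunct2] tim_range(1,3)[OF assms(2-4), of p] assms(5) by simp
  then show ?thesis using move_tim assms by simp
qed

lemma V_move':
  "i < L \<Longrightarrow> j < L \<Longrightarrow> t < M \<Longrightarrow> move t (V i j t) (V i j (Suc t))"
  using routeV by simp

lemma V_move:
  assumes "i < L" "j < L" "p < 2 * L" "c < m" "t < L + 2" "s < 3"
  shows "gmove L m ok rel (p, c, t, s) (V i j (tim p c t s)) (V i j (Suc (tim p c t s)))"
  using V_move'[OF assms(1,2) nth_times(2)[OF assms(3-6)]] move_tim assms by simp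

lemma XV_disjoint:
  assumes "p < 2 * L" "i < L" "j < L" "c < m" "t < L + 2" "s < 3"
  shows "X p (tim p c t s) \<noteq> V i j (tim p c t s)"
  by (rule routeXV[OF assms(1-3) tim_range(1,2)[OF assms(4-6)]])

lemma VV_disjoint:
  assumes "i < L" "j < L" "i' < L" "j' < L" "(i, j) \<noteq> (i', j')" "t \<le> M"
  shows "V i j t \<noteq> V i' j' t"
  by (rule routeVV) (use assms in auto)

text \<open>Within a phase, exit places are never left, so the value token, which ends in \<open>high\<close>, never takes one.\<close>

definition trap :: "nat \<Rightarrow> place \<Rightarrow> bool" where
  "trap p x \<longleftrightarrow> fst x = (if p < L then 6 else 7)"

lemma trap_stay: "trap p x \<Longrightarrow> gmove L m ok rel (p, c, t, s) x y \<Longrightarrow> y = x"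
  by (auto simp: trap_def gmove_def entry_def split: if_splits)

text \<open>From a place with tag at least 5 only entry moves lead elsewhere, so without a possible
  entry the verifier waits.\<close>

lemma V_stay_phase:
  assumes "i < L" "j < L" "p < 2 * L" "c < m" "t < L + 2" "s < 3" "V i j (tim p c t s) = x" "5 \<le> fst x"
    and no: "\<And>c t. \<not> entry L rel p c t x"
  shows "V i j (start (Suc p)) = x"
proof -
  have stay: "gmove L m ok rel (p, c, t, s) x y \<Longrightarrow> y = x" for c t s y
    using no[of c t] assms(8) by (auto simp: gmove_def split: if_splits)
  have "V i j (tim p (m - 1) (L + 1) 2) = x"
  proof (rule phase_induct[of c t s "\<lambda>c t s. V i j (tim p c t s) = x" "m - 1" "L + 1" 2])
    fix c t s c' t' s' assume step: "c < m" "t < L + 2" "s < 3" "nxt c t s c' t' s'" "V i j (tim p c t s) = x"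
    show "V i j (tim p c' t' s') = x"
      using V_move[OF assms(1-3) step(1-3)] step(5) stay nxt_bounds(4)[OF step(4,1-3), of p] by simp
  qed (use m tim_le_last assms in auto)
  then show ?thesis using V_move[OF assms(1-3), of "m - 1" "L + 1" 2] m stay
    unfolding start_Suc finish_def by auto
qed

text \<open>Makes a missed crossing fatal: a verifier whose place admits no entry in the remaining
  phases is still there at the end.\<close>

lemma V_stuck:
  assumes "i < L" "j < L" "V i j (start p) = x" "5 \<le> fst x" "p \<le> 2 * L"
    and no: "\<And>p' c t. p \<le> p' \<Longrightarrow> \<not> entry L rel p' c t x"
  shows "V i j M = x"
  using assms(5,3) no
proof (induction rule: inc_induct)
  case base
  then show ?case by (simp add: start_last)
next
  case (step n)
  have "V i j (start (Suc n)) = x"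
    by (rule V_stay_phase[of i j n 0 0 0]) (use step assms m in \<open>auto simp: start_def\<close>)
  with step show ?case by simp
qed

end

text \<open>The verifiers concerned are \<open>(p, k)\<close> in a phase \<open>p < L\<close> and
  \<open>(k, p - L)\<close> in a later one. Numbering them by \<open>k\<close> alone lets the same
  argument treat both kinds of phases; \<open>u k\<close> is the value remembered from the first
  crossing.\<close>

locale gadget_phase = gadget_routing +
  fixes p :: nat and u :: "nat \<Rightarrow> nat"
  assumes p: "p < 2 * L"
    and V_start: "\<And>k. k < L \<Longrightarrow> V (if p < L then p else k) (if p < L then k else p - L) (start p) =
      (if p < L then pre p k else mid k (p - L) (u k))"
begin

definition "src k = (if p < L then pre p k else mid k (p - L) (u k))"
definition "ver k = V (if p < L then p else k) (if p < L then k else p - L)"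
abbreviation "x c t s \<equiv> X p (tim p c t s)"
abbreviation "w k c t s \<equiv> ver k (tim p c t s)"

lemma xmove: "c < m \<Longrightarrow> t < L + 2 \<Longrightarrow> s < 3 \<Longrightarrow> nxt c t s c' t' s' \<Longrightarrow>
    gmove L m ok rel (p, c, t, s) (x c t s) (x c' t' s')"
  using X_move[OF p, of c t s] nxt_bounds(4)[of c t s c' t' s' p] nxt_bounds(5)[of c t s c' t' s'] by simp

lemma idx: "k < L \<Longrightarrow> (if p < L then p else k) < L" "k < L \<Longrightarrow> (if p < L then k else p - L) < L"
  using p by auto

lemma wmove: "k < L \<Longrightarrow> c < m \<Longrightarrow> t < L + 2 \<Longrightarrow> s < 3 \<Longrightarrow> nxt c t s c' t' s' \<Longrightarrow>
    gmove L m ok rel (p, c, t, s) (w k c t s) (w k c' t' s')"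
  unfolding ver_def
  using V_move[OF idx(1) idx(2) p] nxt_bounds(4) by metis

lemma wlast: "k < L \<Longrightarrow> gmove L m ok rel (p, m - 1, L + 1, 2) (w k (m - 1) (L + 1) 2) (ver k (start (Suc p)))"
  unfolding ver_def start_Suc finish_def by (rule V_move[OF idx(1) idx(2) p]) (use m in auto)

lemma xw: "k < L \<Longrightarrow> c < m \<Longrightarrow> t < L + 2 \<Longrightarrow> s < 3 \<Longrightarrow> x c t s \<noteq> w k c t s"
  unfolding ver_def by (rule XV_disjoint[OF p idx(1) idx(2)])

lemma ww: "k < L \<Longrightarrow> l < L \<Longrightarrow> k \<noteq> l \<Longrightarrow> c < m \<Longrightarrow> t < L + 2 \<Longrightarrow> s < 3 \<Longrightarrow> w k c t s \<noteq> w l c t s"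
  unfolding ver_def
  by (rule VV_disjoint[OF idx(1) idx(2) idx(1) idx(2)]) (use nth_times(2)[OF p, of c m t s] in auto)

lemma x_not_trap: assumes "c < m" "t < L + 2" "s < 3" shows "\<not> trap p (x c t s)"
proof
  assume "trap p (x c t s)"
  have "trap p (x (m - 1) (L + 1) 2)"
  proof (rule phase_induct[of c t s "\<lambda>c t s. trap p (x c t s)" "m - 1" "L + 1" 2])
    fix c t s c' t' s' assume step: "c < m" "t < L + 2" "s < 3" "nxt c t s c' t' s'" "trap p (x c t s)"
    show "trap p (x c' t' s')" using trap_stay[OF step(5) xmove[OF step(1-4)]] step(5) by simp
  qed (use m tim_le_last assms \<open>trap p (x c t s)\<close> in auto)
  then show False using X_ends(2)[OF p] by (simp add: finish_def trap_def split: if_splits)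
qed

lemma exit_trap: "trap p (exit_place L p c t)"
  by (simp add: trap_def exit_place_def)

lemma xmove_core:
  assumes "c < m" "t < L + 2" "s < 3" "nxt c t s c' t' s'" "fst (x c t s) < 5"
  shows "fst (x c' t' s') < 5"
  using xmove[OF assms(1-4)] x_not_trap[OF nxt_bounds(1-3)[OF assms(4,1-3)]] assms(5)
    exit_trap[of c t]
  by (auto simp: gmove_def split: if_splits)

lemma x_core: assumes "c < m" "t < L + 2" "s < 3" shows "fst (x c t s) < 5"
proof -
  have "fst (x 0 0 0) < 5" using X_ends(1)[OF p] by (simp add: start_def)
  show ?thesis
    by (rule phase_induct[of 0 0 0 "\<lambda>c t s. fst (x c t s) < 5" c t s, OF _ _ _ _ xmove_core])
       (use m tim_0_le assms \<open>fst (x 0 0 0) < 5\<close> in auto)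
qed

definition highP :: "nat \<Rightarrow> nat \<Rightarrow> nat \<Rightarrow> bool" where
  "highP c t s \<longleftrightarrow> x c t s = (if 1 \<le> t \<and> t \<le> L \<and> s = 2 then gate1 else high)"

text \<open>The only alternative to the upper lane is to step from \<open>gate1\<close> into an exit
  place, which \<open>x_not_trap\<close> forbids.\<close>

lemma highP_step:
  assumes "c < m" "t < L + 2" "s < 3" "nxt c t s c' t' s'" "highP c t s"
  shows "highP c' t' s'"
  using xmove[OF assms(1-4)] x_not_trap[OF nxt_bounds(1-3)[OF assms(4,1-3)]] assms(4,5)
    exit_trap[of c t]
  by (auto simp: gmove_def highP_def nxt_def entry_def split: if_splits)

lemma highP_later:
  assumes "highP c t s" "c < m" "t < L + 2" "s < 3" "c' < m" "t' < L + 2" "s' < 3" "tim 0 c t s \<le> tim 0 c' t' s'"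
  shows "highP c' t' s'"
  by (rule phase_induct[of c t s highP c' t' s', OF _ _ _ _ highP_step]) (use assms in auto)

text \<open>\<open>free\<close> is included since a verifier in the lower lane can enter it in slot
  0. The ways up, from \<open>free\<close> to \<open>high\<close> and from \<open>gate0\<close> to
  \<open>gate1\<close>, are closed while the value token occupies the upper lane.\<close>

definition lowP :: "nat \<Rightarrow> nat \<Rightarrow> nat \<Rightarrow> nat \<Rightarrow> bool" where
  "lowP k c t s \<longleftrightarrow> (w k c t s = (if 1 \<le> t \<and> t \<le> L \<and> s = 1 then gate0 else low) \<or> w k c t s = free)"

text \<open>A verifier in the lower lane while the value token is in the upper one can never leave.\<close>

lemma stuck:
  assumes "k < L" "highP c t s" "lowP k c t s" "c < m" "t < L + 2" "s < 3"
  shows False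
proof -
  have "highP (m - 1) (L + 1) 2 \<and> lowP k (m - 1) (L + 1) 2"
  proof (rule phase_induct[of c t s "\<lambda>c t s. highP c t s \<and> lowP k c t s" "m - 1" "L + 1" 2])
    fix c t s c' t' s'
    assume step: "c < m" "t < L + 2" "s < 3" "nxt c t s c' t' s'" "highP c t s \<and> lowP k c t s"
    have h: "highP c' t' s'" using highP_step step by blast
    have "lowP k c' t' s'"
      using wmove[OF assms(1) step(1-4)] xw[OF assms(1) nxt_bounds(1-3)[OF step(4,1-3)]] step(4,5) h
      by (auto simp: gmove_def lowP_def highP_def nxt_def entry_def split: if_splits)
    with h show "highP c' t' s' \<and> lowP k c' t' s'" by blast
  qed (use m tim_le_last assms in auto)
  then show False using wlast[OF assms(1)] m
    by (auto simp: gmove_def lowP_def split: if_splits)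
qed

text \<open>Such a value exists because verifiers can enter only there, and it is unique because the
  value token leaves \<open>free\<close> for the upper lane and never comes back.\<close>

definition "val = (SOME a. a < m \<and> x a 1 0 = free)"

lemma x_free_later:
  assumes "c < m" "x c 1 0 = free" "1 \<le> t" "t \<le> L + 1"
  shows "x c t 0 = free" "t \<le> L \<Longrightarrow> x c t 1 = free" "t \<le> L \<Longrightarrow> x c t 2 = free"
proof -
  have st: "x c t 1 = free \<and> x c t 2 = free \<and> x c (Suc t) 0 = free" if "x c t 0 = free" "1 \<le> t" "t \<le> L" for t
    using that assms(1) xmove[of c t 0 c t 1] xmove[of c t 1 c t 2] xmove[of c t 2 c "Suc t" 0]
    by (auto simp: gmove_def nxt_def entry_def split: if_splits)
  have "1 \<le> t \<Longrightarrow> t \<le> L + 1 \<Longrightarrow> x c t 0 = free"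
  proof (induction t rule: dec_induct[of 1])
    case (step n) then show ?case using st[of n] by simp
  qed (use assms in auto)
  then show a: "x c t 0 = free" using assms by simp
  show "t \<le> L \<Longrightarrow> x c t 1 = free" "t \<le> L \<Longrightarrow> x c t 2 = free" using st[OF a] assms by auto
qed

text \<open>\<open>free\<close> is entered only in slot 0, so being there later means having been
  there since.\<close>

lemma x_free_earlier:
  assumes "c < m" "1 \<le> t" "t \<le> L + 1" "x c t 0 = free"
  shows "x c 1 0 = free"
  using assms(2-4)
proof (induction t rule: dec_induct[of 1])
  case (step n)
  have "x c n 0 = free"
    using step assms(1) L xmove[of c n 0 c n 1] xmove[of c n 1 c n 2] xmove[of c n 2 c "Suc n" 0]
    by (auto simp: gmove_def nxt_def entry_def exit_place_def split: if_splits)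
  then show ?case using step by simp
qed

lemma x_free_ok: "c < m \<Longrightarrow> x c 1 0 = free \<Longrightarrow> ok (part p) c"
  using xmove[of c 0 0 c 0 1] xmove[of c 0 1 c 0 2] xmove[of c 0 2 c 1 0]
  by (auto simp: gmove_def nxt_def split: if_splits)

lemma x_free_high:
  assumes "c < m" "x c 1 0 = free" shows "highP c (L + 1) 1"
  using x_free_later(1)[OF assms, of "L + 1"] xmove[of c "L + 1" 0 c "L + 1" 1] assms(1)
  by (auto simp: gmove_def nxt_def highP_def split: if_splits)

lemma x_free_unique:
  assumes "c < m" "c' < m" "x c 1 0 = free" "x c' 1 0 = free" shows "c = c'"
proof -
  have "\<not> c < c'" if *: "c < m" "c' < m" "x c 1 0 = free" "x c' 1 0 = free" for c c'
  proof
    assume "c < c'"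
    have "highP c' 1 0"
    proof (rule highP_later[OF x_free_high[OF *(1,3)]])
      have "c * (L + 2) + (L + 2) \<le> c' * (L + 2)" using \<open>c < c'\<close>
        by (metis Suc_leI mult_Suc mult_le_mono1 add.commute)
      then show "tim 0 c (L + 1) 1 \<le> tim 0 c' 1 0" by (simp add: tm_def)
    qed (use * in auto)
    then show False using * L by (simp add: highP_def)
  qed
  then show ?thesis using assms by (metis linorder_neqE_nat)
qed

lemma x_boundary:
  assumes "c < m" "1 \<le> t" "t \<le> L" "x c t 1 \<noteq> gate0"
  shows "x c t 0 = free \<or> highP c t 0"
  using xmove[of c t 0 c t 1] x_core[of c t 0] assms
  by (auto simp: gmove_def nxt_def highP_def split: if_splits)

lemma src_5: "5 \<le> fst (src k)"
  by (simp add: src_def)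

lemma entry_src: "entry L rel p c t (src k) \<Longrightarrow> t \<ge> 1 \<Longrightarrow> t = Suc k \<and> (p < L \<or> rel (u k) c)"
  by (auto simp: entry_def src_def split: if_splits)

lemma no_entry_later: "p < p' \<Longrightarrow> \<not> entry L rel p' c t (src k)"
  using p by (auto simp: entry_def src_def split: if_splits)

text \<open>A verifier that does not leave in this phase finds no entry from its place afterwards
  and cannot end in \<open>done\<close>.\<close>

lemma leaves:
  assumes k: "k < L"
  shows "\<exists>c<m. w k c (Suc k) 0 = src k \<and> w k c (Suc k) 1 = gate0"
proof (rule ccontr)
  assume no: "\<not> ?thesis"
  have "w k 0 0 0 = src k" using V_start[OF k] by (simp add: ver_def start_def src_def)
  have "w k (m - 1) (L + 1) 2 = src k"
  proof (rule phase_induct[of 0 0 0 "\<lambda>c t s. w k c t s = src k" "m - 1" "L + 1" 2])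
    fix c t s c' t' s' assume step: "c < m" "t < L + 2" "s < 3" "nxt c t s c' t' s'" "w k c t s = src k"
    show "w k c' t' s' = src k"
    proof (rule ccontr)
      assume "w k c' t' s' \<noteq> src k"
      with wmove[OF k step(1-4)] step(5) src_5[of k]
      have "1 \<le> t" "s = 0" "w k c' t' s' = gate0" "entry L rel p c t (src k)"
        by (auto simp: gmove_def split: if_splits)
      with entry_src[of c t k] step no show False by (auto simp: nxt_def)
    qed
  qed (use m tim_le_last \<open>w k 0 0 0 = src k\<close> in auto)
  then have "ver k (start (Suc p)) = src k"
    using wlast[OF k] m src_5[of k] by (auto simp: gmove_def split: if_splits)
  then have "ver k M = src k"
    unfolding ver_def by (intro V_stuck[of _ _ "Suc p"]) (use k p src_5 no_entry_later in auto)
  then show False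
    using V_ends(2)[OF idx(1)[OF k] idx(2)[OF k]] unfolding ver_def src_def by (auto split: if_splits)
qed

text \<open>With \<open>gate0\<close> taken by the verifier, the value token is in
  \<open>free\<close> or in the upper lane. In the latter case \<open>gate1\<close> is blocked and
  the verifier is stuck below.\<close>

lemma leaves_free:
  assumes "k < L" "c < m" "w k c (Suc k) 0 = src k" "w k c (Suc k) 1 = gate0"
  shows "x c 1 0 = free"
proof -
  have ng: "x c (Suc k) 1 \<noteq> gate0" using xw[of k c "Suc k" 1] assms by simp
  have "\<not> highP c (Suc k) 0"
  proof
    assume h: "highP c (Suc k) 0"
    have h1: "highP c (Suc k) 1" using highP_step[of c "Suc k" 0 c "Suc k" 1] h assms by (simp add: nxt_def)
    have h2: "highP c (Suc k) 2" using highP_step[of c "Suc k" 1 c "Suc k" 2] h1 assms by (simp add: nxt_def)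
    show False
      by (rule stuck[OF assms(1) h1]) (use assms in \<open>auto simp: lowP_def\<close>)
  qed
  then have "x c (Suc k) 0 = free" using x_boundary[OF assms(2) _ _ ng] assms(1) by auto
  then show ?thesis by (intro x_free_earlier[of c "Suc k"]) (use assms in auto)
qed

lemma val: "val < m" "x val 1 0 = free"
proof -
  obtain c where "c < m" "x c 1 0 = free" using leaves[OF L] leaves_free[OF L] by blast
  then have "val < m \<and> x val 1 0 = free" unfolding val_def by (rule_tac someI[of _ c]) simp
  then show "val < m" "x val 1 0 = free" by simp_all
qed

lemma leaves_val:
  assumes "k < L" shows "w k val (Suc k) 0 = src k" "w k val (Suc k) 1 = gate0"
  using leaves[OF assms] leaves_free[OF assms] x_free_unique val by metis+

lemma val_ok: "ok (part p) val"
  by (rule x_free_ok[OF val])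

lemma val_rel: assumes "k < L" "\<not> p < L" shows "rel (u k) val"
proof -
  have "gmove L m ok rel (p, val, Suc k, 0) (src k) gate0"
    using wmove[OF assms(1) val(1), of "Suc k" 0 val "Suc k" 1] leaves_val[OF assms(1)] assms(1)
    by (simp add: nxt_def)
  then have "entry L rel p val (Suc k) (src k)"
    using src_5[of k] assms(1) by (auto simp: gmove_def src_def split: if_splits)
  then show ?thesis using entry_src[of val "Suc k" k] assms by auto
qed

text \<open>In the next slot the lower lane passes \<open>gate0\<close>, which the next verifier
  occupies. After the last slot the value token has just moved up, and the verifier is
  stuck.\<close>

lemma no_low:
  assumes k: "k < L" shows "w k val (Suc (Suc k)) 0 \<noteq> low"
proof
  assume lo: "w k val (Suc (Suc k)) 0 = low"
  show False
  proof (cases "Suc k < L")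
    case True
    then have "w k val (Suc (Suc k)) 1 = gate0"
      using wmove[OF k val(1), of "Suc (Suc k)" 0 val "Suc (Suc k)" 1] lo by (auto simp: nxt_def gmove_def entry_def split: if_splits)
    with leaves_val(2)[OF True] ww[OF k True _ val(1), of "Suc (Suc k)" 1] True show False by simp
  next
    case False
    then have kL: "Suc k = L" using k by simp
    have "w k val (L + 1) 1 = low"
      using wmove[OF k val(1), of "L + 1" 0 val "L + 1" 1] lo kL by (auto simp: nxt_def gmove_def split: if_splits)
    then show False
      by (intro stuck[OF k x_free_high[OF val]]) (use val in \<open>auto simp: lowP_def\<close>)
  qed
qed

lemma at_gate1: assumes k: "k < L" shows "w k val (Suc k) 2 = gate1"
proof (rule ccontr)
  assume "w k val (Suc k) 2 \<noteq> gate1"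
  then have "w k val (Suc k) 2 = low"
    using wmove[OF k val(1), of "Suc k" 1 val "Suc k" 2] leaves_val(2)[OF k] k
    by (auto simp: nxt_def gmove_def split: if_splits)
  then have "w k val (Suc (Suc k)) 0 = low"
    using wmove[OF k val(1), of "Suc k" 2 val "Suc (Suc k)" 0] k
    by (auto simp: nxt_def gmove_def split: if_splits)
  with no_low[OF k] show False by blast
qed

text \<open>The upper lane fails symmetrically: in the next slot it passes \<open>gate1\<close>,
  where the next verifier is, and after the last slot it contains the value token itself.\<close>

lemma at_exit: assumes k: "k < L" shows "w k val (Suc (Suc k)) 0 = exit_place L p val (Suc k)"
proof (rule ccontr)
  assume "w k val (Suc (Suc k)) 0 \<noteq> exit_place L p val (Suc k)"
  then have hi: "w k val (Suc (Suc k)) 0 = high"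
    using wmove[OF k val(1), of "Suc k" 2 val "Suc (Suc k)" 0] at_gate1[OF k] k
    by (auto simp: nxt_def gmove_def split: if_splits)
  show False
  proof (cases "Suc k < L")
    case True
    then have "w k val (Suc (Suc k)) 2 = gate1"
      using hi wmove[OF k val(1), of "Suc (Suc k)" 0 val "Suc (Suc k)" 1]
        wmove[OF k val(1), of "Suc (Suc k)" 1 val "Suc (Suc k)" 2]
      by (auto simp: nxt_def gmove_def entry_def split: if_splits)
    with at_gate1[OF True] ww[OF k True _ val(1), of "Suc (Suc k)" 2] True show False by simp
  next
    case False
    then have kL: "Suc k = L" using k by simp
    have "w k val (L + 1) 1 = high"
      using wmove[OF k val(1), of "L + 1" 0 val "L + 1" 1] hi kL by (auto simp: nxt_def gmove_def split: if_splits)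
    with x_free_high[OF val] xw[OF k val(1), of "L + 1" 1] show False by (simp add: highP_def)
  qed
qed

lemma V_next:
  assumes k: "k < L"
  shows "V (if p < L then p else k) (if p < L then k else p - L) (start (Suc p)) = exit_place L p val (Suc k)"
  by (rule V_stay_phase[OF idx(1)[OF k] idx(2)[OF k] p val(1) _ _ at_exit[OF k, unfolded ver_def]])
     (use k p in \<open>auto simp: exit_place_def entry_def split: if_splits\<close>)

end

section \<open>Induction over the phases\<close>

context gadget_routing
begin

text \<open>The position expected at the start of phase \<open>q\<close>: the verifier
  \<open>(i, j)\<close> crosses in the phases \<open>i\<close> and \<open>L + j\<close> and in
  between stores the value of the first.\<close>

definition home :: "(nat \<Rightarrow> nat) \<Rightarrow> nat \<Rightarrow> nat \<Rightarrow> nat \<Rightarrow> place" where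
  "home v q i j = (if q \<le> i then pre i j else if q \<le> L + j then mid i j (v i) else done i j)"

definition good :: "(nat \<Rightarrow> nat) \<Rightarrow> nat \<Rightarrow> bool" where
  "good v q \<longleftrightarrow> v q < m \<and> ok (part q) (v q) \<and> (L \<le> q \<longrightarrow> (\<forall>k<L. rel (v k) (v q)))"

lemma phase_step:
  assumes q: "q < 2 * L" and inv: "\<And>i j. i < L \<Longrightarrow> j < L \<Longrightarrow> V i j (start q) = home v q i j"
  shows "\<exists>a. good (v(q := a)) q \<and> (\<forall>i<L. \<forall>j<L. V i j (start (Suc q)) = home (v(q := a)) (Suc q) i j)"
proof -
  interpret gadget_phase L m ok rel X V q v
    by unfold_locales (use q inv in \<open>auto simp: home_def\<close>)
  have "good (v(q := val)) q"
    unfolding good_def using val(1) val_ok val_rel by auto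
  moreover have "V i j (start (Suc q)) = home (v(q := val)) (Suc q) i j" if ij: "i < L" "j < L" for i j
  proof -
    consider "q = i" | "q = L + j" | "q \<noteq> i" "q \<noteq> L + j" by blast
    then show ?thesis
    proof cases
      case 1
      then show ?thesis using V_next[of j] ij by (simp add: exit_place_def home_def)
    next
      case 2
      then show ?thesis using V_next[of i] ij by (simp add: exit_place_def home_def)
    next
      case 3
      have "V i j (start (Suc q)) = home v q i j"
        by (rule V_stay_phase[OF ij q, of 0 0 0])
           (use 3 ij q m inv[OF ij] in \<open>auto simp: start_def home_def entry_def split: if_splits\<close>)
      moreover have "home (v(q := val)) (Suc q) i j = home v q i j"
        using 3 ij by (auto simp: home_def)
      ultimately show ?thesis by simp
    qed
  qed
  ultimately show ?thesis by blast
qed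

lemma phases:
  "q \<le> 2 * L \<Longrightarrow> \<exists>v. (\<forall>r<q. good v r) \<and> (\<forall>i<L. \<forall>j<L. V i j (start q) = home v q i j)"
proof (induction q)
  case 0
  show ?case using V_ends by (simp add: start_0 home_def)
next
  case (Suc q)
  then obtain v where v: "\<And>r. r < q \<Longrightarrow> good v r" "\<And>i j. i < L \<Longrightarrow> j < L \<Longrightarrow> V i j (start q) = home v q i j"
    by (meson Suc_leD)
  from phase_step[of q v] Suc.prems v(2) obtain a where a: "good (v(q := a)) q"
    "\<forall>i<L. \<forall>j<L. V i j (start (Suc q)) = home (v(q := a)) (Suc q) i j" by auto
  have "good (v(q := a)) r" if "r < q" for r
    using v(1)[OF that] that unfolding good_def by auto
  then have "\<forall>r<Suc q. good (v(q := a)) r" using a(1) less_Suc_eq by auto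
  with a(2) show ?case by blast
qed

lemma sound:
  "\<exists>v v'. (\<forall>i<L. v i < m \<and> ok i (v i) \<and> v' i < m \<and> ok i (v' i)) \<and> (\<forall>i<L. \<forall>j<L. rel (v i) (v' j))"
proof -
  from phases[of "2 * L"] obtain v where v: "\<And>r. r < 2 * L \<Longrightarrow> good v r" by blast
  \<comment> \<open>The second copy of the variable \<open>i\<close> is the value chosen in phase
    \<open>L + i\<close>.\<close>
  have "v i < m \<and> ok i (v i) \<and> v (L + i) < m \<and> ok i (v (L + i))" if "i < L" for i
    using v[of i] v[of "L + i"] that by (simp add: good_def)
  moreover have "rel (v i) (v (L + j))" if "i < L" "j < L" for i j
    using v[of "L + j"] that by (simp add: good_def)
  ultimately show ?thesis by (intro exI[of _ v] exI[of _ "\<lambda>i. v (L + i)"]) simp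
qed

end

section \<open>Completeness: the intended routing\<close>

context gadget
begin

lemma tim_ex: "q < M \<Longrightarrow> \<exists>p c t s. p < 2 * L \<and> c < m \<and> t < L + 2 \<and> s < 3 \<and> q = tim p c t s"
proof (intro exI conjI)
  assume q: "q < M"
  let ?t = "q div 3"
  let ?c = "?t div (L + 2)"
  show "q = tim (?c div m) (?c mod m) (?t mod (L + 2)) (q mod 3)"
    unfolding tm_def by (simp only: div_mult_mod_eq)
  show "q mod 3 < 3" "?t mod (L + 2) < L + 2" "?c mod m < m" using m by simp_all
  have "q < ((2 * L) * m * (L + 2)) * 3" using q by (simp add: length_times algebra_simps)
  then have "?t < (2 * L) * m * (L + 2)" by (simp add: div_less_iff_less_mult)
  then have "?c < (2 * L) * m" by (simp add: div_less_iff_less_mult)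
  then show "?c div m < 2 * L" using m by (simp add: div_less_iff_less_mult)
qed

lemma phase_times:
  assumes p: "p < 2 * L" and q: "start p \<le> q" "q \<le> finish p"
  shows "\<exists>c t s. c < m \<and> t < L + 2 \<and> s < 3 \<and> q = tim p c t s"
proof -
  from q(2) finish_less[OF p] tim_ex[of q] obtain p' c t s where
    *: "p' < 2 * L" "c < m" "t < L + 2" "s < 3" "q = tim p' c t s" by auto
  have "\<not> p' < p" using tim_range(2)[OF *(2-4), of p'] start_mono[of "Suc p'" p] q(1) *(5) start_Suc[of p'] by auto
  moreover have "\<not> p < p'" using tim_range(1)[OF *(2-4), of p'] start_mono[of "Suc p" p'] q(2) *(5) start_Suc[of p] by auto
  ultimately have "p' = p" by simp
  with * show ?thesis by blast
qed

definition xpos :: "nat \<Rightarrow> nat \<times> nat \<times> nat \<times> nat \<Rightarrow> place" where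
  "xpos a d = (case d of (p, c, t, s) \<Rightarrow>
     if c < a then (if s = 1 \<and> 1 \<le> t \<and> t \<le> L then gate0 else low)
     else if a < c then (if s = 2 \<and> 1 \<le> t \<and> t \<le> L then gate1 else high)
     else if t = 0 \<and> s = 0 then low
     else if t = L + 1 \<and> 0 < s then high else free)"

lemma xpos_move:
  assumes "ok (part p) a" "c < m" "t < L + 2" "s < 3" "c' < m" "t' < L + 2" "s' < 3"
    "tim p c' t' s' = Suc (tim p c t s)" "p < 2 * L"
  shows "gmove L m ok rel (p, c, t, s) (xpos a (p, c, t, s)) (xpos a (p, c', t', s'))"
proof -
  have "\<not> (c = m - 1 \<and> t = L + 1 \<and> s = 2)"
    using tim_range(2)[OF assms(5-7), of p] assms(8) by (auto simp: finish_def)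
  from ex_nxt[OF assms(2-4) this] obtain d u r where n: "nxt c t s d u r" by blast
  from nxt_bounds[OF n assms(2-4)] have "tim p d u r = tim p c' t' s'" "d < m" "u < L + 2" "r < 3"
    using assms(8) by simp_all
  then have "c' = d" "t' = u" "s' = r" using tim_inj[of d u r c' t' s' p p] assms by auto
  with n have n: "nxt c t s c' t' s'" by simp
  show ?thesis
  proof -
    from n consider "s = 0" "c' = c" "t' = t" "s' = 1" | "s = 1" "c' = c" "t' = t" "s' = 2"
      | "s = 2" "t < L + 1" "c' = c" "t' = Suc t" "s' = 0"
      | "s = 2" "t = L + 1" "Suc c < m" "c' = Suc c" "t' = 0" "s' = 0" unfolding nxt_def by blast
    then show ?thesis
    proof cases
      case 1 then show ?thesis using assms(1-3)
        by (cases c a rule: linorder_cases; cases "t = 0"; cases "t \<le> L"; simp add: xpos_def gmove_def split: if_split_asm)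
    next
      case 2 then show ?thesis using assms(1-3)
        by (cases c a rule: linorder_cases; cases "t = 0"; cases "t \<le> L"; simp add: xpos_def gmove_def split: if_split_asm)
    next
      case 3 then show ?thesis using assms(1-3) L
        by (cases c a rule: linorder_cases; cases "t = 0"; cases "t < L"; simp add: xpos_def gmove_def split: if_split_asm)
    next
      case 4 then show ?thesis using assms(1-3)
        by (cases c a rule: linorder_cases; cases "Suc c = a"; simp add: xpos_def gmove_def split: if_split_asm)
    qed
  qed
qed

text \<open>The bounds on the places are included because the graph will contain only places with
  bounded indices.\<close>

lemma complete:
  assumes v: "\<And>i. i < L \<Longrightarrow> v i < m \<and> ok i (v i) \<and> v' i < m \<and> ok i (v' i)"
    and r: "\<And>i j. i < L \<Longrightarrow> j < L \<Longrightarrow> rel (v i) (v' j)"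
  shows "\<exists>X V. groute X V \<and> (\<forall>q t. fst (X q t) < 8 \<and> snd (X q t) = (0, 0, 0)) \<and>
    (\<forall>i<L. \<forall>j<L. \<forall>t. fst (V i j t) < 8 \<and> fst (snd (V i j t)) < L \<and> fst (snd (snd (V i j t))) < L \<and>
      snd (snd (snd (V i j t))) < m)"
proof -
  define a where "a p = (if p < L then v p else v' (p - L))" for p
  have a: "a p < m" "ok (part p) (a p)" if "p < 2 * L" for p
    using v[of p] v[of "p - L"] that by (auto simp: a_def)
  \<comment> \<open>\<open>al i j\<close> and \<open>be i j\<close> are the times at which the
    verifier \<open>(i, j)\<close> starts its two crossings.\<close>
  define al where "al i j = tim i (v i) (Suc j) 0" for i j
  define be where "be i j = tim (L + j) (v' j) (Suc i) 0" for i j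
  define X where "X p t = (if t < M then xpos (a p) (times L m ! t) else high)" for p t
  define V where "V i j t = (if t \<le> al i j then pre i j else if t = al i j + 1 then gate0
    else if t = al i j + 2 then gate1 else if t \<le> be i j then mid i j (v i)
    else if t = be i j + 1 then gate0 else if t = be i j + 2 then gate1 else done i j)" for i j t
  have Xt: "X q (tim p c t s) = xpos (a q) (p, c, t, s)" if "p < 2 * L" "c < m" "t < L + 2" "s < 3" for q p c t s
    using nth_times[OF that] by (simp add: X_def)
  have albe: "al i j + 2 < be i j" if "i < L" "j < L" for i j
  proof -
    have "al i j + 2 = tim i (v i) (Suc j) 2" by (simp add: al_def tm_def)
    also have "\<dots> \<le> finish i" by (rule tim_range) (use v[OF that(1)] that in auto)
    also have "\<dots> < start (Suc i)" by (simp add: start_Suc)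
    also have "\<dots> \<le> start (L + j)" using that by (intro start_mono) simp
    also have "\<dots> \<le> be i j" unfolding be_def by (rule tim_range) (use v[OF that(2)] that in auto)
    finally show ?thesis .
  qed
  have beM: "be i j + 2 < M" if "i < L" "j < L" for i j
  proof -
    have "be i j + 2 = tim (L + j) (v' j) (Suc i) 2" by (simp add: be_def tm_def)
    also have "\<dots> < M" by (rule nth_times) (use v[OF that(2)] that in auto)
    finally show ?thesis .
  qed
  have gate_times: "V i j t = gate0 \<Longrightarrow> t = al i j + 1 \<or> t = be i j + 1"
    "V i j t = gate1 \<Longrightarrow> t = al i j + 2 \<or> t = be i j + 2" for i j t
    by (auto simp: V_def split: if_splits)
  have V_other: "V i j t = gate0 \<or> V i j t = gate1 \<or> V i j t = pre i j \<or> V i j t = mid i j (v i) \<or> V i j t = done i j" for i j t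
    by (auto simp: V_def)
  have al_inj: "i = i' \<and> j = j'" if "i < L" "j < L" "i' < L" "j' < L" "al i j = al i' j'" for i j i' j'
    using tim_inj[of "v i" "Suc j" 0 "v i'" "Suc j'" 0 i i'] v[OF that(1)] v[OF that(3)] that unfolding al_def by auto
  have be_inj: "i = i' \<and> j = j'" if "i < L" "j < L" "i' < L" "j' < L" "be i j = be i' j'" for i j i' j'
    using tim_inj[of "v' j" "Suc i" 0 "v' j'" "Suc i'" 0 "L + j" "L + j'"] v[OF that(2)] v[OF that(4)] that unfolding be_def by auto
  have al_be: "al i j \<noteq> be i' j'" if "i < L" "j < L" "i' < L" "j' < L" for i j i' j'
    using tim_inj[of "v i" "Suc j" 0 "v' j'" "Suc i'" 0 i "L + j'"] v[OF that(1)] v[OF that(4)] that unfolding al_def be_def by auto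
  have V_move: "move t (V i j t) (V i j (Suc t))" if ij: "i < L" "j < L" and t: "t < M" for i j t
  proof -
    have stay: "V i j (Suc t) = V i j t" "5 \<le> fst (V i j t)"
      if "t \<noteq> al i j" "t \<noteq> al i j + 1" "t \<noteq> al i j + 2" "t \<noteq> be i j" "t \<noteq> be i j + 1" "t \<noteq> be i j + 2"
      using that albe[OF ij] by (auto simp: V_def)
    have D: "times L m ! (tim i (v i) (Suc j) s) = (i, v i, Suc j, s)"
      "times L m ! (tim (L + j) (v' j) (Suc i) s) = (L + j, v' j, Suc i, s)" if "s < 3" for s
      using nth_times(1)[of i L "v i" m "Suc j" s] nth_times(1)[of "L + j" L "v' j" m "Suc i" s] ij v that by auto
    have alD: "times L m ! al i j = (i, v i, Suc j, 0)" "times L m ! (al i j + 1) = (i, v i, Suc j, 1)"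
      "times L m ! (al i j + 2) = (i, v i, Suc j, 2)"
      using D(1)[of 0] D(1)[of 1] D(1)[of 2] by (simp_all add: al_def tm_def)
    have beD: "times L m ! be i j = (L + j, v' j, Suc i, 0)" "times L m ! (be i j + 1) = (L + j, v' j, Suc i, 1)"
      "times L m ! (be i j + 2) = (L + j, v' j, Suc i, 2)"
      using D(2)[of 0] D(2)[of 1] D(2)[of 2] by (simp_all add: be_def tm_def)
    consider "t = al i j" | "t = al i j + 1" | "t = al i j + 2" | "t = be i j" | "t = be i j + 1" | "t = be i j + 2"
      | "V i j (Suc t) = V i j t" "5 \<le> fst (V i j t)" using stay by blast
    then show ?thesis
    proof cases
      case 1 then show ?thesis using alD ij by (simp add: move_def V_def gmove_def entry_def)
    next
      case 2 then show ?thesis using alD ij albe[OF ij] by (simp add: move_def V_def gmove_def)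
    next
      case 3 then show ?thesis using alD ij albe[OF ij] by (simp add: move_def V_def gmove_def exit_place_def)
    next
      case 4 then show ?thesis using beD ij albe[OF ij] r by (simp add: move_def V_def gmove_def entry_def)
    next
      case 5 then show ?thesis using beD ij albe[OF ij] by (simp add: move_def V_def gmove_def)
    next
      case 6 then show ?thesis using beD ij albe[OF ij] by (simp add: move_def V_def gmove_def exit_place_def)
    next
      case 7 then show ?thesis by (simp add: move_def gmove_def)
    qed
  qed
  have "groute X V"
    unfolding groute_def
  proof (intro conjI allI impI)
    fix p assume p: "p < 2 * L"
    show "X p (start p) = low" unfolding start_def using Xt[OF p m] a[OF p] by (simp add: xpos_def)
    show "X p (finish p) = high"
      unfolding finish_def using Xt[OF p, of "m - 1" "L + 1" 2] m a(1)[OF p] by (auto simp: xpos_def)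
    fix q assume q: "start p \<le> q" "q < finish p"
    from phase_times[OF p, of q] q obtain c t s where 1: "c < m" "t < L + 2" "s < 3" "q = tim p c t s" by auto
    from phase_times[OF p, of "Suc q"] q obtain c' t' s' where 2: "c' < m" "t' < L + 2" "s' < 3" "Suc q = tim p c' t' s'" by auto
    show "move q (X p q) (X p (Suc q))"
      using xpos_move[OF a(2)[OF p] 1(1-3) 2(1-3) _ p] 1(4) 2(4) Xt[OF p 1(1-3)] Xt[OF p 2(1-3)] move_tim[OF p 1(1-3)]
      by simp
  next
    fix i j assume ij: "i < L" "j < L"
    show "V i j 0 = pre i j" by (simp add: V_def)
    show "V i j M = done i j" using beM[OF ij] albe[OF ij] by (simp add: V_def)
    show "move t (V i j t) (V i j (Suc t))" if "t < M" for t by (rule V_move[OF ij that])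
  next
    fix p i j q assume *: "p < 2 * L" "i < L" "j < L" "start p \<le> q" "q \<le> finish p"
    show "X p q \<noteq> V i j q"
    proof
      assume eq: "X p q = V i j q"
      obtain c t s where t: "c < m" "t < L + 2" "s < 3" "q = tim p c t s"
        using phase_times[OF *(1,4,5)] by blast
      have xq: "X p q = xpos (a p) (p, c, t, s)" using Xt[OF *(1) t(1-3), of p] t(4) by simp
      \<comment> \<open>Only gates are common to both kinds of tokens. The value token uses them at
        values other than \<open>a p\<close>, the verifiers exactly at \<open>a p\<close>.\<close>
      have "V i j q = gate0 \<or> V i j q = gate1"
        using V_other[of i j q] eq xq by (auto simp: xpos_def split: if_splits)
      then show False
      proof
        assume g: "V i j q = gate0"
        then have s: "s = 1" "c < a p" using eq xq by (auto simp: xpos_def split: if_splits)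
        from gate_times(1)[OF g] have "tim p c t 1 = tim i (v i) (Suc j) 1 \<or> tim p c t 1 = tim (L + j) (v' j) (Suc i) 1"
          using t(4) s(1) by (simp add: al_def be_def tm_def)
        then have "p = i \<and> c = v i \<or> p = L + j \<and> c = v' j"
          using tim_inj[of c t 1 "v i" "Suc j" 1 p i] tim_inj[of c t 1 "v' j" "Suc i" 1 p "L + j"] t * v by auto
        then show False using s(2) * by (auto simp: a_def)
      next
        assume g: "V i j q = gate1"
        then have s: "s = 2" "a p < c" using eq xq by (auto simp: xpos_def split: if_splits)
        from gate_times(2)[OF g] have "tim p c t 2 = tim i (v i) (Suc j) 2 \<or> tim p c t 2 = tim (L + j) (v' j) (Suc i) 2"
          using t(4) s(1) by (simp add: al_def be_def tm_def)
        then have "p = i \<and> c = v i \<or> p = L + j \<and> c = v' j"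
          using tim_inj[of c t 2 "v i" "Suc j" 2 p i] tim_inj[of c t 2 "v' j" "Suc i" 2 p "L + j"] t * v by auto
        then show False using s(2) * by (auto simp: a_def)
      qed
    qed
  next
    fix i j i' j' t assume *: "i < L" "j < L" "i' < L" "j' < L" "(i, j) \<noteq> (i', j')"
    show "V i j t \<noteq> V i' j' t"
    proof
      assume eq: "V i j t = V i' j' t"
      \<comment> \<open>Verifiers share only the gates, and every crossing has a phase, value and
        slot of its own.\<close>
      then consider "V i j t = gate0" "V i' j' t = gate0" | "V i j t = gate1" "V i' j' t = gate1"
        using V_other[of i j t] V_other[of i' j' t] *(5) by auto
      then show False
      proof cases
        case 1
        from gate_times(1)[OF 1(1)] gate_times(1)[OF 1(2)]
        have "al i j = al i' j' \<or> be i j = be i' j' \<or> al i j = be i' j' \<or> al i' j' = be i j" by auto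
        then show False
          using al_inj[OF *(1-4)] be_inj[OF *(1-4)] al_be[OF *(1-4)] al_be[OF *(3,4,1,2)] *(5) by auto
      next
        case 2
        from gate_times(2)[OF 2(1)] gate_times(2)[OF 2(2)]
        have "al i j = al i' j' \<or> be i j = be i' j' \<or> al i j = be i' j' \<or> al i' j' = be i j" by auto
        then show False
          using al_inj[OF *(1-4)] be_inj[OF *(1-4)] al_be[OF *(1-4)] al_be[OF *(3,4,1,2)] *(5) by auto
      qed
    qed
  qed
  moreover have "fst (X q t) < 8 \<and> snd (X q t) = (0, 0, 0)" for q t
    by (simp add: X_def xpos_def split: prod.split)
  moreover have "fst (V i j t) < 8 \<and> fst (snd (V i j t)) < L \<and> fst (snd (snd (V i j t))) < L \<and> snd (snd (snd (V i j t))) < m"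
    if "i < L" "j < L" for i j t
    using that v[of i] L m by (simp add: V_def)
  ultimately show ?thesis by blast
qed

lemma solvable_iff:
  "(\<exists>X V. groute X V) \<longleftrightarrow> (\<exists>v v'. (\<forall>i<L. v i < m \<and> ok i (v i) \<and> v' i < m \<and> ok i (v' i)) \<and>
    (\<forall>i<L. \<forall>j<L. rel (v i) (v' j)))" (is "?A \<longleftrightarrow> ?B")
proof
  assume ?A
  then obtain X V where XV: "groute X V" by blast
  interpret gadget_routing L m ok rel X V by unfold_locales (rule XV)
  show ?B by (rule sound)
next
  assume ?B
  then obtain v v' where *: "\<forall>i<L. v i < m \<and> ok i (v i) \<and> v' i < m \<and> ok i (v' i)"
    "\<forall>i<L. \<forall>j<L. rel (v i) (v' j)" by blast
  from complete[of v v'] * show ?A by auto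
qed

end

section \<open>The gadget as an instance with numbered vertices\<close>

definition places :: "nat \<Rightarrow> nat \<Rightarrow> place list" where
  "places L m = List.product [0..<8] (List.product [0..<L] (List.product [0..<L] [0..<m]))"

definition pidx :: "nat \<Rightarrow> nat \<Rightarrow> place \<Rightarrow> nat" where
  "pidx L m x = ((fst x * L + fst (snd x)) * L + fst (snd (snd x))) * m + snd (snd (snd x))"

definition psize :: "nat \<Rightarrow> nat \<Rightarrow> nat" where "psize L m = 8 * L * L * m"

definition place_ok :: "nat \<Rightarrow> nat \<Rightarrow> place \<Rightarrow> bool" where
  "place_ok L m x \<longleftrightarrow> fst x < 8 \<and> fst (snd x) < L \<and> fst (snd (snd x)) < L \<and> snd (snd (snd x)) < m"

lemma length_places: "length (places L m) = psize L m"
  by (simp add: places_def psize_def)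

lemma distinct_places: "distinct (places L m)"
  unfolding places_def by (intro distinct_product distinct_upt)

lemma nth_places:
  assumes "place_ok L m x" shows "places L m ! pidx L m x = x" "pidx L m x < psize L m"
proof -
  obtain a i j c where x: "x = (a, i, j, c)" by (cases x)
  with assms have b: "a < 8" "i < L" "j < L" "c < m" by (simp_all add: place_ok_def)
  have eq: "pidx L m (a, i, j, c) = a * (L * (L * m)) + (i * (L * m) + (j * m + c))"
    by (simp add: pidx_def algebra_simps)
  have 1: "j * m + c < L * m" by (rule vertex_less) (use b in auto)
  have 2: "i * (L * m) + (j * m + c) < L * (L * m)" by (rule vertex_less) (use b 1 in auto)
  have 3: "List.product [0..<L] [0..<m] ! (j * m + c) = (j, c)"
    using nth_product[of j "[0..<L]" c "[0..<m]"] b by simp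
  have 4: "List.product [0..<L] (List.product [0..<L] [0..<m]) ! (i * (L * m) + (j * m + c)) = (i, j, c)"
    using nth_product[of i "[0..<L]" "j * m + c" "List.product [0..<L] [0..<m]"] b 1 3 by simp
  show "places L m ! pidx L m x = x"
    using nth_product[of a "[0..<8]" "i * (L * m) + (j * m + c)"
        "List.product [0..<L] (List.product [0..<L] [0..<m])"] b 2 4
    unfolding x eq places_def by simp
  have "psize L m = 8 * (L * (L * m))" by (simp add: psize_def)
  then show "pidx L m x < psize L m"
    unfolding x eq by (simp only:) (rule vertex_less, use b 2 in auto)
qed

definition tstart :: "nat \<Rightarrow> nat \<Rightarrow> nat \<Rightarrow> nat" where "tstart L m p = tm L m p 0 0 0"
definition tfinish :: "nat \<Rightarrow> nat \<Rightarrow> nat \<Rightarrow> nat" where "tfinish L m p = tm L m p (m - 1) (L + 1) 2"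

definition dsp_n :: "nat \<Rightarrow> nat \<Rightarrow> nat" where
  "dsp_n L m = Suc (length (times L m)) * psize L m"

definition dsp_vss :: "nat \<Rightarrow> nat \<Rightarrow> nat list list" where
  "dsp_vss L m = map (\<lambda>t. map (\<lambda>a. t * psize L m + a) [0..<psize L m]) [0..<Suc (length (times L m))]"

definition dsp_es :: "nat \<Rightarrow> nat \<Rightarrow> (nat \<Rightarrow> nat \<Rightarrow> bool) \<Rightarrow> (nat \<Rightarrow> nat \<Rightarrow> bool) \<Rightarrow> (nat \<times> nat) list" where
  "dsp_es L m ok rel = map (\<lambda>z. (fst z * psize L m + fst (snd z), Suc (fst z) * psize L m + snd (snd z)))
     (filter (\<lambda>z. gmove L m ok rel (nthd (0, 0, 0, 0) (times L m) (fst z))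
        (nthd (0, 0, 0, 0) (places L m) (fst (snd z))) (nthd (0, 0, 0, 0) (places L m) (snd (snd z))))
     (List.product [0..<length (times L m)] (List.product [0..<psize L m] [0..<psize L m])))"

definition dsp_rs :: "nat \<Rightarrow> nat \<Rightarrow> (nat \<times> nat) list" where
  "dsp_rs L m = map (\<lambda>p. (tstart L m p * psize L m + pidx L m (0, 0, 0, 0), tfinish L m p * psize L m + pidx L m (2, 0, 0, 0))) [0..<2 * L] @
     map (\<lambda>z. (pidx L m (5, fst z, snd z, 0), length (times L m) * psize L m + pidx L m (7, fst z, snd z, 0)))
       (List.product [0..<L] [0..<L])"

context gadget
begin

abbreviation "P \<equiv> psize L m"
definition "mvi t a b \<longleftrightarrow> gmove L m ok rel (times L m ! t) (places L m ! a) (places L m ! b)"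
text \<open>Request \<open>r < 2 * L\<close> is the value token of phase \<open>r\<close>; request
  \<open>2 * L + (i * L + j)\<close> is the verifier \<open>(i, j)\<close>.\<close>

definition "rt1 r = (if r < 2 * L then start r else 0)"
definition "rt2 r = (if r < 2 * L then finish r else M)"
definition "ra1 r = pidx L m (if r < 2 * L then low else pre ((r - 2 * L) div L) ((r - 2 * L) mod L))"
definition "ra2 r = pidx L m (if r < 2 * L then high else done ((r - 2 * L) div L) ((r - 2 * L) mod L))"
abbreviation "R \<equiv> 2 * L + L * L"

lemma pidx_inj: "place_ok L m x \<Longrightarrow> place_ok L m y \<Longrightarrow> pidx L m x = pidx L m y \<longleftrightarrow> x = y"
  using nth_places by metis

lemma place_ok_consts: "place_ok L m low" "place_ok L m high"
  "i < L \<Longrightarrow> j < L \<Longrightarrow> place_ok L m (pre i j)" "i < L \<Longrightarrow> j < L \<Longrightarrow> place_ok L m (done i j)"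
  using L m by (simp_all add: place_ok_def)

lemma ridx: "r < R \<Longrightarrow> \<not> r < 2 * L \<Longrightarrow> (r - 2 * L) div L < L" "(r - 2 * L) mod L < L"
  using L by (simp_all add: div_less_iff_less_mult)

lemma start_finish: "start p < finish p"
  unfolding start_def finish_def using tim_range(3)[of 0 0 0 p] m by (simp add: finish_def start_def)

lemma phases_disjoint:
  assumes "p \<noteq> q" "start p \<le> t" "t \<le> finish p" "start q \<le> t" "t \<le> finish q" shows False
  using assms start_mono[of "Suc p" q] start_mono[of "Suc q" p] start_Suc[of p] start_Suc[of q]
  by (cases p q rule: linorder_cases) auto

sublocale te: time_expanded "Suc M" P mvi R rt1 ra1 rt2 ra2
proof
  show "P > 0" using L m by (simp add: psize_def)
  have M: "M > 0" using L m by (simp add: length_times)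
  show "rt1 r < rt2 r" "rt2 r < Suc M" if "r < R" for r
    using start_finish[of r] finish_less[of r] M by (auto simp: rt1_def rt2_def)
  show "ra1 r < P" "ra2 r < P" if "r < R" for r
    unfolding ra1_def ra2_def using ridx[of r] that place_ok_consts by (auto intro!: nth_places(2))
  fix r r' assume r: "r < R" "r' < R" "r \<noteq> r'"
  have ok: "place_ok L m (if r < 2 * L then low else pre ((r - 2 * L) div L) ((r - 2 * L) mod L))"
    "place_ok L m (if r < 2 * L then high else done ((r - 2 * L) div L) ((r - 2 * L) mod L))" if "r < R" for r
    using ridx[of r] that place_ok_consts by auto
  show "{(rt1 r, ra1 r), (rt2 r, ra2 r)} \<inter> {(rt1 r', ra1 r'), (rt2 r', ra2 r')} = {}"
  proof (cases "r < 2 * L \<and> r' < 2 * L")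
    case True
    then have "{rt1 r, rt2 r} \<inter> {rt1 r', rt2 r'} = {}"
      using phases_disjoint[OF r(3), of "rt1 r"] phases_disjoint[OF r(3), of "rt2 r"]
        start_finish[of r] start_finish[of r'] by (auto simp: rt1_def rt2_def)
    then show ?thesis by blast
  next
    case False
    have dm: "(r - 2 * L) div L \<noteq> (r' - 2 * L) div L \<or> (r - 2 * L) mod L \<noteq> (r' - 2 * L) mod L"
      if "\<not> r < 2 * L" "\<not> r' < 2 * L"
    proof (rule ccontr)
      assume "\<not> ?thesis"
      then have "r - 2 * L = r' - 2 * L" by (metis div_mult_mod_eq)
      with that r(3) show False by simp
    qed
    show ?thesis
      unfolding ra1_def ra2_def using False pidx_inj[OF ok(1)[OF r(1)] ok(1)[OF r(2)]] pidx_inj[OF ok(1)[OF r(1)] ok(2)[OF r(2)]]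
        pidx_inj[OF ok(2)[OF r(1)] ok(1)[OF r(2)]] pidx_inj[OF ok(2)[OF r(1)] ok(2)[OF r(2)]] dm
      by (cases "r < 2 * L"; cases "r' < 2 * L") auto
  qed
qed

lemma V_index: assumes "i < L" "j < L"
  shows "2 * L + (i * L + j) < R" "\<not> 2 * L + (i * L + j) < 2 * L"
    "(2 * L + (i * L + j) - 2 * L) div L = i" "(2 * L + (i * L + j) - 2 * L) mod L = j"
  using vertex_less[OF assms(2,1)] assms by simp_all

lemma groute_of_routing:
  assumes "te.routing pos"
  shows "groute (\<lambda>p t. places L m ! pos p t) (\<lambda>i j t. places L m ! pos (2 * L + (i * L + j)) t)"
proof -
  note rt = assms[unfolded te.routing_def]
  have 1: "pos r (rt1 r) = ra1 r" "pos r (rt2 r) = ra2 r" "\<And>t. rt1 r \<le> t \<Longrightarrow> t \<le> rt2 r \<Longrightarrow> pos r t < P"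
    "\<And>t. rt1 r \<le> t \<Longrightarrow> t < rt2 r \<Longrightarrow> mvi t (pos r t) (pos r (Suc t))" if "r < R" for r
    using rt[THEN conjunct1, rule_format, OF that] by auto
  have 2: "places L m ! pos r t \<noteq> places L m ! pos r' t"
    if "r < R" "r' < R" "r \<noteq> r'" "rt1 r \<le> t" "t \<le> rt2 r" "rt1 r' \<le> t" "t \<le> rt2 r'" for r r' t
    using rt[THEN conjunct2, rule_format, OF that] 1(3)[OF that(1,4,5)] 1(3)[OF that(2,6,7)] distinct_places[of L m]
    by (simp add: nth_eq_iff_index_eq length_places)
  have X: "p < R" "rt1 p = start p" "rt2 p = finish p" "places L m ! ra1 p = low" "places L m ! ra2 p = high" if "p < 2 * L" for p
    using that nth_places(1)[OF place_ok_consts(1)] nth_places(1)[OF place_ok_consts(2)]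
    by (simp_all add: rt1_def rt2_def ra1_def ra2_def)
  have V: "rt1 (2 * L + (i * L + j)) = 0" "rt2 (2 * L + (i * L + j)) = M" "places L m ! ra1 (2 * L + (i * L + j)) = pre i j"
    "places L m ! ra2 (2 * L + (i * L + j)) = done i j" if "i < L" "j < L" for i j
    using that V_index[OF that] nth_places(1)[OF place_ok_consts(3)[OF that]] nth_places(1)[OF place_ok_consts(4)[OF that]]
    by (simp_all add: rt1_def rt2_def ra1_def ra2_def)
  show ?thesis
    unfolding groute_def
  proof (intro conjI allI impI)
    fix p assume p: "p < 2 * L"
    show "places L m ! pos p (start p) = low" "places L m ! pos p (finish p) = high"
      using 1(1,2)[OF X(1)[OF p]] X[OF p] by simp_all
    show "move t (places L m ! pos p t) (places L m ! pos p (Suc t))" if "start p \<le> t" "t < finish p" for t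
      using 1(4)[OF X(1)[OF p]] X[OF p] that by (simp add: mvi_def move_def)
  next
    fix i j assume ij: "i < L" "j < L"
    show "places L m ! pos (2 * L + (i * L + j)) 0 = pre i j" "places L m ! pos (2 * L + (i * L + j)) M = done i j"
      using 1(1,2)[OF V_index(1)[OF ij]] V[OF ij] by simp_all
    show "move t (places L m ! pos (2 * L + (i * L + j)) t) (places L m ! pos (2 * L + (i * L + j)) (Suc t))" if "t < M" for t
      using 1(4)[OF V_index(1)[OF ij]] V[OF ij] that by (simp add: mvi_def move_def)
  next
    fix p i j t assume *: "p < 2 * L" "i < L" "j < L" "start p \<le> t" "t \<le> finish p"
    show "places L m ! pos p t \<noteq> places L m ! pos (2 * L + (i * L + j)) t"
      by (rule 2) (use * X[OF *(1)] V[OF *(2,3)] V_index[OF *(2,3)] finish_less[OF *(1)] in auto)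
  next
    fix i j i' j' t assume *: "i < L" "j < L" "i' < L" "j' < L" "t \<le> M" "(i, j) \<noteq> (i', j')"
    have "i * L + j \<noteq> i' * L + j'" using * by (metis div_mult_add)
    then show "places L m ! pos (2 * L + (i * L + j)) t \<noteq> places L m ! pos (2 * L + (i' * L + j')) t"
      by (intro 2) (use * V[OF *(1,2)] V[OF *(3,4)] V_index[OF *(1,2)] V_index[OF *(3,4)] in auto)
  qed
qed

lemma routing_of_groute:
  assumes g: "groute X V" and X: "\<And>q t. place_ok L m (X q t)" and V: "\<And>i j t. i < L \<Longrightarrow> j < L \<Longrightarrow> place_ok L m (V i j t)"
  shows "te.routing (\<lambda>r t. pidx L m (if r < 2 * L then X r t else V ((r - 2 * L) div L) ((r - 2 * L) mod L) t))"
proof -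
  interpret gadget_routing L m ok rel X V by unfold_locales (rule g)
  let ?i = "\<lambda>r. (r - 2 * L) div L" let ?j = "\<lambda>r. (r - 2 * L) mod L"
  let ?q = "\<lambda>r t. if r < 2 * L then X r t else V (?i r) (?j r) t"
  have ok: "place_ok L m (?q r t)" if "r < R" for r t using X V ridx[of r] that by auto
  have mv: "mvi t (pidx L m x) (pidx L m y) \<longleftrightarrow> move t x y" if "place_ok L m x" "place_ok L m y" for t x y
    using nth_places(1) that by (simp add: mvi_def move_def)
  show ?thesis
    unfolding te.routing_def
  proof (intro conjI allI impI)
    fix r assume r: "r < R"
    show "pidx L m (?q r (rt1 r)) = ra1 r" "pidx L m (?q r (rt2 r)) = ra2 r"
      using X_ends[of r] V_ends[of "?i r" "?j r"] ridx[of r] r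
      by (auto simp: rt1_def rt2_def ra1_def ra2_def)
    show "pidx L m (?q r t) < P" for t by (rule nth_places(2)[OF ok[OF r]])
    fix t assume t: "rt1 r \<le> t \<and> t < rt2 r"
    have "move t (?q r t) (?q r (Suc t))"
      using routeX[of r] routeV[of "?i r" "?j r"] ridx[of r] r t by (auto simp: rt1_def rt2_def)
    then show "mvi t (pidx L m (?q r t)) (pidx L m (?q r (Suc t)))"
      using mv[OF ok[OF r] ok[OF r]] by blast
  next
    fix r r' t assume *: "r < R" "r' < R" "r \<noteq> r'" "rt1 r \<le> t" "t \<le> rt2 r" "rt1 r' \<le> t" "t \<le> rt2 r'"
    have "?q r t \<noteq> ?q r' t"
    proof (cases "r < 2 * L"; cases "r' < 2 * L")
      assume "r < 2 * L" "r' < 2 * L"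
      then show ?thesis using phases_disjoint[OF *(3), of t] * by (auto simp: rt1_def rt2_def)
    next
      assume "r < 2 * L" "\<not> r' < 2 * L"
      then show ?thesis using routeXV[of r "?i r'" "?j r'" t] ridx[of r'] * by (auto simp: rt1_def rt2_def)
    next
      assume "\<not> r < 2 * L" "r' < 2 * L"
      then show ?thesis using routeXV[of r' "?i r" "?j r" t] ridx[of r] * by (auto simp: rt1_def rt2_def)
    next
      assume n: "\<not> r < 2 * L" "\<not> r' < 2 * L"
      have "(?i r, ?j r) \<noteq> (?i r', ?j r')"
      proof
        assume "(?i r, ?j r) = (?i r', ?j r')"
        then have "r - 2 * L = r' - 2 * L" by (metis div_mult_mod_eq prod.inject)
        with n *(3) show False by simp
      qed
      then show ?thesis using routeVV[of "?i r" "?j r" "?i r'" "?j r'" t] ridx[of r] ridx[of r'] n * by (auto simp: rt2_def)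
    qed
    then show "pidx L m (?q r t) \<noteq> pidx L m (?q r' t)" using pidx_inj[OF ok[OF *(1)] ok[OF *(2)]] by blast
  qed
qed

lemma ex_routing_iff: "(\<exists>pos. te.routing pos) \<longleftrightarrow> (\<exists>X V. groute X V)"
proof
  assume "\<exists>pos. te.routing pos"
  then show "\<exists>X V. groute X V" using groute_of_routing by blast
next
  assume "\<exists>X V. groute X V"
  \<comment> \<open>An arbitrary \<open>groute\<close> says nothing about places outside the
    relevant times, so its places need not be numbered. It is replaced by the routing from
    \<open>complete\<close>, which stays within bounds.\<close>
  then obtain v v' where v: "\<forall>i<L. v i < m \<and> ok i (v i) \<and> v' i < m \<and> ok i (v' i)" "\<forall>i<L. \<forall>j<L. rel (v i) (v' j)"
    unfolding solvable_iff by blast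
  from complete[of v v'] v obtain X V where g: "groute X V" and X: "\<And>q t. fst (X q t) < 8 \<and> snd (X q t) = (0, 0, 0)"
    and V: "\<And>i j t. i < L \<Longrightarrow> j < L \<Longrightarrow> fst (V i j t) < 8 \<and> fst (snd (V i j t)) < L \<and>
      fst (snd (snd (V i j t))) < L \<and> snd (snd (snd (V i j t))) < m" by blast
  have "te.routing (\<lambda>r t. pidx L m (if r < 2 * L then X r t else V ((r - 2 * L) div L) ((r - 2 * L) mod L) t))"
    by (rule routing_of_groute[OF g]) (use X V L m in \<open>auto simp: place_ok_def\<close>)
  then show "\<exists>pos. te.routing pos" by blast
qed

lemma dsp_Vs: "map set (dsp_vss L m) = te.Vs"
  by (simp add: dsp_vss_def te.Vs_def image_add_atLeastLessThan add.commute comp_def del: upt_Suc)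

lemma dsp_E: "(\<lambda>(u, v). {u, v}) ` set (dsp_es L m ok rel) = te.E"
proof (intro equalityI subsetI)
  fix e assume "e \<in> (\<lambda>(u, v). {u, v}) ` set (dsp_es L m ok rel)"
  then obtain t a b where "t < M" "a < P" "b < P" "mvi t a b" "e = {t * P + a, Suc t * P + b}"
    by (auto simp: dsp_es_def mvi_def nthd_def length_places)
  then show "e \<in> te.E" unfolding te.E_def by blast
next
  fix e assume "e \<in> te.E"
  then obtain t a b where t: "t < M" "a < P" "b < P" "mvi t a b" and e: "e = {t * P + a, Suc t * P + b}"
    unfolding te.E_def by auto
  have "(t * P + a, Suc t * P + b) \<in> set (dsp_es L m ok rel)"
    unfolding dsp_es_def set_map
    by (rule image_eqI[of _ _ "(t, a, b)"]) (use t in \<open>auto simp: mvi_def nthd_def length_places\<close>)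
  then show "e \<in> (\<lambda>(u, v). {u, v}) ` set (dsp_es L m ok rel)"
    unfolding e by (rule rev_image_eqI) simp
qed

lemma dsp_rs: "dsp_rs L m = te.rs"
proof -
  have 1: "[0..<R] = [0..<2 * L] @ map (\<lambda>k. 2 * L + k) [0..<L * L]"
    using upt_add_eq_append[of 0 "2 * L" "L * L"] by (simp add: map_add_upt add.commute)
  have 2: "List.product [0..<L] [0..<L] = map (\<lambda>k. (k div L, k mod L)) [0..<L * L]"
    by (rule nth_equalityI) (use L in \<open>auto simp: product_nth div_less_iff_less_mult\<close>)
  show ?thesis
    unfolding dsp_rs_def te.rs_def 1 2
    by (auto simp: rt1_def rt2_def ra1_def ra2_def tstart_def tfinish_def start_def finish_def)
qed

end

theorem gadget_dsp:
  assumes "L > 0" "m > 0"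
  shows "(let V = {..<dsp_n L m}; E = (\<lambda>(u, v). {u, v}) ` set (dsp_es L m ok rel); Vs = map set (dsp_vss L m) in
       one_shortest_graph V E Vs \<and> set (dsp_rs L m) \<subseteq> V \<times> V \<and> DSP_solvable V E Vs (dsp_rs L m)) \<longleftrightarrow>
    (\<exists>v v'. (\<forall>i<L. v i < m \<and> ok i (v i) \<and> v' i < m \<and> ok i (v' i)) \<and> (\<forall>i<L. \<forall>j<L. rel (v i) (v' j)))"
proof -
  interpret gadget L m ok rel by unfold_locales (use assms in auto)
  have V: "{..<dsp_n L m} = te.V" by (simp add: dsp_n_def te.V_def)
  show ?thesis
    unfolding Let_def V dsp_E dsp_Vs dsp_rs
    using te.one_shortest te.rs_subset te.solvable_iff ex_routing_iff solvable_iff by simp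
qed


section \<open>Local certificates for circuits of weft 1\<close>

text \<open>Gate values, certificate bits and path lengths all arise from a single pass along the
  topological order.\<close>

definition run :: "('v list \<Rightarrow> gate \<Rightarrow> 'v) \<Rightarrow> circuit \<Rightarrow> 'v list" where
  "run F C = foldl (\<lambda>vs g. vs @ [F vs g]) [] C"

lemma run_snoc: "run F (C @ [g]) = run F C @ [F (run F C) g]"
  by (simp add: run_def)

lemma length_run [simp]: "length (run F C) = length C"
  by (induction C rule: rev_induct) (simp_all add: run_snoc, simp add: run_def)

lemma nth_run: "i < length C \<Longrightarrow> run F C ! i = F (take i (run F C)) (C ! i)"
proof (induction C rule: rev_induct)
  case (snoc g C)
  then show ?case
    by (cases "i = length C") (simp_all add: run_snoc nth_append)
qed simp

lemma gate_values_run: "gate_values a = run (gate_value a)"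
  by (simp add: fun_eq_iff gate_values_def run_def)

primrec gtag :: "gate \<Rightarrow> nat" where
  "gtag InG = 0"
| "gtag (NotG j) = 1"
| "gtag (AndG js) = 2"
| "gtag (OrG js) = 3"

type_synonym gap = "nat \<times> nat \<times> nat"

text \<open>The boundary \<open>Suc v\<close> denotes the input \<open>v\<close>; the shift keeps 0
  available for the left end.\<close>

definition known_true :: "gap list \<Rightarrow> nat \<Rightarrow> bool" where
  "known_true J v \<longleftrightarrow> (\<exists>t\<in>set J. Suc v = fst (snd t) \<or> Suc v = snd (snd t))"

definition known_false :: "gap list \<Rightarrow> nat \<Rightarrow> bool" where
  "known_false J v \<longleftrightarrow> (\<exists>t\<in>set J. fst (snd t) < Suc v \<and> Suc v < snd (snd t))"

type_synonym bits = "bool \<times> bool \<times> bool \<times> bool"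

abbreviation lo :: "bits \<Rightarrow> bool" where "lo z \<equiv> fst z"
abbreviation hi :: "bits \<Rightarrow> bool" where "hi z \<equiv> fst (snd z)"
abbreviation po :: "bits \<Rightarrow> bool" where "po z \<equiv> fst (snd (snd z))"
abbreviation ne :: "bits \<Rightarrow> bool" where "ne z \<equiv> snd (snd (snd z))"

abbreviation bit :: "bits list \<Rightarrow> nat \<Rightarrow> bits" where "bit \<equiv> nthd (False, False, False, False)"

text \<open>\<open>lo\<close> and \<open>hi\<close> are the Kleene bounds for the value of a gate given the information \<open>J\<close>;
  \<open>po\<close> and \<open>ne\<close> bound it for positive and negative occurrences given \<open>I\<close>, except that the witness for
  a large gate that needs one must be certified by \<open>J\<close>.\<close>

definition bits_step :: "gap list \<Rightarrow> gap list \<Rightarrow> bits list \<Rightarrow> gate \<Rightarrow> bits" where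
  "bits_step J I vs g = (if gtag g = 0
     then (known_true J (length vs), \<not> known_false J (length vs), \<not> known_false I (length vs), known_true I (length vs))
     else if gtag g = 1
     then (\<forall>j\<in>set (preds g). \<not> hi (bit vs j),
           \<forall>j\<in>set (preds g). \<not> lo (bit vs j),
           \<forall>j\<in>set (preds g). \<not> ne (bit vs j),
           \<forall>j\<in>set (preds g). \<not> po (bit vs j))
     else if gtag g = 2
     then (\<forall>j\<in>set (preds g). lo (bit vs j),
           \<forall>j\<in>set (preds g). hi (bit vs j),
           \<forall>j\<in>set (preds g). po (bit vs j),
           if 2 < length (preds g) then \<forall>j\<in>set (preds g). hi (bit vs j)
           else \<forall>j\<in>set (preds g). ne (bit vs j))
     else (\<exists>j\<in>set (preds g). lo (bit vs j),
           \<exists>j\<in>set (preds g). hi (bit vs j),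
           if 2 < length (preds g) then \<exists>j\<in>set (preds g). lo (bit vs j)
           else \<exists>j\<in>set (preds g). po (bit vs j),
           \<exists>j\<in>set (preds g). ne (bit vs j)))"

definition out_bit :: "circuit \<Rightarrow> gap list \<Rightarrow> gap list \<Rightarrow> bool" where
  "out_bit C J I = po (bit (run (bits_step J I) C) (length C - 1))"

text \<open>Depth and weft quantify over possibly exponentially many paths. Taking the maximum over
  predecessors computes them in one pass, and the same numbers drive the inductions on
  gates.\<close>

definition path_step :: "(gate \<Rightarrow> nat) \<Rightarrow> nat list \<Rightarrow> gate \<Rightarrow> nat" where
  "path_step f vs g = f g + foldl max 0 (map (nthd 0 vs) (preds g))"

definition path_max :: "(gate \<Rightarrow> nat) \<Rightarrow> circuit \<Rightarrow> nat \<Rightarrow> nat" where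
  "path_max f C i = nthd 0 (run (path_step f) C) i"

lemma foldl_max_ge: "x \<in> set xs \<or> x \<le> b \<Longrightarrow> (x :: nat) \<le> foldl max b xs"
proof (induction xs arbitrary: b)
  case (Cons y xs)
  have "x \<in> set xs \<or> x \<le> max b y" using Cons.prems by auto
  from Cons.IH[OF this] show ?case by simp
qed simp

lemma foldl_max_mem: "foldl max b xs = b \<or> foldl max b xs \<in> set (xs :: nat list)"
proof (induction xs arbitrary: b)
  case (Cons x xs)
  from Cons[of "max b x"] show ?case by (auto simp: max_def)
qed simp

text \<open>Inputs weigh 0, so that a path starting at an input has its number of edges as
  weight.\<close>

definition depth_weight :: "gate \<Rightarrow> nat" where "depth_weight g = (if gtag g = 0 then 0 else 1)"
definition weft_weight :: "gate \<Rightarrow> nat" where "weft_weight g = (if 2 < length (preds g) then 1 else 0)"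

text \<open>Dropping the condition on the last gate allows induction along the path.\<close>

definition ipath :: "circuit \<Rightarrow> nat list \<Rightarrow> bool" where
  "ipath C p \<longleftrightarrow> p \<noteq> [] \<and> set p \<subseteq> {..<length C} \<and> C ! hd p = InG \<and>
     (\<forall>j. Suc j < length p \<longrightarrow> p ! j \<in> set (preds (C ! (p ! Suc j))))"

lemma in_out_path_iff: "in_out_path C p \<longleftrightarrow> ipath C p \<and> last p = length C - 1"
  by (auto simp: in_out_path_def ipath_def)

lemma ipath_snoc: "p \<noteq> [] \<Longrightarrow> ipath C (p @ [i]) \<longleftrightarrow> ipath C p \<and> i < length C \<and> last p \<in> set (preds (C ! i))"
proof -
  assume p: "p \<noteq> []"
  have "(\<forall>j. Suc j < length (p @ [i]) \<longrightarrow> (p @ [i]) ! j \<in> set (preds (C ! ((p @ [i]) ! Suc j)))) \<longleftrightarrow>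
    (\<forall>j. Suc j < length p \<longrightarrow> p ! j \<in> set (preds (C ! (p ! Suc j)))) \<and> last p \<in> set (preds (C ! i))" (is "?A \<longleftrightarrow> ?B \<and> ?D")
  proof (intro iffI conjI)
    assume A: ?A
    show ?B
    proof (intro allI impI)
      fix j assume "Suc j < length p"
      with A[rule_format, of j] show "p ! j \<in> set (preds (C ! (p ! Suc j)))" by (simp add: nth_append)
    qed
    show ?D using A[rule_format, of "length p - 1"] p by (simp add: nth_append last_conv_nth)
  next
    assume BD: "?B \<and> ?D"
    show ?A
    proof (intro allI impI)
      fix j assume j: "Suc j < length (p @ [i])"
      show "(p @ [i]) ! j \<in> set (preds (C ! ((p @ [i]) ! Suc j)))"
      proof (cases "Suc j < length p")
        case True with BD show ?thesis by (simp add: nth_append)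
      next
        case False
        with j have "Suc j = length p" by simp
        then have "(p @ [i]) ! j = last p" "(p @ [i]) ! Suc j = i" using p
          by (auto simp: nth_append last_conv_nth simp flip: \<open>Suc j = length p\<close>)
        with BD show ?thesis by simp
      qed
    qed
  qed
  then show ?thesis using p unfolding ipath_def by auto
qed

section \<open>Depth and weft as maximal path weights\<close>

locale circuit =
  fixes C :: circuit
  assumes wf: "wf_circuit C"
begin

abbreviation "N \<equiv> length C"

lemma N_pos: "N > 0" using wf by (simp add: wf_circuit_def)

lemma wfD: "i < N \<Longrightarrow> arity_ok (C ! i)" "i < N \<Longrightarrow> j \<in> set (preds (C ! i)) \<Longrightarrow> j < i"
  using wf by (auto simp: wf_circuit_def)

abbreviation "mp f i \<equiv> path_max f C i"

lemma mp_rec: "i < N \<Longrightarrow> mp f i = f (C ! i) + foldl max 0 (map (mp f) (preds (C ! i)))"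
proof -
  assume i: "i < N"
  have "map (nthd 0 (take i (run (path_step f) C))) (preds (C ! i)) = map (mp f) (preds (C ! i))"
    using less_trans[OF wfD(2)[OF i] i] wfD(2)[OF i] i by (auto simp: path_max_def nthd_def)
  moreover have "mp f i = path_step f (take i (run (path_step f) C)) (C ! i)"
    using i by (simp add: path_max_def nthd_def nth_run)
  ultimately show ?thesis by (simp only: path_step_def)
qed

lemma mp_pred: "i < N \<Longrightarrow> j \<in> set (preds (C ! i)) \<Longrightarrow> f (C ! i) + mp f j \<le> mp f i"
  using foldl_max_ge[of "mp f j" "map (mp f) (preds (C ! i))" 0] by (simp add: mp_rec)

lemma preds_empty: "i < N \<Longrightarrow> preds (C ! i) = [] \<longleftrightarrow> C ! i = InG"
  using wfD(1)[of i] by (cases "C ! i") auto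

lemma ipath_le: "ipath C p \<Longrightarrow> (\<Sum>i\<leftarrow>p. f (C ! i)) \<le> mp f (last p)"
proof (induction p rule: rev_induct)
  case (snoc i p)
  show ?case
  proof (cases "p = []")
    case True
    with snoc show ?thesis by (simp add: ipath_def mp_rec)
  next
    case False
    with snoc have "ipath C p" "i < N" "last p \<in> set (preds (C ! i))" by (simp_all add: ipath_snoc)
    with snoc mp_pred[of i "last p" f] show ?thesis by simp
  qed
qed (simp add: ipath_def)

text \<open>Following maximising predecessors backwards can stop only at a gate without
  predecessors, and by the arity conditions this is an input.\<close>

lemma ex_ipath: "i < N \<Longrightarrow> \<exists>p. ipath C p \<and> last p = i \<and> (\<Sum>j\<leftarrow>p. f (C ! j)) = mp f i"
proof (induction i rule: less_induct)
  case (less i)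
  show ?case
  proof (cases "preds (C ! i) = []")
    case True
    with less preds_empty have "ipath C [i]" by (simp add: ipath_def)
    with True less show ?thesis by (intro exI[of _ "[i]"]) (simp add: mp_rec)
  next
    case False
    have "\<exists>j\<in>set (preds (C ! i)). mp f i = f (C ! i) + mp f j"
    proof (cases "foldl max 0 (map (mp f) (preds (C ! i))) = 0")
      case True
      from False obtain j where j: "j \<in> set (preds (C ! i))" by (cases "preds (C ! i)") auto
      with True foldl_max_ge[of "mp f j" "map (mp f) (preds (C ! i))" 0] less show ?thesis
        by (intro bexI[of _ j]) (simp_all add: mp_rec)
    next
      case F: False
      with foldl_max_mem[of 0 "map (mp f) (preds (C ! i))"] less show ?thesis by (auto simp: mp_rec[of i])
    qed
    then obtain j where j: "j \<in> set (preds (C ! i))" "mp f i = f (C ! i) + mp f j" by blast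
    with less wfD(2)[of i j] obtain p where p: "ipath C p" "last p = j" "(\<Sum>j\<leftarrow>p. f (C ! j)) = mp f j" by fastforce
    then have "p \<noteq> []" by (simp add: ipath_def)
    with p j less have "ipath C (p @ [i])" by (simp add: ipath_snoc)
    with p j show ?thesis by (intro exI[of _ "p @ [i]"]) simp
  qed
qed

lemma ipath_length: "ipath C p \<Longrightarrow> (\<Sum>i\<leftarrow>p. depth_weight (C ! i)) = length p - 1"
proof (induction p rule: rev_induct)
  case (snoc i p)
  show ?case
  proof (cases "p = []")
    case True
    with snoc show ?thesis by (simp add: ipath_def depth_weight_def)
  next
    case False
    with snoc have i: "ipath C p" "last p \<in> set (preds (C ! i))" by (simp_all add: ipath_snoc)
    then have "depth_weight (C ! i) = 1" by (cases "C ! i") (auto simp: depth_weight_def)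
    with i snoc False show ?thesis by (simp add: Suc_diff_Suc)
  qed
qed (simp add: ipath_def)

lemma sum_weft: "(\<Sum>i\<leftarrow>p. weft_weight (C ! i)) = length (filter (\<lambda>i. large (C ! i)) p)"
  by (induction p) (simp_all add: weft_weight_def large_def)

lemma depth_le_iff: "depth_le C d \<longleftrightarrow> mp depth_weight (N - 1) \<le> d"
proof
  assume "depth_le C d"
  moreover obtain p where "ipath C p" "last p = N - 1" "(\<Sum>j\<leftarrow>p. depth_weight (C ! j)) = mp depth_weight (N - 1)"
    using ex_ipath[of "N - 1"] N_pos by auto
  ultimately show "mp depth_weight (N - 1) \<le> d"
    using ipath_length unfolding depth_le_def in_out_path_iff by fastforce
next
  assume "mp depth_weight (N - 1) \<le> d"
  then show "depth_le C d"
    unfolding depth_le_def in_out_path_iff using ipath_length ipath_le[of _ depth_weight] by fastforce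
qed

lemma weft_le_iff: "weft_le C d \<longleftrightarrow> mp weft_weight (N - 1) \<le> d"
proof
  assume "weft_le C d"
  moreover obtain p where "ipath C p" "last p = N - 1" "(\<Sum>j\<leftarrow>p. weft_weight (C ! j)) = mp weft_weight (N - 1)"
    using ex_ipath[of "N - 1"] N_pos by auto
  ultimately show "mp weft_weight (N - 1) \<le> d"
    unfolding weft_le_def in_out_path_iff sum_weft by fastforce
next
  assume "mp weft_weight (N - 1) \<le> d"
  then show "weft_le C d"
    unfolding weft_le_def in_out_path_iff using ipath_le[of _ weft_weight] unfolding sum_weft by fastforce
qed

end

section \<open>Certificates and refutations for the output\<close>

locale assigned_circuit = circuit +
  fixes a :: "nat \<Rightarrow> bool"
begin

definition "val i = gate_values a C ! i"

lemma val_rec: assumes "i < N"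
  shows "C ! i = InG \<Longrightarrow> val i = a i" "C ! i = NotG j \<Longrightarrow> val i = (\<not> val j)"
    "C ! i = AndG js \<Longrightarrow> val i = (\<forall>j\<in>set js. val j)" "C ! i = OrG js \<Longrightarrow> val i = (\<exists>j\<in>set js. val j)"
  using wfD(2)[OF assms] assms
  by (auto simp: val_def gate_values_run nth_run)

abbreviation "B J I i \<equiv> bit (run (bits_step J I) C) i"

lemma B_rec: assumes i: "i < N"
  shows "C ! i = InG \<Longrightarrow> B J I i = (known_true J i, \<not> known_false J i, \<not> known_false I i, known_true I i)"
    "C ! i = NotG j \<Longrightarrow> B J I i = (\<not> hi (B J I j), \<not> lo (B J I j), \<not> ne (B J I j), \<not> po (B J I j))"
    "C ! i = AndG js \<Longrightarrow> B J I i = (\<forall>j\<in>set js. lo (B J I j), \<forall>j\<in>set js. hi (B J I j), \<forall>j\<in>set js. po (B J I j),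
       if 2 < length js then \<forall>j\<in>set js. hi (B J I j) else \<forall>j\<in>set js. ne (B J I j))"
    "C ! i = OrG js \<Longrightarrow> B J I i = (\<exists>j\<in>set js. lo (B J I j), \<exists>j\<in>set js. hi (B J I j),
       if 2 < length js then \<exists>j\<in>set js. lo (B J I j) else \<exists>j\<in>set js. po (B J I j), \<exists>j\<in>set js. ne (B J I j))"
proof -
  have tk: "nthd z (take i (run (bits_step J I) C)) j = nthd z (run (bits_step J I) C) j" if "j \<in> set (preds (C ! i))" for z j
    using wfD(2)[OF i that] i by (simp add: nthd_def)
  have B: "B J I i = bits_step J I (take i (run (bits_step J I) C)) (C ! i)"
    using i by (simp add: nthd_def nth_run)
  show "C ! i = InG \<Longrightarrow> B J I i = (known_true J i, \<not> known_false J i, \<not> known_false I i, known_true I i)"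
    unfolding B using i by (simp add: bits_step_def)
  show "C ! i = NotG j \<Longrightarrow> B J I i = (\<not> hi (B J I j), \<not> lo (B J I j), \<not> ne (B J I j), \<not> po (B J I j))"
    unfolding B using tk by (simp add: bits_step_def)
  show "C ! i = AndG js \<Longrightarrow> B J I i = (\<forall>j\<in>set js. lo (B J I j), \<forall>j\<in>set js. hi (B J I j), \<forall>j\<in>set js. po (B J I j),
       if 2 < length js then \<forall>j\<in>set js. hi (B J I j) else \<forall>j\<in>set js. ne (B J I j))"
    unfolding B using tk by (simp add: bits_step_def)
  show "C ! i = OrG js \<Longrightarrow> B J I i = (\<exists>j\<in>set js. lo (B J I j), \<exists>j\<in>set js. hi (B J I j),
       if 2 < length js then \<exists>j\<in>set js. lo (B J I j) else \<exists>j\<in>set js. po (B J I j), \<exists>j\<in>set js. ne (B J I j))"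
    unfolding B using tk by (simp add: bits_step_def)
qed

definition inputs :: "nat set" where "inputs = {i. i < N \<and> C ! i = InG}"

text \<open>Truthfulness is required at inputs only, because a gap may enclose positions of other
  gates.\<close>

definition cons :: "gap list \<Rightarrow> bool" where
  "cons J \<longleftrightarrow> (\<forall>i\<in>inputs. (known_true J i \<longrightarrow> a i) \<and> (known_false J i \<longrightarrow> \<not> a i))"

definition knows :: "gap list \<Rightarrow> nat set \<Rightarrow> bool" where
  "knows J X \<longleftrightarrow> (\<forall>i\<in>X. known_true J i \<or> known_false J i)"

definition small_set :: "nat \<Rightarrow> nat set \<Rightarrow> bool" where
  "small_set i X \<longleftrightarrow> X \<subseteq> inputs \<and> card X \<le> 2 ^ mp depth_weight i"

lemma finite_inputs: "finite inputs" by (simp add: inputs_def)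

lemma small_set_empty: "small_set i {}" by (simp add: small_set_def)

lemma knows_UN: "knows J (\<Union>j\<in>A. X j) \<longleftrightarrow> (\<forall>j\<in>A. knows J (X j))"
  by (auto simp: knows_def)

lemma small_set_mono:
  assumes "i < N" "j \<in> set (preds (C ! i))" "small_set j X" shows "small_set i X"
proof -
  have "mp depth_weight j \<le> mp depth_weight i" using mp_pred[OF assms(1,2), of depth_weight] by simp
  then have "(2::nat) ^ mp depth_weight j \<le> 2 ^ mp depth_weight i" by (rule power_increasing) simp
  with assms(3) show ?thesis unfolding small_set_def by linarith
qed

text \<open>The depth drops at each predecessor, so two sets of at most half the permitted size are
  united. This is the origin of the powers of two.\<close>

lemma small_set_UN:
  assumes i: "i < N" and le: "length (preds (C ! i)) \<le> 2" and ne: "C ! i \<noteq> InG"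
    and X: "\<And>j. j \<in> set (preds (C ! i)) \<Longrightarrow> small_set j (X j)"
  shows "small_set i (\<Union>j\<in>set (preds (C ! i)). X j)"
proof -
  have d: "depth_weight (C ! i) = 1" using ne by (cases "C ! i") (auto simp: depth_weight_def)
  have "card (\<Union>j\<in>set (preds (C ! i)). X j) \<le> (\<Sum>j\<in>set (preds (C ! i)). card (X j))"
    by (rule card_UN_le) simp
  also have "\<dots> \<le> (\<Sum>j\<in>set (preds (C ! i)). 2 ^ (mp depth_weight i - 1))"
  proof (rule sum_mono)
    fix j assume j: "j \<in> set (preds (C ! i))"
    have "mp depth_weight j \<le> mp depth_weight i - 1" using mp_pred[OF i j, of depth_weight] d by simp
    then have "(2::nat) ^ mp depth_weight j \<le> 2 ^ (mp depth_weight i - 1)" by (rule power_increasing) simp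
    with X[OF j] show "card (X j) \<le> 2 ^ (mp depth_weight i - 1)" unfolding small_set_def by linarith
  qed
  also have "\<dots> \<le> 2 * 2 ^ (mp depth_weight i - 1)"
    using card_length[of "preds (C ! i)"] le by simp
  also have "\<dots> = 2 ^ mp depth_weight i"
  proof -
    have "mp depth_weight i \<ge> 1" using mp_rec[OF i, of depth_weight] d by simp
    then show ?thesis by (metis power_Suc Suc_pred' less_eq_Suc_le One_nat_def)
  qed
  finally show ?thesis using X unfolding small_set_def by blast
qed

lemma bounds:
  assumes "cons J" shows "i < N \<Longrightarrow> (lo (B J I i) \<longrightarrow> val i) \<and> (val i \<longrightarrow> hi (B J I i))"
proof (induction i rule: less_induct)
  case (less i)
  have IH: "(lo (B J I j) \<longrightarrow> val j) \<and> (val j \<longrightarrow> hi (B J I j))" if "j \<in> set (preds (C ! i))" for j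
    using less.IH[OF wfD(2)[OF less.prems that]] wfD(2)[OF less.prems that] less.prems by simp
  show ?case
  proof (cases "C ! i")
    case InG
    with less assms show ?thesis by (auto simp: B_rec val_rec cons_def inputs_def)
  next
    case (NotG j)
    with IH[of j] less.prems show ?thesis by (auto simp: B_rec val_rec)
  next
    case (AndG js)
    with IH less.prems show ?thesis by (simp add: B_rec val_rec)
  next
    case (OrG js)
    with IH less.prems show ?thesis by (auto simp: B_rec val_rec)
  qed
qed

lemma small_gate:
  assumes "i < N" "mp weft_weight i = 0"
  shows "length (preds (C ! i)) \<le> 2" "\<And>j. j \<in> set (preds (C ! i)) \<Longrightarrow> mp weft_weight j = 0"
proof -
  have "weft_weight (C ! i) = 0" using mp_rec[OF assms(1), of weft_weight] assms(2) by simp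
  then show "length (preds (C ! i)) \<le> 2" by (simp add: weft_weight_def split: if_splits)
  show "\<And>j. j \<in> set (preds (C ! i)) \<Longrightarrow> mp weft_weight j = 0"
    using mp_pred[OF assms(1), of _ weft_weight] assms(2) by fastforce
qed

lemma large_gate:
  assumes "i < N" "mp weft_weight i \<le> 1" "2 < length (preds (C ! i))" "j \<in> set (preds (C ! i))"
  shows "mp weft_weight j = 0"
  using mp_pred[OF assms(1,4), of weft_weight] assms(2,3) by (simp add: weft_weight_def)

lemma pred_weft:
  assumes "i < N" "mp weft_weight i \<le> 1" "j \<in> set (preds (C ! i))"
  shows "mp weft_weight j \<le> 1"
  using mp_pred[OF assms(1,3), of weft_weight] assms(2) by simp

text \<open>With small gates only, the inputs below form a small set, and once these are known the
  Kleene bounds meet.\<close>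

lemma decided:
  "i < N \<Longrightarrow> mp weft_weight i = 0 \<Longrightarrow> \<exists>X. small_set i X \<and>
     (\<forall>J I. cons J \<longrightarrow> knows J X \<longrightarrow> lo (B J I i) = val i \<and> hi (B J I i) = val i)"
proof (induction i rule: less_induct)
  case (less i)
  have "\<forall>j\<in>set (preds (C ! i)). \<exists>X. small_set j X \<and>
     (\<forall>J I. cons J \<longrightarrow> knows J X \<longrightarrow> lo (B J I j) = val j \<and> hi (B J I j) = val j)"
    using less.IH wfD(2)[OF less.prems(1)] small_gate(2)[OF less.prems] less.prems(1) by (meson less_trans)
  then obtain X where X: "\<And>j. j \<in> set (preds (C ! i)) \<Longrightarrow> small_set j (X j)"
    "\<And>j J I. j \<in> set (preds (C ! i)) \<Longrightarrow> cons J \<Longrightarrow> knows J (X j) \<Longrightarrow> lo (B J I j) = val j \<and> hi (B J I j) = val j"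
    by metis
  show ?case
  proof (cases "C ! i = InG")
    case True
    then have "small_set i {i}" using less.prems by (simp add: small_set_def inputs_def)
    moreover have "lo (B J I i) = val i \<and> hi (B J I i) = val i" if "cons J" "knows J {i}" for J I
      using that True less.prems by (auto simp: B_rec val_rec cons_def knows_def inputs_def)
    ultimately show ?thesis by blast
  next
    case False
    let ?X = "\<Union>j\<in>set (preds (C ! i)). X j"
    have "small_set i ?X" by (rule small_set_UN[OF less.prems(1) small_gate(1)[OF less.prems] False X(1)])
    moreover have "lo (B J I i) = val i \<and> hi (B J I i) = val i" if "cons J" "knows J ?X" for J I
    proof -
      have "lo (B J I j) = val j \<and> hi (B J I j) = val j" if "j \<in> set (preds (C ! i))" for j
        using X(2)[OF that \<open>cons J\<close>] \<open>knows J ?X\<close> that unfolding knows_UN by blast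
      with False less.prems(1) show ?thesis
        by (cases "C ! i") (simp_all add: B_rec val_rec)
    qed
    ultimately show ?thesis by blast
  qed
qed

text \<open>A small gate passes on the inputs of all predecessors. A large gate needs one
  predecessor: a false one if a conjunction is false, a true one if a disjunction is true. For the
  opposite values the bounds from \<open>J\<close> already suffice, so nothing needs to be known.
  The claim about \<open>ne\<close> runs along because negation exchanges it with
  \<open>po\<close>.\<close>

lemma refuted:
  assumes J: "cons J"
  shows "i < N \<Longrightarrow> \<exists>X. small_set i X \<and>
     (\<forall>I. cons I \<longrightarrow> knows I X \<longrightarrow> (po (B J I i) \<longrightarrow> val i) \<and> (val i \<longrightarrow> ne (B J I i)))"
proof (induction i rule: less_induct)
  case (less i)
  have "\<forall>j\<in>set (preds (C ! i)). \<exists>X. small_set j X \<and>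
     (\<forall>I. cons I \<longrightarrow> knows I X \<longrightarrow> (po (B J I j) \<longrightarrow> val j) \<and> (val j \<longrightarrow> ne (B J I j)))"
    using less.IH wfD(2)[OF less.prems] less.prems by (meson less_trans)
  then obtain X where X: "\<And>j. j \<in> set (preds (C ! i)) \<Longrightarrow> small_set j (X j)"
    "\<And>j I. j \<in> set (preds (C ! i)) \<Longrightarrow> cons I \<Longrightarrow> knows I (X j) \<Longrightarrow> (po (B J I j) \<longrightarrow> val j) \<and> (val j \<longrightarrow> ne (B J I j))"
    by metis
  note bd = bounds[OF J]
  show ?case
  proof (cases "C ! i = InG")
    case True
    then have "small_set i {i}" using less.prems by (simp add: small_set_def inputs_def)
    moreover have "(po (B J I i) \<longrightarrow> val i) \<and> (val i \<longrightarrow> ne (B J I i))" if "cons I" "knows I {i}" for I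
      using that True less.prems by (auto simp: B_rec val_rec cons_def knows_def inputs_def)
    ultimately show ?thesis by blast
  next
    case nin: False
    show ?thesis
    proof (cases "length (preds (C ! i)) \<le> 2")
      case True
      let ?X = "\<Union>j\<in>set (preds (C ! i)). X j"
      have "small_set i ?X" by (rule small_set_UN[OF less.prems True nin X(1)])
      moreover have "(po (B J I i) \<longrightarrow> val i) \<and> (val i \<longrightarrow> ne (B J I i))" if "cons I" "knows I ?X" for I
      proof -
        have "(po (B J I j) \<longrightarrow> val j) \<and> (val j \<longrightarrow> ne (B J I j))" if "j \<in> set (preds (C ! i))" for j
          using X(2)[OF that \<open>cons I\<close>] \<open>knows I ?X\<close> that unfolding knows_UN by blast
        with nin less.prems True show ?thesis
          by (cases "C ! i") (auto simp: B_rec val_rec)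
      qed
      ultimately show ?thesis by blast
    next
      case lg: False
      have pr: "\<And>j. j \<in> set (preds (C ! i)) \<Longrightarrow> j < N" using wfD(2)[OF less.prems] less.prems by force
      show ?thesis
      proof (cases "C ! i")
        case (AndG js)
        show ?thesis
        proof (cases "val i")
          case True
          then have "(po (B J I i) \<longrightarrow> val i) \<and> (val i \<longrightarrow> ne (B J I i))" for I
            using AndG lg less.prems bd pr by (auto simp: B_rec val_rec)
          then show ?thesis using small_set_empty by blast
        next
          case False
          then obtain j where j: "j \<in> set js" "\<not> val j" using AndG less.prems by (auto simp: val_rec)
          have "small_set i (X j)" using small_set_mono[OF less.prems _ X(1)] j AndG by simp
          moreover have "(po (B J I i) \<longrightarrow> val i) \<and> (val i \<longrightarrow> ne (B J I i))" if "cons I" "knows I (X j)" for I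
            using X(2)[of j I] that j False AndG less.prems by (auto simp: B_rec)
          ultimately show ?thesis by blast
        qed
      next
        case (OrG js)
        show ?thesis
        proof (cases "val i")
          case False
          then have "(po (B J I i) \<longrightarrow> val i) \<and> (val i \<longrightarrow> ne (B J I i))" for I
            using OrG lg less.prems bd pr by (auto simp: B_rec val_rec)
          then show ?thesis using small_set_empty by blast
        next
          case True
          then obtain j where j: "j \<in> set js" "val j" using OrG less.prems by (auto simp: val_rec)
          have "small_set i (X j)" using small_set_mono[OF less.prems _ X(1)] j OrG by simp
          moreover have "(po (B J I i) \<longrightarrow> val i) \<and> (val i \<longrightarrow> ne (B J I i))" if "cons I" "knows I (X j)" for I
            using X(2)[of j I] that j True OrG less.prems by (auto simp: B_rec)
          ultimately show ?thesis by blast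
        qed
      qed (use nin lg in auto)
    qed
  qed
qed

text \<open>Below small gates \<open>po\<close> and \<open>ne\<close> are built from
  \<open>I\<close> alone and err only on the generous side for truthful \<open>I\<close>.\<close>

lemma small_certified:
  "i < N \<Longrightarrow> mp weft_weight i = 0 \<Longrightarrow> cons I \<Longrightarrow> (val i \<longrightarrow> po (B J I i)) \<and> (ne (B J I i) \<longrightarrow> val i)"
proof (induction i rule: less_induct)
  case (less i)
  have IH: "(val j \<longrightarrow> po (B J I j)) \<and> (ne (B J I j) \<longrightarrow> val j)" if "j \<in> set (preds (C ! i))" for j
    using less.IH[of j] wfD(2)[OF less.prems(1) that] small_gate(2)[OF less.prems(1,2) that] less.prems by simp
  have le: "length (preds (C ! i)) \<le> 2" by (rule small_gate(1)[OF less.prems(1,2)])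
  show ?case
  proof (cases "C ! i")
    case InG
    with less.prems show ?thesis by (auto simp: B_rec val_rec cons_def inputs_def)
  next
    case (NotG j)
    with IH[of j] less.prems show ?thesis by (auto simp: B_rec val_rec)
  next
    case (AndG js)
    with IH less.prems le show ?thesis by (simp add: B_rec val_rec)
  next
    case (OrG js)
    with IH less.prems le show ?thesis by (auto simp: B_rec val_rec)
  qed
qed

text \<open>Here \<open>J\<close> has to know a witness for each true large disjunction and each
  false large conjunction that is reached. Weft at most 1 is decisive: the witness has weft 0, so
  \<open>decided\<close> certifies it by few inputs.\<close>

lemma certified:
  "i < N \<Longrightarrow> mp weft_weight i \<le> 1 \<Longrightarrow> \<exists>X. small_set i X \<and>
     (\<forall>J I. cons J \<longrightarrow> cons I \<longrightarrow> knows J X \<longrightarrow> (val i \<longrightarrow> po (B J I i)) \<and> (ne (B J I i) \<longrightarrow> val i))"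
proof (induction i rule: less_induct)
  case (less i)
  have "\<forall>j\<in>set (preds (C ! i)). \<exists>X. small_set j X \<and>
     (\<forall>J I. cons J \<longrightarrow> cons I \<longrightarrow> knows J X \<longrightarrow> (val j \<longrightarrow> po (B J I j)) \<and> (ne (B J I j) \<longrightarrow> val j))"
    using less.IH wfD(2)[OF less.prems(1)] pred_weft[OF less.prems] less.prems(1) by (meson less_trans)
  then obtain X where X: "\<And>j. j \<in> set (preds (C ! i)) \<Longrightarrow> small_set j (X j)"
    "\<And>j J I. j \<in> set (preds (C ! i)) \<Longrightarrow> cons J \<Longrightarrow> cons I \<Longrightarrow> knows J (X j) \<Longrightarrow>
       (val j \<longrightarrow> po (B J I j)) \<and> (ne (B J I j) \<longrightarrow> val j)"
    by metis
  show ?case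
  proof (cases "C ! i = InG")
    case True
    have "(val i \<longrightarrow> po (B J I i)) \<and> (ne (B J I i) \<longrightarrow> val i)" if "cons I" for J I
      using that True less.prems by (auto simp: B_rec val_rec cons_def inputs_def)
    then show ?thesis using small_set_empty by blast
  next
    case nin: False
    show ?thesis
    proof (cases "length (preds (C ! i)) \<le> 2")
      case True
      let ?X = "\<Union>j\<in>set (preds (C ! i)). X j"
      have "small_set i ?X" by (rule small_set_UN[OF less.prems(1) True nin X(1)])
      moreover have "(val i \<longrightarrow> po (B J I i)) \<and> (ne (B J I i) \<longrightarrow> val i)" if "cons J" "cons I" "knows J ?X" for J I
      proof -
        have "(val j \<longrightarrow> po (B J I j)) \<and> (ne (B J I j) \<longrightarrow> val j)" if "j \<in> set (preds (C ! i))" for j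
          using X(2)[OF that \<open>cons J\<close> \<open>cons I\<close>] \<open>knows J ?X\<close> that unfolding knows_UN by blast
        with nin less.prems True show ?thesis
          by (cases "C ! i") (auto simp: B_rec val_rec)
      qed
      ultimately show ?thesis by blast
    next
      case False
      have lg: "2 < length (preds (C ! i))" using False by simp
      have pr: "\<And>j. j \<in> set (preds (C ! i)) \<Longrightarrow> j < N" using wfD(2)[OF less.prems(1)] less.prems by force
      have sm: "(val j \<longrightarrow> po (B J I j)) \<and> (ne (B J I j) \<longrightarrow> val j)" if "j \<in> set (preds (C ! i))" "cons I" for j J I
        by (rule small_certified[OF pr[OF that(1)] large_gate[OF less.prems lg that(1)] that(2)])
      have dec: "\<exists>X. small_set i X \<and> (\<forall>J I. cons J \<longrightarrow> knows J X \<longrightarrow> lo (B J I j) = val j \<and> hi (B J I j) = val j)"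
        if "j \<in> set (preds (C ! i))" for j
        using decided[OF pr[OF that] large_gate[OF less.prems lg that]] small_set_mono[OF less.prems(1) that] by blast
      show ?thesis
      proof (cases "C ! i")
        case (AndG js)
        show ?thesis
        proof (cases "val i")
          case True
          then have "(val i \<longrightarrow> po (B J I i)) \<and> (ne (B J I i) \<longrightarrow> val i)" if "cons I" for J I
            using AndG less.prems sm that by (auto simp: B_rec val_rec)
          then show ?thesis using small_set_empty by blast
        next
          case False
          then obtain j where j: "j \<in> set js" "\<not> val j" using AndG less.prems by (auto simp: val_rec)
          from dec[of j] j AndG obtain Y where Y: "small_set i Y"
            "\<And>J I. cons J \<Longrightarrow> knows J Y \<Longrightarrow> lo (B J I j) = val j \<and> hi (B J I j) = val j" by auto
          have "(val i \<longrightarrow> po (B J I i)) \<and> (ne (B J I i) \<longrightarrow> val i)" if "cons J" "knows J Y" for J I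
            using Y(2)[OF that, of I] j False AndG less.prems lg by (auto simp: B_rec)
          with Y(1) show ?thesis by blast
        qed
      next
        case (OrG js)
        show ?thesis
        proof (cases "val i")
          case False
          then have "(val i \<longrightarrow> po (B J I i)) \<and> (ne (B J I i) \<longrightarrow> val i)" if "cons I" for J I
            using OrG less.prems sm that by (auto simp: B_rec val_rec)
          then show ?thesis using small_set_empty by blast
        next
          case True
          then obtain j where j: "j \<in> set js" "val j" using OrG less.prems by (auto simp: val_rec)
          from dec[of j] j OrG obtain Y where Y: "small_set i Y"
            "\<And>J I. cons J \<Longrightarrow> knows J Y \<Longrightarrow> lo (B J I j) = val j \<and> hi (B J I j) = val j" by auto
          have "(val i \<longrightarrow> po (B J I i)) \<and> (ne (B J I i) \<longrightarrow> val i)" if "cons J" "knows J Y" for J I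
            using Y(2)[OF that, of I] j True OrG less.prems lg by (auto simp: B_rec)
          with Y(1) show ?thesis by blast
        qed
      qed (use nin lg in auto)
    qed
  qed
qed

text \<open>\<open>F\<close> abstracts the tuples of gaps: all are truthful, and each small set is
  known to one of them. \<open>certified\<close> provides the right \<open>J\<close>; if the output
  is false, \<open>refuted\<close> provides an \<open>I\<close> against any
  \<open>J\<close>.\<close>

lemma output_iff:
  assumes d: "depth_le C d" and w: "weft_le C 1"
    and F: "\<And>J. J \<in> F \<Longrightarrow> cons J" "\<And>X. X \<subseteq> inputs \<Longrightarrow> card X \<le> 2 ^ d \<Longrightarrow> \<exists>J\<in>F. knows J X"
  shows "circuit_output a C \<longleftrightarrow> (\<exists>J\<in>F. \<forall>I\<in>F. out_bit C J I)"
proof -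
  have N1: "N - 1 < N" using N_pos by simp
  have len: "length (gate_values a C) = N" by (simp add: gate_values_run)
  then have "gate_values a C \<noteq> []" using N_pos by (metis length_greater_0_conv)
  then have out: "circuit_output a C = val (N - 1)"
    unfolding circuit_output_def val_def by (simp add: last_conv_nth len)
  have bit: "out_bit C J I = po (B J I (N - 1))" for J I by (simp add: out_bit_def)
  have know: "\<exists>J\<in>F. knows J X" if "small_set (N - 1) X" for X
  proof (rule F(2))
    have "(2::nat) ^ mp depth_weight (N - 1) \<le> 2 ^ d"
      by (rule power_increasing) (use d depth_le_iff in auto)
    with that show "X \<subseteq> inputs" "card X \<le> 2 ^ d" unfolding small_set_def by (auto intro: le_trans)
  qed
  show ?thesis
    unfolding out bit
  proof
    assume v: "val (N - 1)"
    have "mp weft_weight (N - 1) \<le> 1" using w weft_le_iff by simp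
    from certified[OF N1 this] obtain X where X: "small_set (N - 1) X"
      "\<And>J I. cons J \<Longrightarrow> cons I \<Longrightarrow> knows J X \<Longrightarrow> val (N - 1) \<longrightarrow> po (B J I (N - 1))" by blast
    from know[OF X(1)] obtain J where "J \<in> F" "knows J X" by blast
    with X(2) v F(1) show "\<exists>J\<in>F. \<forall>I\<in>F. po (B J I (N - 1))" by blast
  next
    assume "\<exists>J\<in>F. \<forall>I\<in>F. po (B J I (N - 1))"
    then obtain J where J: "J \<in> F" "\<And>I. I \<in> F \<Longrightarrow> po (B J I (N - 1))" by blast
    from refuted[OF F(1)[OF J(1)] N1] obtain X where X: "small_set (N - 1) X"
      "\<And>I. cons I \<Longrightarrow> knows I X \<Longrightarrow> po (B J I (N - 1)) \<longrightarrow> val (N - 1)" by blast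
    from know[OF X(1)] obtain I where "I \<in> F" "knows I X" by blast
    with X(2) J F(1) show "val (N - 1)" by blast
  qed
qed

end

section \<open>Gaps of a selection and local views\<close>

type_synonym view = "gap list \<times> gap list"

text \<open>A gap \<open>(i, a, b)\<close> says that \<open>a\<close> and \<open>b\<close> are consecutive among the boundaries
  \<open>0 = g 0 < \<dots> < g (k + 1) = N + 1\<close>, where \<open>g i - 1\<close> is the \<open>i\<close>-th selected input for \<open>1 \<le> i \<le> k\<close>.\<close>

definition valid_gap :: "circuit \<Rightarrow> nat \<Rightarrow> gap \<Rightarrow> bool" where
  "valid_gap C k t \<longleftrightarrow> fst (snd t) < snd (snd t) \<and> (fst t = 0) = (fst (snd t) = 0) \<and>
     (fst t = k) = (snd (snd t) = Suc (length C)) \<and>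
     (fst (snd t) \<noteq> 0 \<longrightarrow> gtag (nthd InG C (fst (snd t) - 1)) = 0) \<and>
     (snd (snd t) \<noteq> Suc (length C) \<longrightarrow> gtag (nthd InG C (snd (snd t) - 1)) = 0)"

text \<open>Uniqueness of each gap and matching ends of neighbours are binary conditions, and
  together they force one chain of boundaries.\<close>

definition compat :: "gap \<Rightarrow> gap \<Rightarrow> bool" where
  "compat x y \<longleftrightarrow> (fst x = fst y \<longrightarrow> snd x = snd y) \<and> (Suc (fst x) = fst y \<longrightarrow> snd (snd x) = fst (snd y))"

definition view_cons :: "view \<Rightarrow> view \<Rightarrow> bool" where
  "view_cons V V' \<longleftrightarrow> fst V = fst V' \<and> (\<forall>x\<in>set (fst V @ snd V). \<forall>y\<in>set (fst V' @ snd V'). compat x y)"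

definition view_ok :: "circuit \<Rightarrow> nat \<Rightarrow> nat list \<Rightarrow> view \<Rightarrow> bool" where
  "view_ok C k I V \<longleftrightarrow> map fst (snd V) = I \<and> (\<forall>t\<in>set (fst V @ snd V). valid_gap C k t) \<and> out_bit C (fst V) (snd V)"

definition parts :: "nat \<Rightarrow> nat \<Rightarrow> nat list list" where
  "parts q k = List.n_lists q [0..<Suc k]"

definition views :: "nat \<Rightarrow> circuit \<Rightarrow> nat \<Rightarrow> view list" where
  "views q C k = (let G = List.n_lists q (List.product [0..<Suc k] (List.product [0..<length C + 2] [0..<length C + 2]))
     in List.product G G)"

lemma set_parts: "set (parts q k) = {I. length I = q \<and> set I \<subseteq> {..k}}"
  by (auto simp: parts_def set_n_lists less_Suc_eq_le)

lemma set_views: "set (views q C k) = {V. length (fst V) = q \<and> length (snd V) = q \<and>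
    (\<forall>t\<in>set (fst V @ snd V). fst t \<le> k \<and> fst (snd t) < length C + 2 \<and> snd (snd t) < length C + 2)}"
proof -
  define Q where "Q t \<longleftrightarrow> fst t \<le> k \<and> fst (snd t) < length C + 2 \<and> snd (snd t) < length C + 2" for t
  have "set (List.product [0..<Suc k] (List.product [0..<length C + 2] [0..<length C + 2])) = {t. Q t}"
    by (auto simp: Q_def less_Suc_eq_le simp del: upt_Suc)
  then have "set (views q C k) = {ys. length ys = q \<and> set ys \<subseteq> {t. Q t}} \<times> {ys. length ys = q \<and> set ys \<subseteq> {t. Q t}}"
    unfolding views_def Let_def set_product set_n_lists by simp
  also have "\<dots> = {V. length (fst V) = q \<and> length (snd V) = q \<and> (\<forall>t\<in>set (fst V @ snd V). Q t)}"
    by auto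
  finally show ?thesis unfolding Q_def .
qed

locale selected_circuit = assigned_circuit +
  fixes k :: nat and g :: "nat \<Rightarrow> nat"
  assumes g_Suc: "\<And>i. i \<le> k \<Longrightarrow> g i < g (Suc i)" and g_0: "g 0 = 0" and g_k: "g (Suc k) = Suc (length C)"
    and a_iff: "\<And>v. v < length C \<Longrightarrow> C ! v = InG \<Longrightarrow> a v \<longleftrightarrow> (\<exists>i. 1 \<le> i \<and> i \<le> k \<and> g i = Suc v)"
begin

definition gap :: "nat \<Rightarrow> gap" where "gap i = (i, g i, g (Suc i))"

lemma g_mono: "i < j \<Longrightarrow> j \<le> Suc k \<Longrightarrow> g i < g j"
proof (induction j)
  case (Suc j)
  then show ?case using g_Suc[of j] by (cases "i = j") auto
qed simp

lemma g_mono_le: "i \<le> j \<Longrightarrow> j \<le> Suc k \<Longrightarrow> g i \<le> g j"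
  using g_mono[of i j] by (cases "i = j") auto

lemma cons_gaps: assumes "set I \<subseteq> {..k}" shows "cons (map gap I)"
  unfolding cons_def
proof (intro ballI conjI impI)
  fix v assume "v \<in> inputs"
  then have v: "v < N" "C ! v = InG" by (auto simp: inputs_def)
  {
    assume "known_true (map gap I) v"
    then obtain i where i: "i \<in> set I" "Suc v = g i \<or> Suc v = g (Suc i)" by (auto simp: known_true_def gap_def)
    then obtain j where j: "Suc v = g j" "j \<le> Suc k" using assms by fastforce
    have "j \<noteq> 0" using j(1) g_0 by (cases j) auto
    moreover have "j \<noteq> Suc k" using j(1) g_k v(1) by auto
    ultimately have "1 \<le> j \<and> j \<le> k \<and> g j = Suc v" using j by simp
    then show "a v" using a_iff[OF v] by blast
  }
  assume "known_false (map gap I) v"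
  then obtain i where i: "i \<in> set I" "g i < Suc v" "Suc v < g (Suc i)" by (auto simp: known_false_def gap_def)
  show "\<not> a v"
  proof
    assume "a v"
    then obtain j where j: "j \<le> k" "g j = Suc v" using a_iff[OF v] by blast
    have "i \<le> k" using i assms by auto
    then show False using i j g_mono_le[of j i] g_mono_le[of "Suc i" j] by (cases "j \<le> i") auto
  qed
qed

lemma ex_gap: "n \<le> k \<Longrightarrow> Suc v \<le> g (Suc n) \<Longrightarrow> \<exists>i\<le>n. g i \<le> Suc v \<and> Suc v \<le> g (Suc i)"
proof (induction n)
  case 0
  then show ?case using g_0 by auto
next
  case (Suc n)
  show ?case
  proof (cases "g (Suc n) \<le> Suc v")
    case True
    with Suc show ?thesis by (intro exI[of _ "Suc n"]) simp
  next
    case False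
    with Suc obtain i where "i \<le> n" "g i \<le> Suc v \<and> Suc v \<le> g (Suc i)" by auto
    then show ?thesis by (intro exI[of _ i]) simp
  qed
qed

lemma knows_gaps:
  assumes X: "X \<subseteq> inputs" "card X \<le> q"
  shows "\<exists>I\<in>set (parts q k). knows (map gap I) X"
proof -
  have "\<exists>i\<le>k. g i \<le> Suc v \<and> Suc v \<le> g (Suc i)" if "v \<in> X" for v
    using that X(1) by (intro ex_gap) (auto simp: inputs_def g_k)
  then obtain h where h: "\<And>v. v \<in> X \<Longrightarrow> h v \<le> k \<and> g (h v) \<le> Suc v \<and> Suc v \<le> g (Suc (h v))" by metis
  have "finite X" using X(1) finite_inputs finite_subset by blast
  then obtain xs where xs: "set xs = X" "length xs = card X" by (metis finite_distinct_list distinct_card)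
  \<comment> \<open>Padding with gap 0 attains the exact length \<open>q\<close>; additional
    truthful information does no harm.\<close>
  let ?I = "map h xs @ replicate (q - card X) 0"
  have "?I \<in> set (parts q k)" using h xs X(2) by (auto simp: set_parts)
  moreover have "knows (map gap ?I) X"
    unfolding knows_def
  proof
    fix v assume v: "v \<in> X"
    then have "gap (h v) \<in> set (map gap ?I)" using xs by auto
    moreover have "Suc v = g (h v) \<or> Suc v = g (Suc (h v)) \<or> g (h v) < Suc v \<and> Suc v < g (Suc (h v))"
      using h[OF v] by linarith
    ultimately show "known_true (map gap ?I) v \<or> known_false (map gap ?I) v"
      unfolding known_true_def known_false_def by (metis gap_def fst_conv snd_conv)
  qed
  ultimately show ?thesis by blast
qed

lemma output_iff_gaps:
  assumes "depth_le C d" "weft_le C 1"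
  shows "circuit_output a C \<longleftrightarrow> (\<exists>J\<in>set (parts (2 ^ d) k). \<forall>I\<in>set (parts (2 ^ d) k). out_bit C (map gap J) (map gap I))"
proof -
  let ?F = "(\<lambda>I. map gap I) ` set (parts (2 ^ d) k)"
  have "circuit_output a C \<longleftrightarrow> (\<exists>J\<in>?F. \<forall>I\<in>?F. out_bit C J I)"
  proof (rule output_iff[OF assms])
    show "cons J" if "J \<in> ?F" for J using that by (auto simp: set_parts intro: cons_gaps)
    show "\<exists>J\<in>?F. knows J X" if "X \<subseteq> inputs" "card X \<le> 2 ^ d" for X using knows_gaps[OF that] by blast
  qed
  then show ?thesis by simp
qed

end

lemma ex_index_iff:
  assumes "distinct Is"
  shows "(\<exists>v v'. (\<forall>i<length Is. v i < length U \<and> ok (Is ! i) (U ! v i) \<and> v' i < length U \<and> ok (Is ! i) (U ! v' i)) \<and>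
      (\<forall>i<length Is. \<forall>j<length Is. R (U ! v i) (U ! v' j))) \<longleftrightarrow>
    (\<exists>f f'. (\<forall>I\<in>set Is. f I \<in> set U \<and> ok I (f I) \<and> f' I \<in> set U \<and> ok I (f' I)) \<and>
      (\<forall>I\<in>set Is. \<forall>J\<in>set Is. R (f I) (f' J)))" (is "?A \<longleftrightarrow> ?B")
proof
  assume ?A
  then obtain v v' where v: "\<And>i. i < length Is \<Longrightarrow> v i < length U \<and> ok (Is ! i) (U ! v i) \<and> v' i < length U \<and> ok (Is ! i) (U ! v' i)"
    "\<And>i j. i < length Is \<Longrightarrow> j < length Is \<Longrightarrow> R (U ! v i) (U ! v' j)" by blast
  have "\<forall>I\<in>set Is. \<exists>i. i < length Is \<and> Is ! i = I" by (simp add: in_set_conv_nth)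
  then obtain x where x: "\<And>I. I \<in> set Is \<Longrightarrow> x I < length Is \<and> Is ! x I = I" by metis
  have "U ! v (x I) \<in> set U \<and> ok I (U ! v (x I)) \<and> U ! v' (x I) \<in> set U \<and> ok I (U ! v' (x I))"
    if "I \<in> set Is" for I using v(1)[of "x I"] x[OF that] by simp
  moreover have "R (U ! v (x I)) (U ! v' (x J))" if "I \<in> set Is" "J \<in> set Is" for I J
    using v(2)[of "x I" "x J"] x[OF that(1)] x[OF that(2)] by simp
  ultimately show ?B
    by (intro exI[of _ "\<lambda>I. U ! v (x I)"] exI[of _ "\<lambda>I. U ! v' (x I)"]) simp
next
  assume ?B
  then obtain f f' where f: "\<And>I. I \<in> set Is \<Longrightarrow> f I \<in> set U \<and> ok I (f I) \<and> f' I \<in> set U \<and> ok I (f' I)"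
    "\<And>I J. I \<in> set Is \<Longrightarrow> J \<in> set Is \<Longrightarrow> R (f I) (f' J)" by blast
  have "\<forall>V\<in>set U. \<exists>i. i < length U \<and> U ! i = V" by (simp add: in_set_conv_nth)
  then obtain x where x: "\<And>V. V \<in> set U \<Longrightarrow> x V < length U \<and> U ! x V = V" by metis
  show ?A
    by (intro exI[of _ "\<lambda>i. x (f (Is ! i))"] exI[of _ "\<lambda>i. x (f' (Is ! i))"] conjI allI impI)
       (use f x nth_mem in auto)
qed

section \<open>Selections of weight \<open>k\<close> as consistent families of views\<close>

context circuit
begin

lemma views_of_selection:
  assumes d: "depth_le C d" and w: "weft_le C 1" and a: "weight a C = k" "circuit_output a C"
  shows "\<exists>f. (\<forall>I\<in>set (parts (2 ^ d) k). f I \<in> set (views (2 ^ d) C k) \<and> view_ok C k I (f I)) \<and>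
    (\<forall>I\<in>set (parts (2 ^ d) k). \<forall>J\<in>set (parts (2 ^ d) k). view_cons (f I) (f J))"
proof -
  define S where "S = {i. i < N \<and> C ! i = InG \<and> a i}"
  define xs where "xs = sorted_list_of_set S"
  have fin: "finite S" by (simp add: S_def)
  have xs: "set xs = S" "length xs = k" "sorted_wrt (<) xs"
    using fin a(1) by (simp_all add: xs_def S_def weight_def)
  define g where "g i = (if i = 0 then 0 else if i \<le> k then Suc (xs ! (i - 1)) else Suc N)" for i
  have xsS: "xs ! i \<in> S" if "i < k" for i using that xs nth_mem by blast
  have xsN: "xs ! i < N" if "i < k" for i using xsS[OF that] by (simp add: S_def)
  interpret selected_circuit C a k g
  proof
    show "g i < g (Suc i)" if "i \<le> k" for i
    proof (cases "i = 0 \<or> i = k")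
      case True then show ?thesis using xsN[of "i - 1"] by (auto simp: g_def)
    next
      case False
      then have "xs ! (i - 1) < xs ! i" using sorted_wrt_nth_less[OF xs(3), of "i - 1" i] xs(2) that by auto
      with False that show ?thesis by (auto simp: g_def)
    qed
    show "g 0 = 0" "g (Suc k) = Suc N" by (simp_all add: g_def)
    fix v assume v: "v < N" "C ! v = InG"
    have "a v \<longleftrightarrow> v \<in> set xs" using v xs by (simp add: S_def)
    also have "\<dots> \<longleftrightarrow> (\<exists>j<k. xs ! j = v)" using xs by (auto simp: in_set_conv_nth)
    also have "\<dots> \<longleftrightarrow> (\<exists>i. 1 \<le> i \<and> i \<le> k \<and> g i = Suc v)"
    proof
      assume "\<exists>j<k. xs ! j = v"
      then obtain j where "j < k" "xs ! j = v" by blast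
      then show "\<exists>i. 1 \<le> i \<and> i \<le> k \<and> g i = Suc v" by (intro exI[of _ "Suc j"]) (simp add: g_def)
    next
      assume "\<exists>i. 1 \<le> i \<and> i \<le> k \<and> g i = Suc v"
      then obtain i where "1 \<le> i" "i \<le> k" "g i = Suc v" by blast
      then show "\<exists>j<k. xs ! j = v" by (intro exI[of _ "i - 1"]) (auto simp: g_def)
    qed
    finally show "a v \<longleftrightarrow> (\<exists>i. 1 \<le> i \<and> i \<le> k \<and> g i = Suc v)" .
  qed
  from output_iff_gaps[OF d w] a(2) obtain J where J: "J \<in> set (parts (2 ^ d) k)"
    "\<And>I. I \<in> set (parts (2 ^ d) k) \<Longrightarrow> out_bit C (map gap J) (map gap I)" by blast
  define f where "f I = (map gap J, map gap I)" for I
  have gin: "gtag (nthd InG C (g i - 1)) = 0" if "1 \<le> i" "i \<le> k" for i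
    using xsS[of "i - 1"] that by (auto simp: g_def S_def nthd_def)
  have valid: "valid_gap C k (gap i)" if "i \<le> k" for i
  proof -
    have "g i = 0 \<longleftrightarrow> i = 0" using g_mono[of 0 i] that g_0 by (cases "i = 0") auto
    moreover have "g (Suc i) = Suc N \<longleftrightarrow> i = k" using g_mono[of "Suc i" "Suc k"] that g_k by (cases "i = k") auto
    ultimately show ?thesis
      unfolding valid_gap_def gap_def using g_Suc[OF that] gin[of i] gin[of "Suc i"] that by auto
  qed
  have le: "g i < N + 2" if "i \<le> Suc k" for i using g_mono_le[OF that] g_k by simp
  have "f I \<in> set (views (2 ^ d) C k) \<and> view_ok C k I (f I)" if I: "I \<in> set (parts (2 ^ d) k)" for I
  proof
    show "f I \<in> set (views (2 ^ d) C k)"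
      using I J(1) le by (auto simp: set_views set_parts f_def gap_def)
    show "view_ok C k I (f I)"
      using I J valid unfolding view_ok_def f_def
      by (auto simp: set_parts comp_def gap_def intro!: map_idI)
  qed
  moreover have "view_cons (f I) (f I')" for I I'
    by (auto simp: view_cons_def f_def compat_def gap_def)
  ultimately show ?thesis by blast
qed

lemma selection_of_views:
  assumes d: "depth_le C d" and w: "weft_le C 1"
    and f: "\<And>I. I \<in> set (parts (2 ^ d) k) \<Longrightarrow> f I \<in> set (views (2 ^ d) C k) \<and> view_ok C k I (f I)"
    and f': "\<And>I. I \<in> set (parts (2 ^ d) k) \<Longrightarrow> f' I \<in> set (views (2 ^ d) C k) \<and> view_ok C k I (f' I)"
    and R: "\<And>I J. I \<in> set (parts (2 ^ d) k) \<Longrightarrow> J \<in> set (parts (2 ^ d) k) \<Longrightarrow> view_cons (f I) (f' J)"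
  shows "\<exists>a. weight a C = k \<and> circuit_output a C"
proof -
  \<comment> \<open>The view belonging to the constant tuple of \<open>i\<close> displays gap
    \<open>i\<close>, which makes every single gap accessible.\<close>
  define rp where "rp i = replicate (2 ^ d) i" for i :: nat
  have rp: "rp i \<in> set (parts (2 ^ d) k)" if "i \<le> k" for i using that by (auto simp: rp_def set_parts)
  have two: "(2::nat) ^ d > 0" by simp
  define y where "y i = hd (snd (f' (rp i)))" for i
  have hd_in: "hd (snd V) \<in> set (fst V @ snd V) \<and> fst (hd (snd V)) = i"
    if "V \<in> set (views (2 ^ d) C k)" "view_ok C k (rp i) V" for V i
  proof -
    have "snd V \<noteq> []" using that(1) two by (auto simp: set_views)
    moreover have "map fst (snd V) = rp i" using that(2) by (simp add: view_ok_def)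
    ultimately show ?thesis using two unfolding rp_def
      by (metis UnCI hd_in_set hd_map hd_replicate replicate_0 set_append list.map_disc_iff)
  qed
  have y: "y i \<in> set (fst (f' (rp i)) @ snd (f' (rp i)))" "fst (y i) = i" if "i \<le> k" for i
    using hd_in[OF f'[OF rp[OF that], THEN conjunct1] f'[OF rp[OF that], THEN conjunct2]] unfolding y_def by blast+
  have y_valid: "valid_gap C k (y i)" and y_le: "snd (snd (y i)) < N + 2" if "i \<le> k" for i
    using y(1)[OF that] f'[OF rp[OF that]] unfolding view_ok_def by (blast, auto simp: set_views)
  \<comment> \<open>Comparing first copies with second copies at constant tuples shows that every
    gap mentioned by a first copy is one of the \<open>y i\<close>.\<close>
  have agree: "t = y (fst t)" if "I \<in> set (parts (2 ^ d) k)" "t \<in> set (fst (f I) @ snd (f I))" for I t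
  proof -
    have "fst t \<le> k" using f[OF that(1)] that(2) by (auto simp: set_views)
    then have "compat t (y (fst t))" using R[OF that(1) rp] y(1) that(2) unfolding view_cons_def by blast
    then show ?thesis using y(2)[OF \<open>fst t \<le> k\<close>] by (simp add: compat_def prod_eq_iff)
  qed
  have link: "snd (snd (y i)) = fst (snd (y (Suc i)))" if "Suc i \<le> k" for i
  proof -
    let ?z = "hd (snd (f (rp i)))"
    have i: "i \<le> k" using that by simp
    have z: "?z \<in> set (fst (f (rp i)) @ snd (f (rp i)))" "fst ?z = i" using hd_in[OF f[OF rp[OF i], THEN conjunct1] f[OF rp[OF i], THEN conjunct2]] by blast+
    have "?z = y i" using agree[OF rp[OF i] z(1)] unfolding z(2) .
    moreover have "compat ?z (y (Suc i))"
      using R[OF rp[OF i] rp[OF that]] y(1)[OF that] z(1) unfolding view_cons_def by blast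
    ultimately show ?thesis using y(2)[OF that] z(2) by (simp add: compat_def)
  qed
  define g where "g i = (if i \<le> k then fst (snd (y i)) else Suc N)" for i
  have y_eq: "y i = (i, g i, g (Suc i))" if "i \<le> k" for i
  proof -
    have "snd (snd (y i)) = g (Suc i)"
    proof (cases "i = k")
      case True
      then show ?thesis using y_valid[OF that] y(2)[OF that] by (simp add: valid_gap_def g_def)
    next
      case False
      then show ?thesis using link[of i] that by (simp add: g_def)
    qed
    moreover have "fst (snd (y i)) = g i" using that by (simp add: g_def)
    ultimately show ?thesis using y(2)[OF that] by (simp add: prod_eq_iff)
  qed
  have v: "g i < g (Suc i)" "i = 0 \<longleftrightarrow> g i = 0" "g i \<noteq> 0 \<Longrightarrow> gtag (nthd InG C (g i - 1)) = 0" "g (Suc i) < N + 2" if "i \<le> k" for i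
    using y_valid[OF that] y_le[OF that] unfolding y_eq[OF that] valid_gap_def by simp_all
  define a where "a v \<longleftrightarrow> (\<exists>i. 1 \<le> i \<and> i \<le> k \<and> g i = Suc v)" for v
  interpret selected_circuit C a k g
    by unfold_locales (use v(1) v(2)[of 0] in \<open>auto simp: a_def g_def[of "Suc k"]\<close>)
  have gi: "g i - 1 < N \<and> C ! (g i - 1) = InG \<and> Suc (g i - 1) = g i" if "1 \<le> i" "i \<le> k" for i
  proof -
    have "g i \<noteq> 0" using v(2)[OF that(2)] that by simp
    moreover have "g i < Suc N" using v(1,4)[OF that(2)] by simp
    ultimately have "g i - 1 < N" by simp
    moreover have "gtag (C ! (g i - 1)) = 0" using v(3)[OF that(2) \<open>g i \<noteq> 0\<close>] \<open>g i - 1 < N\<close> by (simp add: nthd_def)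
    then have "C ! (g i - 1) = InG" by (cases "C ! (g i - 1)") auto
    ultimately show ?thesis using \<open>g i \<noteq> 0\<close> by simp
  qed
  have "{i. i < N \<and> C ! i = InG \<and> a i} = (\<lambda>i. g i - 1) ` {1..k}"
  proof (intro equalityI subsetI)
    fix x assume "x \<in> {i. i < N \<and> C ! i = InG \<and> a i}"
    then obtain i where "1 \<le> i" "i \<le> k" "g i = Suc x" by (auto simp: a_def)
    then show "x \<in> (\<lambda>i. g i - 1) ` {1..k}" by (intro image_eqI[of _ _ i]) auto
  next
    fix x assume "x \<in> (\<lambda>i. g i - 1) ` {1..k}"
    then obtain i where i: "1 \<le> i" "i \<le> k" "x = g i - 1" by auto
    with gi[of i] show "x \<in> {i. i < N \<and> C ! i = InG \<and> a i}" unfolding a_def by auto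
  qed
  moreover have "inj_on (\<lambda>i. g i - 1) {1..k}"
  proof (rule inj_onI)
    fix i j assume "i \<in> {1..k}" "j \<in> {1..k}" "g i - 1 = g j - 1"
    then have "g i = g j" using gi[of i] gi[of j] by auto
    then show "i = j" using g_mono[of i j] g_mono[of j i] \<open>i \<in> _\<close> \<open>j \<in> _\<close> by (cases i j rule: linorder_cases) auto
  qed
  ultimately have "weight a C = k" unfolding weight_def by (simp add: card_image)
  have gaps: "map gap (map fst ts) = ts" if "I \<in> set (parts (2 ^ d) k)" "set ts \<subseteq> set (fst (f I) @ snd (f I))" for ts I
  proof -
    have "gap (fst t) = t" if "t \<in> set ts" for t
    proof -
      have t: "t \<in> set (fst (f I) @ snd (f I))" using that \<open>set ts \<subseteq> _\<close> by blast
      moreover have "fst t \<le> k" using f[OF \<open>I \<in> _\<close>] t by (auto simp: set_views)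
      ultimately show ?thesis using agree[OF \<open>I \<in> _\<close> t] y_eq by (simp add: gap_def)
    qed
    then show ?thesis by (simp add: map_idI)
  qed
  define J where "J = map fst (fst (f (rp 0)))"
  have rp0: "rp 0 \<in> set (parts (2 ^ d) k)" by (rule rp) simp
  \<comment> \<open>\<open>view_cons\<close> equates the certificates, so one \<open>J\<close> has
    to withstand all \<open>I\<close>.\<close>
  have fJ: "fst (f I) = map gap J" if "I \<in> set (parts (2 ^ d) k)" for I
  proof -
    have "fst (f I) = fst (f' I)" "fst (f (rp 0)) = fst (f' I)"
      using R[OF that that] R[OF rp0 that] by (simp_all add: view_cons_def)
    then show ?thesis using gaps[OF rp0, of "fst (f (rp 0))"] by (simp add: J_def)
  qed
  have "J \<in> set (parts (2 ^ d) k)" using f[OF rp0] by (auto simp: J_def set_parts set_views)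
  moreover have "out_bit C (map gap J) (map gap I)" if "I \<in> set (parts (2 ^ d) k)" for I
  proof -
    have "map fst (snd (f I)) = I" using f[OF that] by (simp add: view_ok_def)
    then have "snd (f I) = map gap I" using gaps[OF that, of "snd (f I)"] by auto
    then show ?thesis using f[OF that] fJ[OF that] by (simp add: view_ok_def)
  qed
  ultimately have "circuit_output a C" using output_iff_gaps[OF d w] by blast
  with \<open>weight a C = k\<close> show ?thesis by blast
qed

theorem selection_iff:
  assumes "depth_le C d" "weft_le C 1"
  shows "(\<exists>a. weight a C = k \<and> circuit_output a C) \<longleftrightarrow>
    (let Is = parts (2 ^ d) k; U = views (2 ^ d) C k in
      \<exists>v v'. (\<forall>i<length Is. v i < length U \<and> view_ok C k (Is ! i) (U ! v i) \<and>
          v' i < length U \<and> view_ok C k (Is ! i) (U ! v' i)) \<and>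
        (\<forall>i<length Is. \<forall>j<length Is. view_cons (U ! v i) (U ! v' j)))"
proof -
  have "distinct (parts (2 ^ d) k)" by (simp add: parts_def distinct_n_lists)
  show ?thesis
    unfolding Let_def ex_index_iff[OF \<open>distinct _\<close>]
  proof
    assume "\<exists>a. weight a C = k \<and> circuit_output a C"
    then obtain a where "weight a C = k" "circuit_output a C" by blast
    from views_of_selection[OF assms this] obtain f where
      "\<forall>I\<in>set (parts (2 ^ d) k). f I \<in> set (views (2 ^ d) C k) \<and> view_ok C k I (f I)"
      "\<forall>I\<in>set (parts (2 ^ d) k). \<forall>J\<in>set (parts (2 ^ d) k). view_cons (f I) (f J)" by blast
    then show "\<exists>f f'. (\<forall>I\<in>set (parts (2 ^ d) k). f I \<in> set (views (2 ^ d) C k) \<and> view_ok C k I (f I) \<and>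
        f' I \<in> set (views (2 ^ d) C k) \<and> view_ok C k I (f' I)) \<and>
      (\<forall>I\<in>set (parts (2 ^ d) k). \<forall>J\<in>set (parts (2 ^ d) k). view_cons (f I) (f' J))"
      by (intro exI[of _ f]) simp
  next
    assume "\<exists>f f'. (\<forall>I\<in>set (parts (2 ^ d) k). f I \<in> set (views (2 ^ d) C k) \<and> view_ok C k I (f I) \<and>
        f' I \<in> set (views (2 ^ d) C k) \<and> view_ok C k I (f' I)) \<and>
      (\<forall>I\<in>set (parts (2 ^ d) k). \<forall>J\<in>set (parts (2 ^ d) k). view_cons (f I) (f' J))"
    then obtain f f' where f: "\<forall>I\<in>set (parts (2 ^ d) k). f I \<in> set (views (2 ^ d) C k) \<and> view_ok C k I (f I) \<and>
        f' I \<in> set (views (2 ^ d) C k) \<and> view_ok C k I (f' I)"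
      "\<forall>I\<in>set (parts (2 ^ d) k). \<forall>J\<in>set (parts (2 ^ d) k). view_cons (f I) (f' J)" by blast
    show "\<exists>a. weight a C = k \<and> circuit_output a C"
      by (rule selection_of_views[OF assms, where f = f and f' = f']) (use f in auto)
  qed
qed

end


section \<open>The reduction\<close>

instantiation gate :: encd begin
definition "encode = enc_gate"
instance by standard (simp add: encode_gate_def inj_enc_gate)
end

lemma encode_gate: "encode g = Cns (encode (gtag g))
    (case g of InG \<Rightarrow> Nl | NotG j \<Rightarrow> encode j | AndG js \<Rightarrow> encode js | OrG js \<Rightarrow> encode js)"
  by (cases g) (simp_all add: encode_gate_def encode_nat_def encode_list_def)

lemma cm_gtag [cm_intros]: assumes "cm K f" shows "cm K (\<lambda>x. gtag (f x))"
proof -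
  have "cm K (\<lambda>x. case encode (f x) of Nl \<Rightarrow> Nl | Cns u v \<Rightarrow> u)" by (intro cm_intros assms)
  then show ?thesis by (rule cm_encode_cong) (simp add: encode_gate)
qed

lemma cm_preds [cm_intros]: assumes "cm K f" shows "cm K (\<lambda>x. preds (f x))"
proof -
  \<comment> \<open>An input yields the empty list, a negation wraps its number into a singleton,
    and the other gates carry their list already.\<close>
  have "cm K (\<lambda>x. case encode (f x) of Nl \<Rightarrow> Nl | Cns u v \<Rightarrow> if u = Nl then Nl else if u = Cns Nl Nl then Cns v Nl else v)"
    by (intro cm_intros assms)
  then show ?thesis
    by (rule cm_encode_cong) (simp add: encode_gate numeral_2_eq_2 numeral_3_eq_3 split: gate.split)
qed

lemma cm_gate_constrs [cm_intros]:
  "cm K f \<Longrightarrow> cm K (\<lambda>x. NotG (f x))" "cm K h \<Longrightarrow> cm K (\<lambda>x. AndG (h x))" "cm K h \<Longrightarrow> cm K (\<lambda>x. OrG (h x))"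
proof -
  show "cm K (\<lambda>x. NotG (f x))" if "cm K f"
    by (rule cm_encode_cong[OF cm_Pair[OF cm_const[of _ "1 :: nat"] that]]) (simp add: encode_gate)
  show "cm K (\<lambda>x. AndG (h x))" if "cm K h"
    by (rule cm_encode_cong[OF cm_Pair[OF cm_const[of _ "2 :: nat"] that]]) (simp add: encode_gate)
  show "cm K (\<lambda>x. OrG (h x))" if "cm K h"
    by (rule cm_encode_cong[OF cm_Pair[OF cm_const[of _ "3 :: nat"] that]]) (simp add: encode_gate)
qed

text \<open>Decoding is total; malformed inputs are recognised by encoding the result again.\<close>

definition decode_gate :: "data \<Rightarrow> gate" where
  "decode_gate x = (case x of Nl \<Rightarrow> InG | Cns u v \<Rightarrow>
     if length (dlist u) = 0 then InG
     else if length (dlist u) = 1 then NotG (length (dlist v))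
     else if length (dlist u) = 2 then AndG (map (\<lambda>y. length (dlist y)) (dlist v))
     else OrG (map (\<lambda>y. length (dlist y)) (dlist v)))"

lemma length_dlist_encode [simp]: "length (dlist (encode (n :: nat))) = n"
  by (induction n) simp_all

lemma decode_encode_gate [simp]: "decode_gate (encode g) = g"
  by (cases g) (simp_all add: decode_gate_def encode_gate comp_def del: encode_nat)

lemma cm_decode_gate [cm_intros]: assumes "cm K f" shows "cm K (\<lambda>x. decode_gate (f x))"
  unfolding decode_gate_def by (intro cm_intros assms)

section \<open>Computability of the tests on circuits and views\<close>

lemma cm_max: assumes "cm K f" "cm K g" shows "cm K (\<lambda>x. max (f x) (g x) :: nat)"
  unfolding max_def by (intro cm_intros assms)

lemma cm_foldl_max [cm_intros]: assumes "cm K l" shows "cm K (\<lambda>x. foldl max (0 :: nat) (l x))"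
proof (rule cm_foldl[where step = "\<lambda>_. max", OF _ cm_const assms])
  show "cm K (\<lambda>z :: 'a \<times> nat \<times> nat. max (fst (snd z)) (snd (snd z)))" by (intro cm_max cm_intros)
  show "pb K (\<lambda>x. 1 + sz (l x))" by (intro pb_add pb_const cm_sz assms)
  show "sz (foldl max 0 (take n (l x))) \<le> 1 + sz (l x)" for x n
    using foldl_max_mem[of 0 "take n (l x)"] sz_member[of "foldl max 0 (take n (l x))" "l x"]
    by (auto dest: in_set_takeD)
qed

text \<open>One value is stored per gate, so the pass is polynomial as soon as the single values are
  bounded.\<close>

lemma cm_run:
  fixes C :: "'a::encd \<Rightarrow> circuit" and F :: "'a \<Rightarrow> 'v::encd list \<Rightarrow> gate \<Rightarrow> 'v"
  assumes F: "cm K (\<lambda>z. F (fst z) (fst (snd z)) (snd (snd z)))" and C: "cm K C"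
    and B: "pb K B" "\<And>x n v. v \<in> set (run (F x) (take n (C x))) \<Longrightarrow> sz v \<le> B x"
  shows "cm K (\<lambda>x. run (F x) (C x))"
  unfolding run_def
proof (rule cm_foldl[where step = "\<lambda>x vs g. vs @ [F x vs g]", OF _ cm_const C])
  show "cm K (\<lambda>z :: 'a \<times> 'v list \<times> gate. fst (snd z) @ [F (fst z) (fst (snd z)) (snd (snd z))])"
    by (intro cm_intros F)
  show "pb K (\<lambda>x. 1 + sz (C x) * (1 + B x))" by (intro pb_add pb_mult pb_const cm_sz C B)
  fix x n assume n: "n \<le> length (C x)"
  have "sz (run (F x) (take n (C x))) \<le> 1 + length (run (F x) (take n (C x))) * (1 + B x)"
    by (rule sz_list_le) (rule B)
  also have "\<dots> \<le> 1 + sz (C x) * (1 + B x)"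
    using length_le_sz[of "C x"] n by (intro add_mono mult_le_mono) simp_all
  finally show "sz (foldl (\<lambda>vs g. vs @ [F x vs g]) [] (take n (C x))) \<le> 1 + sz (C x) * (1 + B x)"
    by (simp add: run_def)
qed

text \<open>With weights at most 1 the maxima stay below the number of gates, and unary storage
  remains affordable.\<close>

lemma path_step_le:
  assumes "\<And>g. f g \<le> 1" shows "v \<in> set (run (path_step f) C) \<Longrightarrow> v \<le> length C"
proof (induction C arbitrary: v rule: rev_induct)
  case Nil
  then show ?case by (simp add: run_def)
next
  case (snoc g C)
  have le: "nthd 0 (run (path_step f) C) j \<le> length C" for j
    using snoc.IH[of "run (path_step f) C ! j"] by (auto simp: nthd_def)
  have "foldl max 0 (map (nthd 0 (run (path_step f) C)) (preds g)) \<le> length C"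
    using foldl_max_mem[of 0 "map (nthd 0 (run (path_step f) C)) (preds g)"] le by auto
  then have "path_step f (run (path_step f) C) g \<le> Suc (length C)"
    using assms[of g] by (simp add: path_step_def)
  with snoc show ?case by (auto simp: run_snoc le_SucI)
qed

lemma cm_path_max:
  fixes C :: "'a::encd \<Rightarrow> circuit"
  assumes f: "cm K f" "\<And>g. f g \<le> 1" and C: "cm K C" and i: "cm K i"
  shows "cm K (\<lambda>x. path_max f (C x) (i x))"
proof -
  have "cm K (\<lambda>x. run (path_step f) (C x))"
  proof (rule cm_run[OF _ C])
    show "cm K (\<lambda>z :: 'a \<times> nat list \<times> gate. path_step f (fst (snd z)) (snd (snd z)))"
      unfolding path_step_def by (intro cm_intros cm_comp[OF f(1)])
    show "pb K (\<lambda>x. 2 * sz (C x) + 1)" by (intro pb_add pb_mult pb_const cm_sz C)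
    fix x n v assume "v \<in> set (run (path_step f) (take n (C x)))"
    from path_step_le[OF f(2) this] have "v \<le> length (C x)" by simp
    with length_le_sz[of "C x"] show "sz v \<le> 2 * sz (C x) + 1" by simp
  qed
  then show ?thesis unfolding path_max_def by (intro cm_intros i)
qed

lemma cm_weights: "cm K depth_weight" "cm K weft_weight"
  unfolding depth_weight_def[abs_def] weft_weight_def[abs_def] by (intro cm_intros)+

lemma cm_known [cm_intros]:
  assumes "cm K J" "cm K v"
  shows "cm K (\<lambda>x. known_true (J x) (v x))" "cm K (\<lambda>x. known_false (J x) (v x))"
  unfolding known_true_def known_false_def by (intro cm_intros assms cm_comp[OF assms(2)])+

lemma cm_bits_step [cm_intros]:
  assumes "cm K J" "cm K I" "cm K vs" "cm K g" shows "cm K (\<lambda>x. bits_step (J x) (I x) (vs x) (g x))"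
  unfolding bits_step_def by (intro cm_intros assms cm_comp[OF assms(3)])

lemma sz_bits: "sz (z :: bits) \<le> 15"
  using sz_bool_le[of "fst z"] sz_bool_le[of "fst (snd z)"] sz_bool_le[of "fst (snd (snd z))"]
    sz_bool_le[of "snd (snd (snd z))"] sz_pair[of z] sz_pair[of "snd z"] sz_pair[of "snd (snd z)"] by linarith

lemma cm_out_bit [cm_intros]:
  assumes C: "cm K C" and J: "cm K J" and I: "cm K I" shows "cm K (\<lambda>x. out_bit (C x) (J x) (I x))"
proof -
  have "cm K (\<lambda>x. run (bits_step (J x) (I x)) (C x))"
  proof (rule cm_run[OF _ C])
    show "cm K (\<lambda>z :: 'a \<times> bits list \<times> gate. bits_step (J (fst z)) (I (fst z)) (fst (snd z)) (snd (snd z)))"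
      by (intro cm_intros cm_comp[OF J] cm_comp[OF I])
    show "pb K (\<lambda>_ :: 'a. 15)" by (rule pb_const)
  qed (rule sz_bits)
  then show ?thesis unfolding out_bit_def by (intro cm_intros C)
qed

lemma cm_valid_gap [cm_intros]:
  assumes "cm K C" "cm K k" "cm K t" shows "cm K (\<lambda>x. valid_gap (C x) (k x) (t x))"
  unfolding valid_gap_def by (intro cm_intros assms)

lemma cm_compat [cm_intros]:
  assumes "cm K f" "cm K g" shows "cm K (\<lambda>x. compat (f x) (g x))"
  unfolding compat_def by (intro cm_intros assms)

lemma cm_view_cons [cm_intros]:
  assumes "cm K f" "cm K g" shows "cm K (\<lambda>x. view_cons (f x) (g x))"
  unfolding view_cons_def by (intro cm_intros assms cm_comp[OF assms(1)] cm_comp[OF assms(2)])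

lemma cm_view_ok [cm_intros]:
  assumes "cm K C" "cm K k" "cm K I" "cm K V" shows "cm K (\<lambda>x. view_ok (C x) (k x) (I x) (V x))"
  unfolding view_ok_def by (intro cm_intros assms cm_comp[OF assms(1)] cm_comp[OF assms(2)])

lemma cm_parts [cm_intros]: assumes "cm K k" shows "cm K (\<lambda>x. parts q (k x))"
  unfolding parts_def by (intro cm_intros assms)

lemma cm_views [cm_intros]: assumes "cm K C" "cm K k" shows "cm K (\<lambda>x. views q (C x) (k x))"
  unfolding views_def Let_def by (intro cm_intros assms)

section \<open>Computability of the gadget\<close>

lemma cm_times [cm_intros]: assumes "cm K L" "cm K m" shows "cm K (\<lambda>x. times (L x) (m x))"
  unfolding times_def by (intro cm_intros assms)

lemma cm_places [cm_intros]: assumes "cm K L" "cm K m" shows "cm K (\<lambda>x. places (L x) (m x))"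
  unfolding places_def by (intro cm_intros assms)

lemma cm_psize [cm_intros]: assumes "cm K L" "cm K m" shows "cm K (\<lambda>x. psize (L x) (m x))"
  unfolding psize_def by (intro cm_intros assms)

lemma cm_pidx [cm_intros]: assumes "cm K L" "cm K m" "cm K f" shows "cm K (\<lambda>x. pidx (L x) (m x) (f x))"
  unfolding pidx_def by (intro cm_intros assms)

lemma cm_tstart [cm_intros]: assumes "cm K L" "cm K m" "cm K p" shows "cm K (\<lambda>x. tstart (L x) (m x) (p x))"
  unfolding tstart_def tm_def by (intro cm_intros assms)

lemma cm_tfinish [cm_intros]: assumes "cm K L" "cm K m" "cm K p" shows "cm K (\<lambda>x. tfinish (L x) (m x) (p x))"
  unfolding tfinish_def tm_def by (intro cm_intros assms)

lemma cm_gmove: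
  assumes ok: "cm K (\<lambda>z. ok (fst z) (fst (snd z)) (snd (snd z)))" and rel: "cm K (\<lambda>z. rel (fst z) (fst (snd z)) (snd (snd z)))"
    and a: "cm K L" "cm K m" "cm K d" "cm K f" "cm K g"
  shows "cm K (\<lambda>x. gmove (L x) (m x) (ok x) (rel x) (d x) (f x) (g x))"
proof -
  have ok': "cm K (\<lambda>x. ok x (u x) (v x))" if "cm K u" "cm K v" for u v
    using cm_comp3[OF ok cm_id that] .
  have rel': "cm K (\<lambda>x. rel x (u x) (v x))" if "cm K u" "cm K v" for u v
    using cm_comp3[OF rel cm_id that] .
  show ?thesis
    unfolding gmove_def entry_def exit_place_def by (intro ok' rel' cm_intros a)
qed

lemma cm_dsp_n [cm_intros]: assumes "cm K L" "cm K m" shows "cm K (\<lambda>x. dsp_n (L x) (m x))"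
  unfolding dsp_n_def by (intro cm_intros assms)

lemma cm_dsp_vss [cm_intros]: assumes "cm K L" "cm K m" shows "cm K (\<lambda>x. dsp_vss (L x) (m x))"
  unfolding dsp_vss_def by (intro cm_intros assms cm_comp[OF assms(1)] cm_comp[OF assms(2)])

lemma cm_dsp_rs [cm_intros]: assumes "cm K L" "cm K m" shows "cm K (\<lambda>x. dsp_rs (L x) (m x))"
  unfolding dsp_rs_def by (intro cm_intros assms cm_comp[OF assms(1)] cm_comp[OF assms(2)])

lemma cm_dsp_es:
  fixes L m :: "'a::encd \<Rightarrow> nat"
  assumes ok: "cm K (\<lambda>z. ok (fst z) (fst (snd z)) (snd (snd z)))" and rel: "cm K (\<lambda>z. rel (fst z) (fst (snd z)) (snd (snd z)))"
    and a: "cm K L" "cm K m"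
  shows "cm K (\<lambda>x. dsp_es (L x) (m x) (ok x) (rel x))"
proof -
  have ok': "cm K (\<lambda>z :: ('a \<times> nat \<times> nat \<times> nat) \<times> nat \<times> nat. ok (fst (fst z)) (fst (snd z)) (snd (snd z)))"
    by (rule cm_comp3[OF ok]) (intro cm_intros)+
  have rel': "cm K (\<lambda>z :: ('a \<times> nat \<times> nat \<times> nat) \<times> nat \<times> nat. rel (fst (fst z)) (fst (snd z)) (snd (snd z)))"
    by (rule cm_comp3[OF rel]) (intro cm_intros)+
  show ?thesis
    unfolding dsp_es_def
    by (intro cm_gmove[where ok = "\<lambda>z. ok (fst z)" and rel = "\<lambda>z. rel (fst z)", OF ok' rel'] cm_intros a
        cm_comp[OF a(1)] cm_comp[OF a(2)])
qed

section \<open>The reduction map and its correctness\<close>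

definition ok_at :: "circuit \<Rightarrow> nat \<Rightarrow> nat list list \<Rightarrow> view list \<Rightarrow> nat \<Rightarrow> nat \<Rightarrow> bool" where
  "ok_at C k Is U i c \<longleftrightarrow> view_ok C k (nthd [] Is i) (nthd ([], []) U c)"

definition rel_at :: "view list \<Rightarrow> nat \<Rightarrow> nat \<Rightarrow> bool" where
  "rel_at U b c \<longleftrightarrow> view_cons (nthd ([], []) U b) (nthd ([], []) U c)"

definition dsp_of :: "nat \<Rightarrow> circuit \<Rightarrow> nat \<Rightarrow> dsp_instance" where
  "dsp_of d C k = (let Is = parts (2 ^ d) k; U = views (2 ^ d) C k in
     (dsp_n (length Is) (length U), dsp_vss (length Is) (length U),
      dsp_es (length Is) (length U) (ok_at C k Is U) (rel_at U), dsp_rs (length Is) (length U)))"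

lemma cm_dsp_of [cm_intros]:
  assumes C: "cm K C" and k: "cm K k" shows "cm K (\<lambda>x. dsp_of d (C x) (k x))"
proof -
  have "cm K (\<lambda>x. dsp_es (length (parts (2 ^ d) (k x))) (length (views (2 ^ d) (C x) (k x)))
      (ok_at (C x) (k x) (parts (2 ^ d) (k x)) (views (2 ^ d) (C x) (k x))) (rel_at (views (2 ^ d) (C x) (k x))))"
    by (rule cm_dsp_es; (unfold ok_at_def rel_at_def)?) (intro cm_intros C k cm_comp[OF C] cm_comp[OF k])+
  then show ?thesis unfolding dsp_of_def Let_def by (intro cm_intros C k)
qed

text \<open>\<open>wf_circuit\<close> rewritten with list-bounded quantifiers and total indexing,
  the form to which the closure lemmas apply.\<close>

definition wf_test :: "circuit \<Rightarrow> bool" where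
  "wf_test C \<longleftrightarrow> C \<noteq> [] \<and> (\<forall>i\<in>set [0..<length C]. let g = nthd InG C i in
     (gtag g < 2 \<or> 2 \<le> length (preds g)) \<and>
     (\<forall>a\<in>set [0..<length (preds g)]. \<forall>b\<in>set [0..<a]. nthd 0 (preds g) a \<noteq> nthd 0 (preds g) b) \<and>
     (\<forall>j\<in>set (preds g). j < i))"

lemma wf_test: "wf_test C \<longleftrightarrow> wf_circuit C"
proof -
  have ar: "arity_ok g \<longleftrightarrow> gtag g < 2 \<or> 2 \<le> length (preds g)" for g by (cases g) auto
  have di: "distinct js \<longleftrightarrow> (\<forall>a\<in>set [0..<length js]. \<forall>b\<in>set [0..<a]. nthd 0 js a \<noteq> nthd 0 js b)" for js :: "nat list"
  proof
    assume "distinct js"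
    then show "\<forall>a\<in>set [0..<length js]. \<forall>b\<in>set [0..<a]. nthd 0 js a \<noteq> nthd 0 js b"
      by (auto simp: nthd_def nth_eq_iff_index_eq)
  next
    assume *: "\<forall>a\<in>set [0..<length js]. \<forall>b\<in>set [0..<a]. nthd 0 js a \<noteq> nthd 0 js b"
    have "js ! a \<noteq> js ! b" if "b < a" "a < length js" for a b
      using *[rule_format, of a b] that by (simp add: nthd_def)
    then show "distinct js" unfolding distinct_conv_nth by (metis linorder_neqE_nat)
  qed
  show ?thesis
    unfolding wf_test_def wf_circuit_def Let_def ar di by (auto simp: nthd_def)
qed

lemma cm_wf_test [cm_intros]: assumes "cm K C" shows "cm K (\<lambda>x. wf_test (C x))"
  unfolding wf_test_def Let_def by (intro cm_intros assms cm_comp[OF assms])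

text \<open>\<open>Nl\<close> is not the encoding of any instance, so \<open>(Nl, 0)\<close> is a
  safe answer for malformed inputs and for circuits outside the class.\<close>

definition reduction :: "nat \<Rightarrow> data \<times> nat \<Rightarrow> data \<times> nat" where
  "reduction d p = (let C = map decode_gate (dlist (fst p)) in
     if encode C = fst p \<and> wf_test C \<and> path_max depth_weight C (length C - 1) \<le> d \<and>
       path_max weft_weight C (length C - 1) \<le> 1
     then (encode (dsp_of d C (snd p)), length (snd (snd (snd (dsp_of d C (snd p)))))) else (Nl, 0))"

lemma cm_reduction: "cm True (reduction d)"
proof -
  have "depth_weight g \<le> 1" "weft_weight g \<le> 1" for g by (simp_all add: depth_weight_def weft_weight_def)
  note w = cm_path_max[OF cm_weights(1) this(1)] cm_path_max[OF cm_weights(2) this(2)]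
  show ?thesis
    unfolding reduction_def[abs_def] Let_def by (intro cm_intros w)
qed

lemma dsp_of_correct:
  assumes "wf_circuit C" "depth_le C d" "weft_le C 1"
  shows "(encode (dsp_of d C k), length (snd (snd (snd (dsp_of d C k))))) \<in> one_DSP \<longleftrightarrow>
    (\<exists>a. weight a C = k \<and> circuit_output a C)"
proof -
  let ?Is = "parts (2 ^ d) k" and ?U = "views (2 ^ d) C k"
  let ?L = "length ?Is" and ?m = "length ?U"
  interpret circuit C by unfold_locales (rule assms(1))
  have enc: "enc_dsp = encode"
    by (simp add: enc_dsp_def encode_prod_def encode_list_def encode_nat_def)
  have L: "?L > 0" by (simp add: parts_def length_n_lists)
  have m: "?m > 0" by (simp add: views_def Let_def length_n_lists)
  have dsp: "dsp_of d C k = (dsp_n ?L ?m, dsp_vss ?L ?m, dsp_es ?L ?m (ok_at C k ?Is ?U) (rel_at ?U), dsp_rs ?L ?m)"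
    by (simp add: dsp_of_def Let_def)
  have "(encode (dsp_of d C k), length (snd (snd (snd (dsp_of d C k))))) \<in> one_DSP \<longleftrightarrow>
    (let V = {..<dsp_n ?L ?m}; E = (\<lambda>(u, v). {u, v}) ` set (dsp_es ?L ?m (ok_at C k ?Is ?U) (rel_at ?U)); Vs = map set (dsp_vss ?L ?m) in
       one_shortest_graph V E Vs \<and> set (dsp_rs ?L ?m) \<subseteq> V \<times> V \<and> DSP_solvable V E Vs (dsp_rs ?L ?m))"
    unfolding one_DSP_def enc dsp by (auto simp del: encode_Pair)
  also have "\<dots> \<longleftrightarrow> (\<exists>v v'. (\<forall>i<?L. v i < ?m \<and> ok_at C k ?Is ?U i (v i) \<and> v' i < ?m \<and> ok_at C k ?Is ?U i (v' i)) \<and>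
      (\<forall>i<?L. \<forall>j<?L. rel_at ?U (v i) (v' j)))"
    by (rule gadget_dsp[OF L m])
  also have "\<dots> \<longleftrightarrow> (\<exists>v v'. (\<forall>i<?L. v i < ?m \<and> view_ok C k (?Is ! i) (?U ! v i) \<and> v' i < ?m \<and> view_ok C k (?Is ! i) (?U ! v' i)) \<and>
      (\<forall>i<?L. \<forall>j<?L. view_cons (?U ! v i) (?U ! v' j)))"
  proof (intro ex_cong1 conj_cong refl)
    fix v v' :: "nat \<Rightarrow> nat"
    show "(\<forall>i<?L. v i < ?m \<and> ok_at C k ?Is ?U i (v i) \<and> v' i < ?m \<and> ok_at C k ?Is ?U i (v' i)) =
      (\<forall>i<?L. v i < ?m \<and> view_ok C k (?Is ! i) (?U ! v i) \<and> v' i < ?m \<and> view_ok C k (?Is ! i) (?U ! v' i))"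
      by (auto simp: ok_at_def nthd_def)
    show "(\<forall>i<?L. \<forall>j<?L. rel_at ?U (v i) (v' j)) = (\<forall>i<?L. \<forall>j<?L. view_cons (?U ! v i) (?U ! v' j))"
      if "\<forall>i<?L. v i < ?m \<and> view_ok C k (?Is ! i) (?U ! v i) \<and> v' i < ?m \<and> view_ok C k (?Is ! i) (?U ! v' i)"
      using that by (simp add: rel_at_def nthd_def)
  qed
  also have "\<dots> \<longleftrightarrow> (\<exists>a. weight a C = k \<and> circuit_output a C)"
    using selection_iff[OF assms(2,3), of k] by (simp add: Let_def)
  finally show ?thesis .
qed

lemma reduction_correct: "(x, k) \<in> WCS 1 d \<longleftrightarrow> reduction d (x, k) \<in> one_DSP"
proof -
  let ?C = "map decode_gate (dlist x)"
  have enc: "enc_circuit = encode" by (simp add: enc_circuit_def encode_list_def encode_gate_def)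
  have no: "(Nl, 0) \<notin> one_DSP" by (auto simp: one_DSP_def enc_dsp_def enc_pair_def)
  have test: "path_max depth_weight C (length C - 1) \<le> d \<and> path_max weft_weight C (length C - 1) \<le> 1 \<longleftrightarrow>
      depth_le C d \<and> weft_le C 1" if "wf_circuit C" for C
    using circuit.depth_le_iff circuit.weft_le_iff that unfolding circuit_def by blast
  have dec: "?C = C" if "x = encode C" for C :: circuit
    using that by (simp add: comp_def)
  show ?thesis
  proof (cases "encode ?C = x \<and> wf_circuit ?C \<and> depth_le ?C d \<and> weft_le ?C 1")
    case True
    then have "reduction d (x, k) = (encode (dsp_of d ?C k), length (snd (snd (snd (dsp_of d ?C k)))))"
      using test[of ?C] unfolding reduction_def Let_def wf_test by simp
    moreover have "(x, k) \<in> WCS 1 d \<longleftrightarrow> (\<exists>a. weight a ?C = k \<and> circuit_output a ?C)"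
      unfolding WCS_def enc using True dec by (auto simp del: encode_list) metis
    ultimately show ?thesis using dsp_of_correct True by simp
  next
    case False
    then have "reduction d (x, k) = (Nl, 0)"
      using test[of ?C] unfolding reduction_def Let_def wf_test by auto
    moreover have "(x, k) \<notin> WCS 1 d"
    proof
      assume "(x, k) \<in> WCS 1 d"
      then obtain C where "x = encode C" "wf_circuit C" "weft_le C 1" "depth_le C d"
        unfolding WCS_def enc by blast
      with dec False show False by simp
    qed
    ultimately show ?thesis using no by simp
  qed
qed

lemma WCS_reducible: "WCS 1 d \<le>\<^sub>f\<^sub>p\<^sub>t one_DSP"
proof (rule polytime_reduction[OF cm_reduction reduction_correct])
  \<comment> \<open>There are \<open>2 * L + L * L\<close> requests, where
    \<open>L = Suc k ^ (2 ^ d)\<close> counts the index tuples.\<close>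
  let ?g = "\<lambda>k. 2 * Suc k ^ (2 ^ d) + Suc k ^ (2 ^ d) * Suc k ^ (2 ^ d)"
  show "cm False ?g" by (intro cm_intros)
  show "snd (reduction d (x, k)) \<le> ?g k" for x k
    by (simp add: reduction_def Let_def dsp_of_def dsp_rs_def parts_def length_n_lists)
qed

theorem theorem5:
  shows "W_hard 1 one_DSP"
  \<comment> \<open>A problem in \<open>W 1\<close> comes with a fixed \<open>d\<close>, so it is
    harmless that the polynomial and the parameter bound of the reduction depend on
    \<open>d\<close>.\<close>
  unfolding W_hard_def W_def using WCS_reducible fpt_reducible_trans by blast

end
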